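(* Let $\alpha>0$ and $\kappa>0$ be constants independent of $n$, let $m=\alpha n$, and let $H$ be an $m\times n$ matrix with i.i.d. standard normal components. For $\beta\in(0,1]$ define $$\xi_{box,r}(\beta)=\min_{\mathbf{x}_i\in\left[-\frac{1}{\sqrt{\beta n}},\frac{1}{\sqrt{\beta n}}\right],\ \|\mathbf{x}\|_2\le1}\ \max_{\|\lambda\|_2\le1,\ \lambda_i\ge0}\left(\frac{\kappa}{\sqrt\beta}\lambda^T\mathbf{1}-\lambda^TH\mathbf{x}\right),\qquad \xi_{box,r}=\min_{\beta\in(0,1]}\xi_{box,r}(\beta),$$ $$\xi_{box}(\beta)=\min_{\mathbf{x}_i\in\left[-\frac{1}{\sqrt{\beta n}},\frac{1}{\sqrt{\beta n}}\right],\ \|\mathbf{x}\|_2^2=1}\ \max_{\|\lambda\|_2=1,\ \lambda_i\ge0}\left(\frac{\kappa}{\sqrt\beta}\lambda^T\mathbf{1}-\lambda^TH\mathbf{x}\right),\qquad \xi_{box}=\min_{\beta\in(0,1]}\xi_{box}(\beta).$$ Set $$f_{gar}\left(\frac{\kappa}{\sqrt\beta}\right)=\frac{1}{\sqrt{2\pi}}\int_{-\frac{\kappa}{\sqrt\beta}}^\infty\left(z+\frac{\kappa}{\sqrt\beta}\right)^2e^{-\frac{z^2}{2}}dz=\frac{1}{\sqrt{2\pi}}\int_{-\infty}^{\frac{\kappa}{\sqrt\beta}}\left(z-\frac{\kappa}{\sqrt\beta}\right)^2e^{-\frac{z^2}{2}}dz=\frac{\kappa e^{-\frac{\kappa^2}{2\beta}}}{\sqrt{2\beta\pi}}+\frac{\left(\frac{\kappa^2}{\beta}+1\right)\mathrm{erfc}\left(-\frac{\kappa}{\sqrt{2\beta}}\right)}{2}$$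 and $$\widehat{f_{box}}(\beta)=\frac{1}{\sqrt\beta}\max_{\gamma\ge0}\left(-\frac{e^{-2\gamma^2}}{\sqrt{2\pi}}+\gamma\,\mathrm{erfc}\left(\frac{2\gamma}{\sqrt2}\right)-\frac{1}{4\gamma}\left(\mathrm{erfc}\left(-\frac{2\gamma}{\sqrt2}\right)-1\right)-\gamma\beta\right).$$ Let $\epsilon_1^{(m)},\epsilon_1^{(n)},\epsilon_5^{(g)}$ be arbitrarily small positive constants independent of $n$. (i) Let $\beta\in(0,1]$ be a constant independent of $n$. If $\alpha$ is such that $$-(1-\epsilon_1^{(n)})\widehat{f_{box}}(\beta)-(1+\epsilon_1^{(m)})\sqrt{\alpha f_{gar}\left(\frac{\kappa}{\sqrt\beta}\right)}-\epsilon_5^{(g)}>0,$$ then $$\lim_{n\to\infty}P\left(\xi_{box,r}(\beta)>0\right)=1-\lim_{n\to\infty}P\left(\xi_{box,r}(\beta)\le0\right)\le0$$ (i.e. the limit on the left equals $0$). (ii) If $\alpha$ is such that $$\max_{\beta\in(0,1]}\left(-(1-\epsilon_1^{(n)})\widehat{f_{box}}(\beta)-(1+\epsilon_1^{(m)})\sqrt{\alpha f_{gar}\left(\frac{\kappa}{\sqrt\beta}\right)}-\epsilon_5^{(g)}\right)>0,$$ then $$\lim_{n\to\infty}P\left(\xi_{box,r}>0\right)=\lim_{n\to\infty}P\left(\xi_{box}>0\right)\le0$$ (i.e. both limits equal $0$), and with overwhelming probability the system $$H\mathbf{x}\ge\kappa,\qquad\mathbf{x}_i\in\left[-\frac{1}{\sqrt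 n},\frac{1}{\sqrt n}\right],\ 1\le i\le n,$$ is feasible.
   Context: Throughout $\mathbf{x}\in\mathbb{R}^n$, $\lambda\in\mathbb{R}^m$, and $\mathbf{1}$ is the $m$-dimensional all-ones vector. $H\mathbf{x}\ge\kappa$ means that every component of $H\mathbf{x}$ is at least $\kappa$. $\mathrm{erfc}(x)=\frac{2}{\sqrt\pi}\int_x^\infty e^{-t^2}dt$. Minima and maxima over $\beta$ and $\gamma$ are understood as infima and suprema when not attained, and the expression maximized over $\gamma$ is extended to $\gamma=0$ by its limit. The regime is $n\to\infty$ with $m=\alpha n$ (rounded to an integer if necessary). "With overwhelming probability" means with probability (over $H$) at least $1$ minus a quantity decaying exponentially in $n$. *)

theory Defs
  imports "HOL-Probability.Probability"
begin

definition erfc :: "real \<Rightarrow> real" where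
  "erfc x = 2 / sqrt pi * (LBINT t:{x..}. exp (- t\<^sup>2))"

text \<open>A vector of dimension \<open>n\<close> is a function in \<open>{..<n} \<rightarrow>\<^sub>E UNIV\<close>, its Euclidean norm is
  \<^term>\<open>L2_set x {..<n}\<close>, and an \<open>m \<times> n\<close> matrix is given by its entries \<open>H i j\<close> for
  \<open>i < m\<close> and \<open>j < n\<close>.\<close>

definition mat_vec :: "nat \<Rightarrow> (nat \<Rightarrow> nat \<Rightarrow> real) \<Rightarrow> (nat \<Rightarrow> real) \<Rightarrow> nat \<Rightarrow> real" where
  "mat_vec n H x i = (\<Sum>j<n. H i j * x j)"

definition iid_std_normal_matrix ::
  "'w measure \<Rightarrow> nat \<Rightarrow> nat \<Rightarrow> ('w \<Rightarrow> nat \<Rightarrow> nat \<Rightarrow> real) \<Rightarrow> bool" where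
  "iid_std_normal_matrix M m n H \<longleftrightarrow>
     prob_space M \<and>
     prob_space.indep_vars M (\<lambda>_. borel) (\<lambda>(i, j) w. H w i j) ({..<m} \<times> {..<n}) \<and>
     (\<forall>i<m. \<forall>j<n. distributed M lborel (\<lambda>w. H w i j) (\<lambda>z. ennreal (std_normal_density z)))"

definition scaled_box :: "real \<Rightarrow> nat \<Rightarrow> (nat \<Rightarrow> real) set" where
  "scaled_box \<beta> n = {..<n} \<rightarrow>\<^sub>E {- (1 / sqrt (\<beta> * real n)) .. 1 / sqrt (\<beta> * real n)}"

definition objective ::
  "real \<Rightarrow> real \<Rightarrow> nat \<Rightarrow> nat \<Rightarrow> (nat \<Rightarrow> nat \<Rightarrow> real) \<Rightarrow> (nat \<Rightarrow> real) \<Rightarrow> (nat \<Rightarrow> real) \<Rightarrow> real" where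
  "objective \<kappa> \<beta> m n H x l =
     \<kappa> / sqrt \<beta> * (\<Sum>i<m. l i) - (\<Sum>i<m. l i * mat_vec n H x i)"

text \<open>In the next four definitions every supremum is over a bounded set and every infimum over a
  set bounded below, and for \<open>m, n \<ge> 1\<close> and \<open>0 < \<beta> \<le> 1\<close> all index sets are nonempty, so the
  real-valued \<open>INF\<close> and \<open>SUP\<close> are the genuine infima and suprema.\<close>

definition xi_box_r_at ::
  "real \<Rightarrow> nat \<Rightarrow> nat \<Rightarrow> (nat \<Rightarrow> nat \<Rightarrow> real) \<Rightarrow> real \<Rightarrow> real" where
  "xi_box_r_at \<kappa> m n H \<beta> =
     (INF x \<in> {x \<in> scaled_box \<beta> n. L2_set x {..<n} \<le> 1}.
        SUP l \<in> {l \<in> {..<m} \<rightarrow>\<^sub>E {0..}. L2_set l {..<m} \<le> 1}. objective \<kappa> \<beta> m n H x l)"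

definition xi_box_r :: "real \<Rightarrow> nat \<Rightarrow> nat \<Rightarrow> (nat \<Rightarrow> nat \<Rightarrow> real) \<Rightarrow> real" where
  "xi_box_r \<kappa> m n H = (INF \<beta> \<in> {0<..1}. xi_box_r_at \<kappa> m n H \<beta>)"

definition xi_box_at ::
  "real \<Rightarrow> nat \<Rightarrow> nat \<Rightarrow> (nat \<Rightarrow> nat \<Rightarrow> real) \<Rightarrow> real \<Rightarrow> real" where
  "xi_box_at \<kappa> m n H \<beta> =
     (INF x \<in> {x \<in> scaled_box \<beta> n. (L2_set x {..<n})\<^sup>2 = 1}.
        SUP l \<in> {l \<in> {..<m} \<rightarrow>\<^sub>E {0..}. L2_set l {..<m} = 1}. objective \<kappa> \<beta> m n H x l)"

definition xi_box :: "real \<Rightarrow> nat \<Rightarrow> nat \<Rightarrow> (nat \<Rightarrow> nat \<Rightarrow> real) \<Rightarrow> real" where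
  "xi_box \<kappa> m n H = (INF \<beta> \<in> {0<..1}. xi_box_at \<kappa> m n H \<beta>)"

definition box_feasible :: "real \<Rightarrow> nat \<Rightarrow> nat \<Rightarrow> (nat \<Rightarrow> nat \<Rightarrow> real) \<Rightarrow> bool" where
  "box_feasible \<kappa> m n H \<longleftrightarrow>
     (\<exists>x \<in> {..<n} \<rightarrow>\<^sub>E {- (1 / sqrt (real n)) .. 1 / sqrt (real n)}. \<forall>i<m. mat_vec n H x i \<ge> \<kappa>)"

definition f_gar :: "real \<Rightarrow> real" where
  "f_gar c = 1 / sqrt (2 * pi) * (LBINT z:{- c..}. (z + c)\<^sup>2 * exp (- (z\<^sup>2 / 2)))"

definition f_box_expr :: "real \<Rightarrow> real \<Rightarrow> real" where
  "f_box_expr \<beta> \<gamma> =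
     - (exp (- 2 * \<gamma>\<^sup>2) / sqrt (2 * pi)) + \<gamma> * erfc (2 * \<gamma> / sqrt 2)
     - 1 / (4 * \<gamma>) * (erfc (- (2 * \<gamma> / sqrt 2)) - 1) - \<gamma> * \<beta>"

text \<open>The value at \<open>\<gamma> = 0\<close> has to be set separately: with \<open>1 / 0 = 0\<close> the expression
  would evaluate to \<open>- 1 / sqrt (2 * pi)\<close> there, whereas its limit is \<open>- 2 / sqrt (2 * pi)\<close>.\<close>

definition f_box_hat :: "real \<Rightarrow> real" where
  "f_box_hat \<beta> =
     1 / sqrt \<beta> *
     (SUP \<gamma> \<in> {0..}. if \<gamma> = 0 then Lim (at_right 0) (f_box_expr \<beta>) else f_box_expr \<beta> \<gamma>)"

definition feasibility_margin ::
  "real \<Rightarrow> real \<Rightarrow> real \<Rightarrow> real \<Rightarrow> real \<Rightarrow> real \<Rightarrow> real" where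
  "feasibility_margin \<alpha> \<kappa> \<epsilon>1m \<epsilon>1n \<epsilon>5g \<beta> =
     - (1 - \<epsilon>1n) * f_box_hat \<beta> - (1 + \<epsilon>1m) * sqrt (\<alpha> * f_gar (\<kappa> / sqrt \<beta>)) - \<epsilon>5g"

end

theory Submission
  imports Defs
begin

text \<open>A system \<open>H x \<ge> c\<close> with \<open>x\<close> in a compact convex set fails to be solvable only if some
  \<open>l \<ge> 0\<close> satisfies \<open>max_x l \<bullet> H x < c (\<Sum> l_i)\<close>; this turns feasibility into a lower bound on a
  minimum over \<open>l\<close> of a maximum over \<open>x\<close>. Gordon's comparison theorem bounds the probability
  of that event from below after replacing \<open>l \<bullet> H x + \<parallel>l\<parallel> \<parallel>x\<parallel> g_0\<close> by
  \<open>\<parallel>l\<parallel> (g \<bullet> x) + \<parallel>x\<parallel> (h \<bullet> l)\<close> with independent Gaussian vectors \<open>g\<close>, \<open>h\<close>.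
  For the decoupled process take \<open>x_j\<close> proportional to \<open>g_j / (2 \<gamma>)\<close> clipped to \<open>[-1, 1]\<close>,
  where \<open>\<gamma>\<close> is a nearly optimal multiplier in \<open>f_box_hat\<close>: then \<open>g \<bullet> x\<close> concentrates near
  \<open>- sqrt n f_box_hat \<beta>\<close>, whereas the contribution of \<open>h\<close> costs at most about
  \<open>sqrt (\<alpha> n f_gar (\<kappa> / sqrt \<beta>))\<close>. All quantities involved are sums of independent variables, so
  Chernoff bounds give exponential rates.\<close>

section \<open>Gaussian integration by parts\<close>

text \<open>Gordon's theorem is proved for finite families, whereas feasibility ranges over
  continua; rational points join the two. Rounding is harmless at both ends: infeasibility produces
  a certificate with a positive margin, and the decoupled inequality is strict. Rationality excludes
  normalising l, so every test, including the threshold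
  \<open>c * (\<Sum>i<m. l i) + t * sqrt (real n) * L2_set l {..<m}\<close>, is kept positively
  homogeneous in l. The last term pays for the scalar \<open>g_0\<close>, which the comparison needs
  in order that both processes have the same covariances whenever l is the same. The clipped vector
  comes from Lagrange duality: up to sign and scaling, \<open>f_box_hat\<close> is the dual of
  maximising the mean of g y subject to |y| \<le> 1 and a mean square of at most \<beta>, and
  \<gamma> is the multiplier of the latter constraint. The resulting x serves all l at once, but its
  norm may stay below 1; convexity of the squared hinge absorbs this. Infima over uncountable sets
  are measurable here because they are Lipschitz in the matrix entries.\<close>

definition gauss :: "real measure" where
  "gauss = density lborel (\<lambda>x. ennreal (std_normal_density x))"

lemma prob_space_gauss [simp]: "prob_space gauss"
  unfolding gauss_def by (rule prob_space_normal_density) simp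

lemma space_gauss [simp]: "space gauss = UNIV"
  by (simp add: gauss_def)

lemma sets_gauss [simp, measurable_cong]: "sets gauss = sets borel"
  by (simp add: gauss_def)

lemma integrable_gauss_iff:
  fixes f :: "real \<Rightarrow> real"
  assumes "f \<in> borel_measurable borel"
  shows "integrable gauss f \<longleftrightarrow> integrable lborel (\<lambda>x. std_normal_density x * f x)"
  unfolding gauss_def using assms by (subst integrable_density) auto

lemma integral_gauss:
  fixes f :: "real \<Rightarrow> real"
  assumes "f \<in> borel_measurable borel"
  shows "integral\<^sup>L gauss f = (LBINT x. std_normal_density x * f x)"
  unfolding gauss_def using assms by (subst integral_density) auto

lemma integrable_gauss_power: "integrable gauss (\<lambda>x. x ^ k)"
  by (subst integrable_gauss_iff) (auto simp: integrable_std_normal_moment)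

lemma integrable_gauss_id: "integrable gauss (\<lambda>x. x)"
  using integrable_gauss_power[of 1] by simp

lemma integral_gauss_id: "integral\<^sup>L gauss (\<lambda>x. x) = 0"
  using integral_std_normal_moment_odd[of 0] by (subst integral_gauss) auto

lemma integral_gauss_square: "integral\<^sup>L gauss (\<lambda>x. x\<^sup>2) = 1"
  using integral_std_normal_moment_even[of 1] by (subst integral_gauss) (auto simp: eval_nat_numeral)

lemma integrable_gauss_bounded:
  fixes f :: "real \<Rightarrow> real"
  assumes [measurable]: "f \<in> borel_measurable borel" and "\<And>x. \<bar>f x\<bar> \<le> B"
  shows "integrable gauss f"
proof -
  interpret prob_space gauss by simp
  show ?thesis by (rule integrable_const_bound[where B=B]) (use assms in auto)
qed

lemma DERIV_std_normal_density:
  "(std_normal_density has_real_derivative - (x * std_normal_density x)) (at x)"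
  unfolding std_normal_density_def[abs_def]
  by (auto intro!: derivative_eq_intros simp: field_simps)

lemma std_normal_density_tendsto:
  "(std_normal_density \<longlongrightarrow> 0) at_top" "(std_normal_density \<longlongrightarrow> 0) at_bot"
proof -
  have *: "((\<lambda>x::real. exp (- x\<^sup>2 / 2)) \<longlongrightarrow> 0) at_top" "((\<lambda>x::real. exp (- x\<^sup>2 / 2)) \<longlongrightarrow> 0) at_bot"
    by real_asymp+
  show "(std_normal_density \<longlongrightarrow> 0) at_top" "(std_normal_density \<longlongrightarrow> 0) at_bot"
    unfolding std_normal_density_def[abs_def]
    using tendsto_mult[OF tendsto_const[of "1 / sqrt (2*pi)"] *(1)]
      tendsto_mult[OF tendsto_const[of "1 / sqrt (2*pi)"] *(2)] by simp_all
qed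

text \<open>Stein's identity: the difference of the two integrands against the density has the
  antiderivative \<open>- (std_normal_density x * g x)\<close>, up to sign, and boundedness of
  \<open>g\<close> makes this vanish at both infinities. The boundedness hypotheses fit the smoothed
  indicators to which the identity is applied.\<close>

lemma gauss_integration_by_parts:
  fixes g g' :: "real \<Rightarrow> real"
  assumes deriv: "\<And>x. (g has_real_derivative g' x) (at x)"
    and cont: "\<And>x. isCont g' x"
    and bound: "\<And>x. \<bar>g x\<bar> \<le> B" "\<And>x. \<bar>g' x\<bar> \<le> B"
  shows "(\<integral>x. x * g x \<partial>gauss) = (\<integral>x. g' x \<partial>gauss)"
proof -
  have contg: "isCont g x" for x using deriv DERIV_isCont by blast
  have mg[measurable]: "g \<in> borel_measurable borel" "g' \<in> borel_measurable borel"
    using contg cont by (auto intro!: borel_measurable_continuous_onI continuous_at_imp_continuous_on)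
  have B: "B \<ge> 0" using bound(1)[of 0] by linarith
  define F where "F x = - (std_normal_density x * g x)" for x
  define f where "f x = std_normal_density x * (x * g x) - std_normal_density x * g' x" for x
  have 1: "integrable lborel (\<lambda>x. std_normal_density x * (x * g x))"
  proof (rule Bochner_Integration.integrable_bound)
    show "integrable lborel (\<lambda>x. B * (std_normal_density x * \<bar>x\<bar>^1))"
      by (intro integrable_mult_right integrable_std_normal_moment_abs)
    show "AE x in lborel. norm (std_normal_density x * (x * g x)) \<le> norm (B * (std_normal_density x * \<bar>x\<bar>^1))"
    proof (rule AE_I2)
      fix x
      have "\<bar>g x\<bar> * (std_normal_density x * \<bar>x\<bar>) \<le> B * (std_normal_density x * \<bar>x\<bar>)"
        by (intro mult_right_mono bound) simp
      then show "norm (std_normal_density x * (x * g x)) \<le> norm (B * (std_normal_density x * \<bar>x\<bar>^1))"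
        using B by (simp add: abs_mult ac_simps)
    qed
  qed simp
  have 2: "integrable lborel (\<lambda>x. std_normal_density x * g' x)"
  proof (rule Bochner_Integration.integrable_bound)
    show "integrable lborel (\<lambda>x. B * std_normal_density x)" by simp
    show "AE x in lborel. norm (std_normal_density x * g' x) \<le> norm (B * std_normal_density x)"
      using bound(2) B by (auto simp: abs_mult mult.commute intro!: AE_I2 mult_right_mono)
  qed simp
  have lim: "(F \<longlongrightarrow> 0) FF" if "(std_normal_density \<longlongrightarrow> 0) FF" for FF
  proof (rule Lim_null_comparison)
    show "\<forall>\<^sub>F x in FF. norm (F x) \<le> std_normal_density x * B"
      using bound(1) by (auto simp: F_def abs_mult mult_left_mono)
    show "((\<lambda>x. std_normal_density x * B) \<longlongrightarrow> 0) FF" using tendsto_mult_left_zero[OF that] .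
  qed
  have "(LBINT x=-\<infinity>..\<infinity>. f x) = 0 - 0"
  proof (rule interval_integral_FTC_integrable)
    show "(F has_vector_derivative f x) (at x)" for x
      unfolding F_def[abs_def] f_def has_real_derivative_iff_has_vector_derivative[symmetric]
      by (auto intro!: derivative_eq_intros DERIV_std_normal_density deriv)
    show "isCont f x" for x
      unfolding f_def[abs_def] std_normal_density_def[abs_def] by (intro continuous_intros contg cont) auto
    show "set_integrable lborel (einterval (- \<infinity>) \<infinity>) f"
      using 1 2 unfolding f_def[abs_def] by (simp add: set_integrable_def)
    show "((F \<circ> real_of_ereal) \<longlongrightarrow> 0) (at_right (-\<infinity>))" "((F \<circ> real_of_ereal) \<longlongrightarrow> 0) (at_left \<infinity>)"
      using lim std_normal_density_tendsto by (simp_all add: ereal_tendsto_simps1)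
  qed simp
  then have "(LBINT x. f x) = 0"
    by (simp add: interval_lebesgue_integral_def set_lebesgue_integral_def)
  then show ?thesis
    using 1 2 unfolding f_def[abs_def] by (subst (1 2) integral_gauss) simp_all
qed

abbreviation gaussK :: "'k set \<Rightarrow> ('k \<Rightarrow> real) measure" where
  "gaussK K \<equiv> Pi\<^sub>M K (\<lambda>_. gauss)"

lemma product_prob_space_gauss: "product_prob_space (\<lambda>_. gauss)"
  by (rule product_prob_spaceI) simp

lemma prob_space_gaussK: "prob_space (gaussK K)"
  by (intro prob_space_PiM) simp

lemma distr_gaussK_component: "k \<in> K \<Longrightarrow> distr (gaussK K) gauss (\<lambda>w. w k) = gauss"
  by (rule distr_PiM_component) auto

lemma integrable_gaussK_component:
  fixes f :: "real \<Rightarrow> real"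
  assumes k: "k \<in> K" and f: "integrable gauss f"
  shows "integrable (gaussK K) (\<lambda>w. f (w k))"
  by (rule integrable_distr[where M'=gauss])
     (use f k in \<open>auto simp: distr_gaussK_component\<close>)

text \<open>Fubini isolates coordinate \<open>k\<close> and the one-dimensional identity applies on
  every fibre; updating \<open>w\<close> at \<open>k\<close> expresses partial
  differentiation.\<close>

lemma gaussK_integration_by_parts:
  fixes g g' :: "('k \<Rightarrow> real) \<Rightarrow> real"
  assumes K: "finite K" "k \<in> K"
    and deriv: "\<And>w x. ((\<lambda>x. g (w(k := x))) has_real_derivative g' (w(k := x))) (at x)"
    and cont: "\<And>w x. isCont (\<lambda>x. g' (w(k := x))) x"
    and bound: "\<And>w. \<bar>g w\<bar> \<le> B" "\<And>w. \<bar>g' w\<bar> \<le> B"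
    and [measurable]: "g \<in> borel_measurable (gaussK K)" "g' \<in> borel_measurable (gaussK K)"
  shows "(\<integral>w. w k * g w \<partial>gaussK K) = (\<integral>w. g' w \<partial>gaussK K)"
proof -
  interpret product_prob_space "\<lambda>_::'k. gauss" by (rule product_prob_space_gauss)
  interpret K: prob_space "gaussK K" by (rule prob_space_gaussK)
  have B: "B \<ge> 0" using bound(1)[of undefined] by linarith
  define K' where "K' = K - {k}"
  have K': "K = insert k K'" "finite K'" "k \<notin> K'" using K by (auto simp: K'_def)
  have 1: "integrable (gaussK K) (\<lambda>w. w k * g w)"
  proof (rule Bochner_Integration.integrable_bound)
    show "integrable (gaussK K) (\<lambda>w. B * w k)"
      by (intro integrable_mult_right integrable_gaussK_component K integrable_gauss_id)
    show "AE x in gaussK K. norm (x k * g x) \<le> norm (B * x k)"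
    proof (rule AE_I2)
      fix x
      have "\<bar>g x\<bar> * \<bar>x k\<bar> \<le> B * \<bar>x k\<bar>" by (intro mult_right_mono bound) simp
      then show "norm (x k * g x) \<le> norm (B * x k)" using B by (simp add: abs_mult ac_simps)
    qed
  qed (use K in measurable)
  have 2: "integrable (gaussK K) g'"
    by (rule K.integrable_const_bound[where B=B]) (use bound in auto)
  have "(\<integral>w. w k * g w \<partial>gaussK K) = (\<integral>w. (\<integral>x. x * g (w(k:=x)) \<partial>gauss) \<partial>gaussK K')"
    using product_integral_insert[OF K'(2,3), of "\<lambda>w. w k * g w"] 1 by (simp add: K'(1)[symmetric])
  also have "\<dots> = (\<integral>w. (\<integral>x. g' (w(k:=x)) \<partial>gauss) \<partial>gaussK K')"
    by (intro Bochner_Integration.integral_cong refl gauss_integration_by_parts[where B=B] deriv cont bound)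
  also have "\<dots> = (\<integral>w. g' w \<partial>gaussK K)"
    using product_integral_insert[OF K'(2,3), of g'] 2 by (simp add: K'(1)[symmetric])
  finally show ?thesis .
qed

section \<open>Gordon's comparison theorem\<close>

text \<open>A smooth approximation of the indicator of \<open>{..0}\<close>; the shift by \<open>sqrt k\<close> makes it converge
  at \<open>0\<close> as well.\<close>

definition sigmoid :: "real \<Rightarrow> real \<Rightarrow> real" where
  "sigmoid k x = 1 / (1 + exp (k * x - sqrt k))"

definition sig_row :: "real \<Rightarrow> 'j set \<Rightarrow> ('i \<Rightarrow> 'j \<Rightarrow> real) \<Rightarrow> 'i \<Rightarrow> real" where
  "sig_row k J x i = (\<Prod>j\<in>J. sigmoid k (x i j))"

text \<open>For large \<open>k\<close> a row product is near 1 if no entry of the row is positive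
  and near 0 otherwise, so this smooths the indicator of the event that every row has a positive
  entry.\<close>

definition sig_minmax :: "real \<Rightarrow> 'i set \<Rightarrow> 'j set \<Rightarrow> ('i \<Rightarrow> 'j \<Rightarrow> real) \<Rightarrow> real" where
  "sig_minmax k I J x = (\<Prod>i\<in>I. 1 - sig_row k J x i)"

text \<open>The logistic equation u' = - k u (1 - u) makes \<open>- k * sig_term\<close> the partial
  derivative of \<open>sig_row\<close>.\<close>

definition sig_term :: "real \<Rightarrow> 'j set \<Rightarrow> ('i \<Rightarrow> 'j \<Rightarrow> real) \<Rightarrow> 'i \<Rightarrow> 'j \<Rightarrow> real" where
  "sig_term k J x i j = sig_row k J x i * (1 - sigmoid k (x i j))"

definition sig_grad :: "real \<Rightarrow> 'i set \<Rightarrow> 'j set \<Rightarrow> ('i \<Rightarrow> 'j \<Rightarrow> real) \<Rightarrow> 'i \<Rightarrow> 'j \<Rightarrow> real" where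
  "sig_grad k I J x i j = k * (sig_minmax k (I - {i}) J x * sig_term k J x i j)"

definition sig_hess ::
  "real \<Rightarrow> 'i set \<Rightarrow> 'j set \<Rightarrow> ('i \<Rightarrow> 'j \<Rightarrow> real) \<Rightarrow> 'i \<Rightarrow> 'j \<Rightarrow> 'i \<Rightarrow> 'j \<Rightarrow> real" where
  "sig_hess k I J x i j i' j' =
     (if i' = i
      then k * (sig_minmax k (I - {i}) J x *
             (- k * sig_term k J x i j' * (1 - sigmoid k (x i j))
              + (if j' = j then k * sigmoid k (x i j) * sig_term k J x i j else 0)))
      else k * (k * sig_term k J x i' j' * sig_minmax k (I - {i} - {i'}) J x * sig_term k J x i j))"

lemma sigmoid_bounds: "0 \<le> sigmoid k x" "sigmoid k x \<le> 1"
  unfolding sigmoid_def by (auto simp: add_pos_pos divide_le_eq_1 intro: add_nonneg_nonneg)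

lemma DERIV_sigmoid:
  assumes "(f has_real_derivative f') (at s)"
  shows "((\<lambda>s. sigmoid k (f s)) has_real_derivative
           - k * sigmoid k (f s) * (1 - sigmoid k (f s)) * f') (at s)"
proof -
  have [simp]: "1 + exp y \<noteq> 0" for y :: real
    using exp_gt_zero[of y] by linarith
  show ?thesis
    unfolding sigmoid_def
    by (rule derivative_eq_intros assms refl | simp)+
       (simp add: field_simps power2_eq_square)
qed

lemma isCont_sigmoid:
  fixes f :: "real \<Rightarrow> real"
  assumes "isCont f s"
  shows "isCont (\<lambda>s. sigmoid k (f s)) s"
proof -
  have [simp]: "1 + exp y \<noteq> 0" for y :: real
    using exp_gt_zero[of y] by linarith
  show ?thesis
    unfolding sigmoid_def by (intro continuous_intros assms) auto
qed

lemma measurable_sigmoid [measurable]: "sigmoid k \<in> borel_measurable borel"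
  unfolding sigmoid_def[abs_def] by measurable

lemma sig_row_bounds: "0 \<le> sig_row k J x i" "sig_row k J x i \<le> 1"
  unfolding sig_row_def by (auto intro!: prod_nonneg prod_le_1 sigmoid_bounds)

lemma sig_minmax_bounds: "0 \<le> sig_minmax k I J x" "sig_minmax k I J x \<le> 1"
  unfolding sig_minmax_def by (auto intro!: prod_nonneg prod_le_1 sig_row_bounds simp: sig_row_bounds)

lemma sig_term_bounds: "0 \<le> sig_term k J x i j" "sig_term k J x i j \<le> 1"
  unfolding sig_term_def by (auto intro!: mult_nonneg_nonneg mult_le_one sig_row_bounds simp: sigmoid_bounds)

lemma sig_grad_bound: "k \<ge> 0 \<Longrightarrow> \<bar>sig_grad k I J x i j\<bar> \<le> k"
  unfolding sig_grad_def abs_mult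
  by (auto intro!: mult_left_le mult_le_one sig_minmax_bounds sig_term_bounds
           simp: sig_minmax_bounds sig_term_bounds)

text \<open>Differentiating in two different rows hits two different factors, each increasing in its
  own row. Second derivatives within one row have no fixed sign; the comparison tolerates them
  because they meet a covariance difference of zero.\<close>

lemma sig_hess_nonneg: "i' \<noteq> i \<Longrightarrow> sig_hess k I J x i j i' j' \<ge> 0" if "k \<ge> 0"
  unfolding sig_hess_def using that
  by (auto intro!: mult_nonneg_nonneg sig_minmax_bounds sig_term_bounds)

lemma abs_mult_le_one: "\<bar>a\<bar> \<le> 1 \<Longrightarrow> \<bar>b\<bar> \<le> B \<Longrightarrow> \<bar>a * b\<bar> \<le> (B::real)"
  using mult_mono[of "\<bar>a\<bar>" 1 "\<bar>b\<bar>" B] by (simp add: abs_mult)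

text \<open>The factor 2 comes from the two summands of the same-row case. The bound supplies
  integrability and the hypothesis of integration by parts; its size is irrelevant.\<close>

lemma sig_hess_bound:
  assumes k: "k \<ge> 0"
  shows "\<bar>sig_hess k I J x i j i' j'\<bar> \<le> k * (2 * k)"
proof -
  note b = sig_minmax_bounds sig_term_bounds sigmoid_bounds
  have abs: "\<bar>sig_minmax k I' J x\<bar> \<le> 1" "\<bar>sig_term k J x i j\<bar> \<le> 1" "\<bar>sigmoid k y\<bar> \<le> 1"
    "\<bar>1 - sigmoid k y\<bar> \<le> 1" for I' i j y
    by (simp_all add: b abs_of_nonneg)
  have c: "\<bar>a * b\<bar> \<le> k" if "\<bar>a\<bar> \<le> k" "\<bar>b\<bar> \<le> 1" for a b
    using abs_mult_le_one[OF that(2,1)] by (simp add: mult.commute)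
  have 1: "\<bar>- k * sig_term k J x i j' * (1 - sigmoid k (x i j))
              + (if j' = j then k * sigmoid k (x i j) * sig_term k J x i j else 0)\<bar> \<le> k + k"
    by (rule order_trans[OF abs_triangle_ineq add_mono]) (auto intro!: c abs simp: k simp del: mult_minus_left)
  have 2: "\<bar>k * sig_term k J x i' j' * sig_minmax k (I - {i} - {i'}) J x * sig_term k J x i j\<bar> \<le> k + k"
    using c[OF c[OF c] , of k "sig_term k J x i' j'" "sig_minmax k (I - {i} - {i'}) J x" "sig_term k J x i j"] k
    by (auto simp: abs)
  have 3: "\<bar>k * a\<bar> \<le> k * (2 * k)" if "\<bar>a\<bar> \<le> k + k" for a
    using that k by (simp add: abs_mult mult_left_mono)
  show ?thesis unfolding sig_hess_def
    using 3[OF abs_mult_le_one[OF abs(1) 1]] 3[OF 2] by (cases "i' = i") (simp_all only: if_True if_False simp_thms)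
qed

lemma
  assumes [measurable]: "\<And>i j. (\<lambda>w. x w i j) \<in> borel_measurable M"
  shows measurable_sig_minmax: "(\<lambda>w. sig_minmax k I J (x w)) \<in> borel_measurable M"
    and measurable_sig_grad: "(\<lambda>w. sig_grad k I J (x w) i j) \<in> borel_measurable M"
    and measurable_sig_hess: "(\<lambda>w. sig_hess k I J (x w) i j i' j') \<in> borel_measurable M"
  unfolding sig_hess_def sig_grad_def sig_minmax_def sig_term_def sig_row_def by measurable

lemma
  fixes x :: "real \<Rightarrow> 'i \<Rightarrow> 'j \<Rightarrow> real"
  assumes "\<And>i j. isCont (\<lambda>s. x s i j) s"
  shows isCont_sig_grad: "isCont (\<lambda>s. sig_grad k I J (x s) i j) s"
    and isCont_sig_hess: "isCont (\<lambda>s. sig_hess k I J (x s) i j i' j') s"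
  unfolding sig_hess_def sig_grad_def sig_minmax_def sig_term_def sig_row_def
  using assms
  by (cases "i' = i"; cases "j' = j"; auto intro!: continuous_intros isCont_sigmoid)+

lemma DERIV_sig_row:
  assumes "finite J" "\<And>i j. ((\<lambda>s. x s i j) has_real_derivative x' i j) (at s)"
  shows "((\<lambda>s. sig_row k J (x s) i) has_real_derivative (\<Sum>j\<in>J. - k * sig_term k J (x s) i j * x' i j)) (at s)"
proof -
  have "((\<lambda>s. sig_row k J (x s) i) has_real_derivative
     (\<Sum>j\<in>J. (- k * sigmoid k (x s i j) * (1 - sigmoid k (x s i j)) * x' i j) *
        (\<Prod>j'\<in>J - {j}. sigmoid k (x s i j')))) (at s)"
    unfolding sig_row_def by (intro has_field_derivative_prod DERIV_sigmoid assms)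
  also have "(\<Sum>j\<in>J. (- k * sigmoid k (x s i j) * (1 - sigmoid k (x s i j)) * x' i j) *
        (\<Prod>j'\<in>J - {j}. sigmoid k (x s i j'))) = (\<Sum>j\<in>J. - k * sig_term k J (x s) i j * x' i j)"
    unfolding sig_term_def sig_row_def
    by (intro sum.cong refl) (simp add: prod.remove[OF assms(1)] mult_ac)
  finally show ?thesis .
qed

lemma DERIV_sig_minmax:
  assumes "finite I" "finite J" "\<And>i j. ((\<lambda>s. x s i j) has_real_derivative x' i j) (at s)"
  shows "((\<lambda>s. sig_minmax k I J (x s)) has_real_derivative
     (\<Sum>i\<in>I. \<Sum>j\<in>J. sig_grad k I J (x s) i j * x' i j)) (at s)"
proof -
  have *: "((\<lambda>s. 1 - sig_row k J (x s) i) has_real_derivative (\<Sum>j\<in>J. k * sig_term k J (x s) i j * x' i j)) (at s)"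
    for i
    using DERIV_diff[OF DERIV_const[of 1] DERIV_sig_row[where x=x and x'=x' and s=s and k=k and i=i, OF assms(2,3)]]
    by (simp add: sum_negf)
  have "((\<lambda>s. sig_minmax k I J (x s)) has_real_derivative
     (\<Sum>i\<in>I. (\<Sum>j\<in>J. k * sig_term k J (x s) i j * x' i j) * (\<Prod>i'\<in>I - {i}. 1 - sig_row k J (x s) i'))) (at s)"
    unfolding sig_minmax_def by (intro has_field_derivative_prod *)
  then show ?thesis
    unfolding sig_grad_def sig_minmax_def by (simp add: sum_distrib_left sum_distrib_right mult_ac)
qed

lemma DERIV_sig_grad:
  assumes "finite I" "finite J" "i \<in> I" "j \<in> J"
    and x: "\<And>i j. ((\<lambda>s. x s i j) has_real_derivative x' i j) (at s)"
  shows "((\<lambda>s. sig_grad k I J (x s) i j) has_real_derivative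
     (\<Sum>i'\<in>I. \<Sum>j'\<in>J. sig_hess k I J (x s) i j i' j' * x' i' j')) (at s)"
proof -
  let ?u = "sigmoid k (x s i j)" let ?T = "sig_term k J (x s)"
  let ?d = "\<lambda>j'. - k * ?T i j' * (1 - ?u) + (if j' = j then k * ?u * ?T i j else 0)"
  have T: "((\<lambda>s. sig_term k J (x s) i j) has_real_derivative (\<Sum>j'\<in>J. ?d j' * x' i j')) (at s)"
  proof -
    have 1: "((\<lambda>s. sig_term k J (x s) i j) has_real_derivative
        (\<Sum>j'\<in>J. - k * ?T i j' * x' i j') * (1 - ?u) + (0 - (- k * ?u * (1 - ?u) * x' i j)) * sig_row k J (x s) i) (at s)"
      unfolding sig_term_def
      by (intro DERIV_mult DERIV_diff DERIV_const DERIV_sigmoid DERIV_sig_row[unfolded sig_term_def] x assms)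
    \<comment> \<open>The factor \<open>1 - sigmoid\<close> depends on a single entry; writing its
      contribution as a sum with a Kronecker delta lets it merge with the row derivative into the
      shape of \<open>sig_hess\<close>.\<close>
    have "(0 - (- k * ?u * (1 - ?u) * x' i j)) * sig_row k J (x s) i
      = (\<Sum>j'\<in>J. (if j' = j then k * ?u * ?T i j else 0) * x' i j')"
      using assms(2,4) by (simp add: sum.delta' if_distrib[of "\<lambda>a. a * _"] sig_term_def cong: if_cong)
    moreover have "(\<Sum>j'\<in>J. - k * ?T i j' * x' i j') * (1 - ?u) = (\<Sum>j'\<in>J. - k * ?T i j' * (1 - ?u) * x' i j')"
      unfolding sum_distrib_right by (intro sum.cong refl) (simp add: mult_ac)
    ultimately show ?thesis using 1 by (simp only: sum.distrib distrib_right)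
  qed
  have "((\<lambda>s. sig_grad k I J (x s) i j) has_real_derivative
     k * ((\<Sum>i'\<in>I-{i}. \<Sum>j'\<in>J. sig_grad k (I-{i}) J (x s) i' j' * x' i' j') * ?T i j
       + (\<Sum>j'\<in>J. ?d j' * x' i j') * sig_minmax k (I-{i}) J (x s))) (at s)"
    unfolding sig_grad_def[of k I]
    by (intro DERIV_cmult DERIV_mult DERIV_sig_minmax T x assms finite_Diff)
  also have "k * ((\<Sum>i'\<in>I-{i}. \<Sum>j'\<in>J. sig_grad k (I-{i}) J (x s) i' j' * x' i' j') * ?T i j
       + (\<Sum>j'\<in>J. ?d j' * x' i j') * sig_minmax k (I-{i}) J (x s))
     = (\<Sum>i'\<in>I-{i}. \<Sum>j'\<in>J. sig_hess k I J (x s) i j i' j' * x' i' j')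
       + (\<Sum>j'\<in>J. sig_hess k I J (x s) i j i j' * x' i j')"
  proof -
    have "(\<Sum>i'\<in>I-{i}. \<Sum>j'\<in>J. sig_hess k I J (x s) i j i' j' * x' i' j') =
       k * ((\<Sum>i'\<in>I-{i}. \<Sum>j'\<in>J. sig_grad k (I-{i}) J (x s) i' j' * x' i' j') * ?T i j)"
      unfolding sum_distrib_left sum_distrib_right
      by (intro sum.cong refl) (auto simp: sig_hess_def sig_grad_def mult_ac)
    moreover have "(\<Sum>j'\<in>J. sig_hess k I J (x s) i j i j' * x' i j') =
        k * ((\<Sum>j'\<in>J. ?d j' * x' i j') * sig_minmax k (I-{i}) J (x s))"
      unfolding sum_distrib_left sum_distrib_right
      by (intro sum.cong refl) (simp add: sig_hess_def mult_ac)
    ultimately show ?thesis by (simp only: distrib_left)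
  qed
  also have "\<dots> = (\<Sum>i'\<in>I. \<Sum>j'\<in>J. sig_hess k I J (x s) i j i' j' * x' i' j')"
    by (simp add: sum.remove[OF assms(1,3)])
  finally show ?thesis .
qed

text \<open>Both Gaussian processes are linear images of one vector of independent standard normals.
  Covariances become finite sums over \<open>K\<close>, and integration by parts acts on the
  independent coordinates.\<close>

definition linear_form :: "'k set \<Rightarrow> ('i \<Rightarrow> 'j \<Rightarrow> 'k \<Rightarrow> real) \<Rightarrow> ('k \<Rightarrow> real) \<Rightarrow> 'i \<Rightarrow> 'j \<Rightarrow> real" where
  "linear_form K P w i j = (\<Sum>l\<in>K. P i j l * w l)"

lemma measurable_gaussK_component: "l \<in> K \<Longrightarrow> (\<lambda>w. w l) \<in> borel_measurable (gaussK K)"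
  using measurable_component_singleton[of l K "\<lambda>_. gauss"] by (simp cong: measurable_cong_sets)

lemma measurable_linear_form [measurable]: "(\<lambda>w. linear_form K P w i j) \<in> borel_measurable (gaussK K)"
  unfolding linear_form_def
  by (intro borel_measurable_sum borel_measurable_times borel_measurable_const measurable_gaussK_component)

lemma integrable_abs_linear_form:
  "integrable (gaussK K) (\<lambda>w. \<bar>linear_form K P w i j\<bar>)"
  unfolding linear_form_def
  by (intro integrable_abs Bochner_Integration.integrable_sum integrable_mult_right
      integrable_gaussK_component integrable_gauss_id)

lemma DERIV_linear_form:
  assumes "finite K" "l \<in> K"
  shows "((\<lambda>s. linear_form K P (w(l := s)) i j) has_real_derivative P i j l) (at s)"
proof -
  have "((\<lambda>s. linear_form K P (w(l := s)) i j) has_real_derivative (\<Sum>l'\<in>K. if l' = l then P i j l' else 0)) (at s)"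
    unfolding linear_form_def
    by (intro DERIV_sum) (auto intro!: derivative_eq_intros)
  then show ?thesis using assms by simp
qed

context
  fixes I :: "'i set" and J :: "'j set" and K :: "'k set"
    and P Q :: "'i \<Rightarrow> 'j \<Rightarrow> 'k \<Rightarrow> real" and t :: "'i \<Rightarrow> 'j \<Rightarrow> real"
  assumes fin: "finite I" "finite J" "finite K"
    and cross: "\<And>i j i' j'. i \<in> I \<Longrightarrow> j \<in> J \<Longrightarrow> i' \<in> I \<Longrightarrow> j' \<in> J \<Longrightarrow> (\<Sum>l\<in>K. P i j l * Q i' j' l) = 0"
    and same: "\<And>i j j'. i \<in> I \<Longrightarrow> j \<in> J \<Longrightarrow> j' \<in> J \<Longrightarrow>
       (\<Sum>l\<in>K. P i j l * P i j' l) = (\<Sum>l\<in>K. Q i j l * Q i j' l)"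
    and diff: "\<And>i j i' j'. i \<in> I \<Longrightarrow> j \<in> J \<Longrightarrow> i' \<in> I \<Longrightarrow> j' \<in> J \<Longrightarrow> i \<noteq> i' \<Longrightarrow>
       (\<Sum>l\<in>K. Q i j l * Q i' j' l) \<le> (\<Sum>l\<in>K. P i j l * P i' j' l)"
begin

text \<open>A rotation from \<open>Y = linear_form K Q\<close> at angle \<open>0\<close> to \<open>X = linear_form K P\<close> at \<open>pi / 2\<close>.\<close>

definition rotc :: "real \<Rightarrow> 'i \<Rightarrow> 'j \<Rightarrow> 'k \<Rightarrow> real" where
  "rotc \<theta> i j l = sin \<theta> * P i j l + cos \<theta> * Q i j l"

definition rotc' :: "real \<Rightarrow> 'i \<Rightarrow> 'j \<Rightarrow> 'k \<Rightarrow> real" where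
  "rotc' \<theta> i j l = cos \<theta> * P i j l - sin \<theta> * Q i j l"

definition rot :: "real \<Rightarrow> ('k \<Rightarrow> real) \<Rightarrow> 'i \<Rightarrow> 'j \<Rightarrow> real" where
  "rot \<theta> w i j = linear_form K (rotc \<theta>) w i j - t i j"

lemma linear_form_rotc:
  "linear_form K (rotc \<theta>) w i j = sin \<theta> * linear_form K P w i j + cos \<theta> * linear_form K Q w i j"
  "linear_form K (rotc' \<theta>) w i j = cos \<theta> * linear_form K P w i j - sin \<theta> * linear_form K Q w i j"
  unfolding linear_form_def rotc_def rotc'_def
  by (simp_all add: sum_distrib_left sum.distrib sum_subtractf algebra_simps)

text \<open>Velocity against position of the rotation. Independence of the two processes, encoded by
  \<open>cross\<close>, kills the mixed products, and the remaining factor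
  \<open>sin \<theta> * cos \<theta>\<close> is nonnegative on the quarter circle.\<close>

lemma rotc_cov:
  assumes "i \<in> I" "j \<in> J" "i' \<in> I" "j' \<in> J"
  shows "(\<Sum>l\<in>K. rotc' \<theta> i j l * rotc \<theta> i' j' l)
    = sin \<theta> * cos \<theta> * ((\<Sum>l\<in>K. P i j l * P i' j' l) - (\<Sum>l\<in>K. Q i j l * Q i' j' l))"
proof -
  have "(\<Sum>l\<in>K. rotc' \<theta> i j l * rotc \<theta> i' j' l) =
     sin \<theta> * cos \<theta> * ((\<Sum>l\<in>K. P i j l * P i' j' l) - (\<Sum>l\<in>K. Q i j l * Q i' j' l))
     + cos \<theta> * cos \<theta> * (\<Sum>l\<in>K. P i j l * Q i' j' l) - sin \<theta> * sin \<theta> * (\<Sum>l\<in>K. P i' j' l * Q i j l)"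
    unfolding rotc_def rotc'_def
    by (simp add: sum_distrib_left sum.distrib sum_subtractf algebra_simps)
  then show ?thesis using cross assms by simp
qed

lemma DERIV_rot:
  "((\<lambda>\<theta>. rot \<theta> w i j) has_real_derivative linear_form K (rotc' \<theta>) w i j) (at \<theta>)"
  unfolding rot_def linear_form_rotc by (auto intro!: derivative_eq_intros)

text \<open>Integrating each coordinate of the velocity by parts turns the drift into a sum of
  expected second derivatives times covariance differences. Same-row terms vanish by
  \<open>same\<close>; for different rows both factors are nonnegative.\<close>

lemma rot_drift_nonneg:
  assumes k: "k \<ge> 0" and \<theta>: "0 \<le> \<theta>" "\<theta> \<le> pi / 2"
  shows "0 \<le> (\<integral>w. (\<Sum>i\<in>I. \<Sum>j\<in>J. sig_grad k I J (rot \<theta> w) i j * linear_form K (rotc' \<theta>) w i j) \<partial>gaussK K)"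
proof -
  interpret prob_space "gaussK K" by (rule prob_space_gaussK)
  have [measurable]: "(\<lambda>w. rot \<theta> w i j) \<in> borel_measurable (gaussK K)" for i j
    unfolding rot_def by measurable
  have [measurable]: "(\<lambda>w. sig_grad k I J (rot \<theta> w) i j) \<in> borel_measurable (gaussK K)"
    "(\<lambda>w. sig_hess k I J (rot \<theta> w) i j i' j') \<in> borel_measurable (gaussK K)" for i j i' j'
    by (rule measurable_sig_grad measurable_sig_hess; fact)+
  define H where "H i j i' j' = (\<integral>w. sig_hess k I J (rot \<theta> w) i j i' j' \<partial>gaussK K)" for i j i' j'
  have intH: "integrable (gaussK K) (\<lambda>w. sig_hess k I J (rot \<theta> w) i j i' j')" for i j i' j'
    by (rule integrable_const_bound[where B="k * (2 * k)"]) (auto simp: sig_hess_bound k)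
  have intG: "integrable (gaussK K) (\<lambda>w. w l * sig_grad k I J (rot \<theta> w) i j)" if "l \<in> K" for l i j
  proof (rule Bochner_Integration.integrable_bound)
    show "integrable (gaussK K) (\<lambda>w. k * w l)"
      by (intro integrable_mult_right integrable_gaussK_component that integrable_gauss_id)
    show "AE w in gaussK K. norm (w l * sig_grad k I J (rot \<theta> w) i j) \<le> norm (k * w l)"
    proof (rule AE_I2)
      fix w :: "'k \<Rightarrow> real"
      have "\<bar>sig_grad k I J (rot \<theta> w) i j\<bar> * \<bar>w l\<bar> \<le> k * \<bar>w l\<bar>"
        by (intro mult_right_mono sig_grad_bound k) simp
      then show "norm (w l * sig_grad k I J (rot \<theta> w) i j) \<le> norm (k * w l)"
        using k by (simp add: abs_mult mult.commute)
    qed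
  qed (use that in \<open>auto intro!: borel_measurable_times measurable_gaussK_component\<close>)
  have ibp: "(\<integral>w. w l * sig_grad k I J (rot \<theta> w) i j \<partial>gaussK K)
      = (\<Sum>i'\<in>I. \<Sum>j'\<in>J. H i j i' j' * rotc \<theta> i' j' l)" if ij: "i \<in> I" "j \<in> J" and l: "l \<in> K" for i j l
  proof -
    define R where "R = (\<Sum>i'\<in>I. \<Sum>j'\<in>J. \<bar>rotc \<theta> i' j' l\<bar>)"
    have R: "0 \<le> R" unfolding R_def by (intro sum_nonneg) auto
    have D: "((\<lambda>s. rot \<theta> (w(l := s)) i j) has_real_derivative rotc \<theta> i j l) (at s)" for w s i j
      unfolding rot_def using DERIV_diff[OF DERIV_linear_form[OF fin(3) l] DERIV_const] by simp
    have "(\<integral>w. w l * sig_grad k I J (rot \<theta> w) i j \<partial>gaussK K) =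
      (\<integral>w. (\<Sum>i'\<in>I. \<Sum>j'\<in>J. sig_hess k I J (rot \<theta> w) i j i' j' * rotc \<theta> i' j' l) \<partial>gaussK K)"
    \<comment> \<open>One \<open>B\<close> must dominate both the function, bounded by
      \<open>k\<close>, and its derivative, bounded by \<open>k * (2 * k) * R\<close>; hence the
      sum.\<close>
    proof (rule gaussK_integration_by_parts[where B="k + k * (2 * k) * R"])
      show "((\<lambda>x. sig_grad k I J (rot \<theta> (w(l := x))) i j) has_real_derivative
           (\<Sum>i'\<in>I. \<Sum>j'\<in>J. sig_hess k I J (rot \<theta> (w(l := x))) i j i' j' * rotc \<theta> i' j' l)) (at x)" for w x
        by (intro DERIV_sig_grad fin ij D)
      show "isCont (\<lambda>x. \<Sum>i'\<in>I. \<Sum>j'\<in>J. sig_hess k I J (rot \<theta> (w(l := x))) i j i' j' * rotc \<theta> i' j' l) x" for w x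
        by (intro continuous_intros isCont_sig_hess DERIV_isCont[OF D])
      have "\<bar>sig_grad k I J (rot \<theta> w) i j\<bar> \<le> k" for w by (intro sig_grad_bound k)
      moreover have "0 \<le> k * (2 * k) * R" using k R by simp
      ultimately show "\<bar>sig_grad k I J (rot \<theta> w) i j\<bar> \<le> k + k * (2 * k) * R" for w
        using add_increasing2 by blast
      have "\<bar>\<Sum>i'\<in>I. \<Sum>j'\<in>J. sig_hess k I J (rot \<theta> w) i j i' j' * rotc \<theta> i' j' l\<bar> \<le> k * (2 * k) * R" for w
        unfolding R_def sum_distrib_left
        by (intro order_trans[OF sum_abs] sum_mono) (auto simp: abs_mult intro!: mult_right_mono sig_hess_bound k order_trans[OF sum_abs] sum_mono)
      then show "\<bar>\<Sum>i'\<in>I. \<Sum>j'\<in>J. sig_hess k I J (rot \<theta> w) i j i' j' * rotc \<theta> i' j' l\<bar> \<le> k + k * (2 * k) * R" for w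
        using add_increasing[OF k] by blast
    qed (use fin l in measurable)
    also have "\<dots> = (\<Sum>i'\<in>I. \<Sum>j'\<in>J. H i j i' j' * rotc \<theta> i' j' l)"
      unfolding H_def by (simp add: intH)
    finally show ?thesis .
  qed
  have "(\<integral>w. (\<Sum>i\<in>I. \<Sum>j\<in>J. sig_grad k I J (rot \<theta> w) i j * linear_form K (rotc' \<theta>) w i j) \<partial>gaussK K)
      = (\<integral>w. (\<Sum>i\<in>I. \<Sum>j\<in>J. \<Sum>l\<in>K. rotc' \<theta> i j l * (w l * sig_grad k I J (rot \<theta> w) i j)) \<partial>gaussK K)"
    by (simp add: linear_form_def sum_distrib_left sum_distrib_right mult_ac)
  also have "\<dots> = (\<Sum>i\<in>I. \<Sum>j\<in>J. \<Sum>l\<in>K. rotc' \<theta> i j l * (\<integral>w. w l * sig_grad k I J (rot \<theta> w) i j \<partial>gaussK K))"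
    by (simp add: intG)
  also have "\<dots> = (\<Sum>i\<in>I. \<Sum>j\<in>J. \<Sum>l\<in>K. \<Sum>i'\<in>I. \<Sum>j'\<in>J. H i j i' j' * (rotc' \<theta> i j l * rotc \<theta> i' j' l))"
    by (intro sum.cong refl) (simp add: ibp sum_distrib_left mult_ac)
  also have "\<dots> = (\<Sum>i\<in>I. \<Sum>j\<in>J. \<Sum>i'\<in>I. \<Sum>j'\<in>J. H i j i' j' * (\<Sum>l\<in>K. rotc' \<theta> i j l * rotc \<theta> i' j' l))"
  proof (intro sum.cong refl)
    fix i j
    show "(\<Sum>l\<in>K. \<Sum>i'\<in>I. \<Sum>j'\<in>J. H i j i' j' * (rotc' \<theta> i j l * rotc \<theta> i' j' l)) =
      (\<Sum>i'\<in>I. \<Sum>j'\<in>J. H i j i' j' * (\<Sum>l\<in>K. rotc' \<theta> i j l * rotc \<theta> i' j' l))"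
      unfolding sum_distrib_left
      by (subst sum.swap) (intro sum.cong refl, rule sum.swap)
  qed
  also have "\<dots> \<ge> 0"
  proof (intro sum_nonneg)
    fix i j i' j' assume ij: "i \<in> I" "j \<in> J" "i' \<in> I" "j' \<in> J"
    have sc: "0 \<le> sin \<theta> * cos \<theta>"
      using \<theta> by (intro mult_nonneg_nonneg sin_ge_zero cos_ge_zero) auto
    show "0 \<le> H i j i' j' * (\<Sum>l\<in>K. rotc' \<theta> i j l * rotc \<theta> i' j' l)"
    proof (cases "i = i'")
      case True
      then show ?thesis using same ij by (simp add: rotc_cov)
    next
      case False
      then have "0 \<le> H i j i' j'" unfolding H_def
        by (intro Bochner_Integration.integral_nonneg sig_hess_nonneg k) auto
      then show ?thesis using False diff[OF ij False] ij sc by (simp add: rotc_cov)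
    qed
  qed
  finally show ?thesis .
qed

text \<open>The difference of the two expectations is the drift integrated over the quarter circle.
  Exchanging the integrals needs a dominating function free of \<theta>, which is \<open>R\<close>:
  the gradient is at most \<open>k\<close>, and the velocity combines the two processes with
  coefficients of modulus at most 1.\<close>

lemma gordon_smooth:
  assumes k: "k \<ge> 0"
  shows "(\<integral>w. sig_minmax k I J (\<lambda>i j. linear_form K Q w i j - t i j) \<partial>gaussK K)
       \<le> (\<integral>w. sig_minmax k I J (\<lambda>i j. linear_form K P w i j - t i j) \<partial>gaussK K)"
proof -
  interpret N: prob_space "gaussK K" by (rule prob_space_gaussK)
  interpret pair_sigma_finite lborel "gaussK K" ..
  define D where "D \<theta> w = (\<Sum>i\<in>I. \<Sum>j\<in>J. sig_grad k I J (rot \<theta> w) i j * linear_form K (rotc' \<theta>) w i j)" for \<theta> w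
  define f where "f \<theta> w = D \<theta> w * indicator {0..pi/2} \<theta>" for \<theta> w
  define R where "R w = (\<Sum>i\<in>I. \<Sum>j\<in>J. k * (\<bar>linear_form K P w i j\<bar> + \<bar>linear_form K Q w i j\<bar>))" for w
  have ftc: "(\<integral>\<theta>. f \<theta> w \<partial>lborel) = sig_minmax k I J (rot (pi/2) w) - sig_minmax k I J (rot 0 w)" for w
    unfolding f_def
  proof (rule integral_FTC_Icc_real)
    show "((\<lambda>\<theta>. sig_minmax k I J (rot \<theta> w)) has_real_derivative D \<theta> w) (at \<theta>)" for \<theta>
      unfolding D_def by (intro DERIV_sig_minmax fin DERIV_rot)
    show "isCont (\<lambda>\<theta>. D \<theta> w) \<theta>" for \<theta>
      unfolding D_def linear_form_rotc
      by (intro continuous_intros isCont_sig_grad DERIV_isCont[OF DERIV_rot])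
  qed simp
  have [measurable]: "(\<lambda>p. linear_form K P (snd p) i j) \<in> borel_measurable (lborel \<Otimes>\<^sub>M gaussK K)"
     "(\<lambda>p. linear_form K Q (snd p) i j) \<in> borel_measurable (lborel \<Otimes>\<^sub>M gaussK K)" for i j
    by measurable
  have [measurable]: "(\<lambda>p. rot (fst p) (snd p) i j) \<in> borel_measurable (lborel \<Otimes>\<^sub>M gaussK K)"
     "(\<lambda>p. linear_form K (rotc' (fst p)) (snd p) i j) \<in> borel_measurable (lborel \<Otimes>\<^sub>M gaussK K)" for i j
    unfolding rot_def linear_form_rotc by measurable
  have [measurable]: "(\<lambda>p. sig_grad k I J (rot (fst p) (snd p)) i j) \<in> borel_measurable (lborel \<Otimes>\<^sub>M gaussK K)" for i j
    by (rule measurable_sig_grad) fact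
  have mf: "(\<lambda>p. f (fst p) (snd p)) \<in> borel_measurable (lborel \<Otimes>\<^sub>M gaussK K)"
    unfolding f_def D_def by measurable
  have intR: "integrable (gaussK K) R"
    unfolding R_def by (intro Bochner_Integration.integrable_sum integrable_mult_right
       Bochner_Integration.integrable_add integrable_abs_linear_form)
  have [measurable]: "R \<in> borel_measurable (gaussK K)" using intR by auto
  have R0: "0 \<le> R w" for w unfolding R_def by (intro sum_nonneg) (simp add: k)
  have DR: "\<bar>D \<theta> w\<bar> \<le> R w" for \<theta> w
  proof -
    have "\<bar>sig_grad k I J (rot \<theta> w) i j * linear_form K (rotc' \<theta>) w i j\<bar>
        \<le> k * (\<bar>linear_form K P w i j\<bar> + \<bar>linear_form K Q w i j\<bar>)" for i j
      unfolding abs_mult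
    proof (intro mult_mono sig_grad_bound k)
      have "\<bar>linear_form K (rotc' \<theta>) w i j\<bar> \<le> \<bar>cos \<theta> * linear_form K P w i j\<bar> + \<bar>sin \<theta> * linear_form K Q w i j\<bar>"
        unfolding linear_form_rotc by (rule abs_triangle_ineq4)
      also have "\<dots> \<le> \<bar>linear_form K P w i j\<bar> + \<bar>linear_form K Q w i j\<bar>"
        by (intro add_mono abs_mult_le_one) auto
      finally show "\<bar>linear_form K (rotc' \<theta>) w i j\<bar> \<le> \<bar>linear_form K P w i j\<bar> + \<bar>linear_form K Q w i j\<bar>" .
    qed auto
    then show ?thesis unfolding D_def R_def
      by (intro order_trans[OF sum_abs] sum_mono order_trans[OF sum_abs]) auto
  qed
  have intf: "integrable (lborel \<Otimes>\<^sub>M gaussK K) (\<lambda>(\<theta>, w). f \<theta> w)"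
  proof (rule Bochner_Integration.integrable_bound)
    show "integrable (lborel \<Otimes>\<^sub>M gaussK K) (\<lambda>(\<theta>, w). R w * indicator {0..pi/2} \<theta>)"
    proof (rule Fubini_integrable)
      show "integrable lborel (\<lambda>\<theta>. \<integral>w. norm (case (\<theta>, w) of (\<theta>, w) \<Rightarrow> R w * indicator {0..pi/2} \<theta>) \<partial>gaussK K)"
        using R0 by (auto simp: abs_mult)
    qed (auto intro!: integrable_mult_left intR)
    show "AE p in lborel \<Otimes>\<^sub>M gaussK K. norm (case p of (\<theta>, w) \<Rightarrow> f \<theta> w)
       \<le> norm (case p of (\<theta>, w) \<Rightarrow> R w * indicator {0..pi/2} \<theta>)"
      using DR R0 by (auto simp: f_def abs_mult indicator_def intro!: AE_I2)
  qed (use mf in \<open>simp add: case_prod_beta'\<close>)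
  have intF: "integrable (gaussK K) (\<lambda>w. sig_minmax k I J (rot \<theta> w))" for \<theta>
  proof (rule N.integrable_const_bound[where B=1])
    have [measurable]: "(\<lambda>w. rot \<theta> w i j) \<in> borel_measurable (gaussK K)" for i j
      unfolding rot_def by measurable
    show "(\<lambda>w. sig_minmax k I J (rot \<theta> w)) \<in> borel_measurable (gaussK K)"
      by (intro measurable_sig_minmax) simp
  qed (auto simp: sig_minmax_bounds)
  have "0 \<le> (\<integral>\<theta>. (\<integral>w. f \<theta> w \<partial>gaussK K) \<partial>lborel)"
  proof (rule Bochner_Integration.integral_nonneg)
    fix \<theta>
    have "(\<integral>w. f \<theta> w \<partial>gaussK K) = (\<integral>w. D \<theta> w \<partial>gaussK K) * indicator {0..pi/2} \<theta>"
      unfolding f_def by simp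
    also have "\<dots> \<ge> 0"
      using rot_drift_nonneg[OF k] unfolding D_def by (cases "\<theta> \<in> {0..pi/2}") auto
    finally show "0 \<le> (\<integral>w. f \<theta> w \<partial>gaussK K)" .
  qed
  also have "(\<integral>\<theta>. (\<integral>w. f \<theta> w \<partial>gaussK K) \<partial>lborel) = (\<integral>w. (\<integral>\<theta>. f \<theta> w \<partial>lborel) \<partial>gaussK K)"
    using Fubini_integral[OF intf] by simp
  also have "\<dots> = (\<integral>w. sig_minmax k I J (rot (pi/2) w) \<partial>gaussK K) - (\<integral>w. sig_minmax k I J (rot 0 w) \<partial>gaussK K)"
    unfolding ftc using intF by simp
  finally show ?thesis
    unfolding rot_def linear_form_rotc by simp
qed

lemma sigmoid_tendsto: "(\<lambda>k. sigmoid (real k) x) \<longlonglongrightarrow> (if x \<le> 0 then 1 else 0)"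
proof (cases "x \<le> 0")
  case True
  have "(\<lambda>k. exp (real k * x - sqrt (real k))) \<longlonglongrightarrow> 0"
  proof (rule tendsto_sandwich[OF _ _ tendsto_const])
    show "\<forall>\<^sub>F k in sequentially. exp (real k * x - sqrt (real k)) \<le> exp (- sqrt (real k))"
      using True by (auto simp: mult_nonneg_nonpos)
    show "(\<lambda>k. exp (- sqrt (real k))) \<longlonglongrightarrow> 0" by real_asymp
  qed auto
  from tendsto_divide[OF tendsto_const[of 1] tendsto_add[OF tendsto_const[of 1] this]]
  show ?thesis using True by (simp add: sigmoid_def)
next
  case False
  then have x: "x > 0" by simp
  have "filterlim (\<lambda>k. real k * x - sqrt (real k)) at_top sequentially" using x by real_asymp
  then have "filterlim (\<lambda>k. exp (real k * x - sqrt (real k))) at_top sequentially"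
    by (rule filterlim_compose[OF exp_at_top])
  then have "filterlim (\<lambda>k. 1 + exp (real k * x - sqrt (real k))) at_top sequentially"
    by (rule filterlim_tendsto_add_at_top[OF tendsto_const])
  then have "(\<lambda>k. 1 / (1 + exp (real k * x - sqrt (real k)))) \<longlonglongrightarrow> 0"
    using tendsto_divide_0[OF tendsto_const] filterlim_at_top_imp_at_infinity by blast
  then show ?thesis using False by (simp add: sigmoid_def)
qed

lemma sig_minmax_tendsto:
  "(\<lambda>k. sig_minmax (real k) I J x) \<longlonglongrightarrow> indicator {x. \<forall>i\<in>I. \<exists>j\<in>J. x i j > 0} x"
proof -
  have row: "(\<lambda>k. 1 - sig_row (real k) J x i) \<longlonglongrightarrow> 1 - (\<Prod>j\<in>J. if x i j \<le> 0 then 1 else 0)" for i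
    unfolding sig_row_def by (intro tendsto_diff tendsto_const tendsto_prod sigmoid_tendsto)
  have eq: "1 - (\<Prod>j\<in>J. if x i j \<le> 0 then 1 else 0) = (if \<exists>j\<in>J. x i j > 0 then 1 else 0::real)" for i
    using fin by (auto simp: not_le intro!: prod.neutral)
  have "(\<lambda>k. sig_minmax (real k) I J x) \<longlonglongrightarrow> (\<Prod>i\<in>I. if \<exists>j\<in>J. x i j > 0 then 1 else 0)"
    unfolding sig_minmax_def eq[symmetric] by (intro tendsto_prod row)
  also have "(\<Prod>i\<in>I. if \<exists>j\<in>J. x i j > 0 then 1 else 0::real) = indicator {x. \<forall>i\<in>I. \<exists>j\<in>J. x i j > 0} x"
    using fin by (auto simp: indicator_def intro!: prod.neutral)
  finally show ?thesis .
qed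

lemma gordon_finite:
  "\<P>(w in gaussK K. \<forall>i\<in>I. \<exists>j\<in>J. linear_form K Q w i j > t i j)
   \<le> \<P>(w in gaussK K. \<forall>i\<in>I. \<exists>j\<in>J. linear_form K P w i j > t i j)"
proof -
  interpret N: prob_space "gaussK K" by (rule prob_space_gaussK)
  have lim: "(\<lambda>k. \<integral>w. sig_minmax (real k) I J (\<lambda>i j. linear_form K P w i j - t i j) \<partial>gaussK K)
    \<longlonglongrightarrow> \<P>(w in gaussK K. \<forall>i\<in>I. \<exists>j\<in>J. linear_form K P w i j > t i j)"
    for P :: "'i \<Rightarrow> 'j \<Rightarrow> 'k \<Rightarrow> real"
  proof -
    let ?A = "{w \<in> space (gaussK K). \<forall>i\<in>I. \<exists>j\<in>J. linear_form K P w i j > t i j}"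
    have [measurable]: "?A \<in> sets (gaussK K)" using fin by measurable
    have "(\<lambda>k. \<integral>w. sig_minmax (real k) I J (\<lambda>i j. linear_form K P w i j - t i j) \<partial>gaussK K)
      \<longlonglongrightarrow> (\<integral>w. indicator ?A w \<partial>gaussK K)"
    proof (rule integral_dominated_convergence[where w="\<lambda>_. 1"])
      show "(\<lambda>w. sig_minmax (real k) I J (\<lambda>i j. linear_form K P w i j - t i j)) \<in> borel_measurable (gaussK K)" for k
        by (intro measurable_sig_minmax) measurable
      show "AE w in gaussK K. (\<lambda>k. sig_minmax (real k) I J (\<lambda>i j. linear_form K P w i j - t i j)) \<longlonglongrightarrow> indicator ?A w"
      proof (rule AE_I2)
        fix w assume w: "w \<in> space (gaussK K)"
        show "(\<lambda>k. sig_minmax (real k) I J (\<lambda>i j. linear_form K P w i j - t i j)) \<longlonglongrightarrow> indicator ?A w"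
          using sig_minmax_tendsto[of "\<lambda>i j. linear_form K P w i j - t i j"] w by (simp add: indicator_def)
      qed
    qed (auto simp: sig_minmax_bounds)
    then show ?thesis by simp
  qed
  show ?thesis by (rule LIMSEQ_le[OF lim lim]) (auto intro!: gordon_smooth)
qed

end

section \<open>Comparison for countable families and for Gaussian matrices\<close>

lemma countable_exhaustion:
  assumes "countable A"
  obtains F :: "nat \<Rightarrow> 'a set" where "\<And>k. finite (F k)" "\<And>k. F k \<subseteq> A" "incseq F" "(\<Union>k. F k) = A"
proof
  let ?F = "\<lambda>k. {a \<in> A. to_nat_on A a < k}"
  have inj: "inj_on (to_nat_on A) A" using assms by (rule inj_on_to_nat_on)
  show "finite (?F k)" for k
    by (rule finite_imageD[of "to_nat_on A"]) (auto intro: inj_on_subset[OF inj] finite_subset[of _ "{..<k}"])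
  show "incseq ?F" by (auto simp: incseq_def)
qed auto

text \<open>The order of the two limits matters. While \<open>A\<close> is finite, the finitely many
  witnesses lie in a common \<open>G l\<close>, so the events increase to the one for all of
  \<open>B\<close>; afterwards the events decrease as \<open>A\<close> is exhausted. Both steps are
  continuity of measure along monotone sequences.\<close>

lemma gordon_countable:
  fixes A :: "'i set" and B :: "'j set" and K :: "'k set"
    and P Q :: "'i \<Rightarrow> 'j \<Rightarrow> 'k \<Rightarrow> real" and t :: "'i \<Rightarrow> 'j \<Rightarrow> real"
  assumes count: "countable A" "countable B" and K: "finite K"
    and cross: "\<And>i j i' j'. i \<in> A \<Longrightarrow> j \<in> B \<Longrightarrow> i' \<in> A \<Longrightarrow> j' \<in> B \<Longrightarrow> (\<Sum>l\<in>K. P i j l * Q i' j' l) = 0"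
    and same: "\<And>i j j'. i \<in> A \<Longrightarrow> j \<in> B \<Longrightarrow> j' \<in> B \<Longrightarrow>
       (\<Sum>l\<in>K. P i j l * P i j' l) = (\<Sum>l\<in>K. Q i j l * Q i j' l)"
    and diff: "\<And>i j i' j'. i \<in> A \<Longrightarrow> j \<in> B \<Longrightarrow> i' \<in> A \<Longrightarrow> j' \<in> B \<Longrightarrow> i \<noteq> i' \<Longrightarrow>
       (\<Sum>l\<in>K. Q i j l * Q i' j' l) \<le> (\<Sum>l\<in>K. P i j l * P i' j' l)"
  shows "\<P>(w in gaussK K. \<forall>i\<in>A. \<exists>j\<in>B. linear_form K Q w i j > t i j)
       \<le> \<P>(w in gaussK K. \<forall>i\<in>A. \<exists>j\<in>B. linear_form K P w i j > t i j)"
proof -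
  interpret N: prob_space "gaussK K" by (rule prob_space_gaussK)
  obtain F where F: "\<And>k. finite (F k)" "\<And>k. F k \<subseteq> A" "incseq F" "(\<Union>k. F k) = A"
    using countable_exhaustion[OF count(1)] by metis
  obtain G where G: "\<And>k. finite (G k)" "\<And>k. G k \<subseteq> B" "incseq G" "(\<Union>k. G k) = B"
    using countable_exhaustion[OF count(2)] by metis
  define E where "E P A B = {w \<in> space (gaussK K). \<forall>i\<in>A. \<exists>j\<in>B. linear_form K P w i j > t i j}"
    for P :: "'i \<Rightarrow> 'j \<Rightarrow> 'k \<Rightarrow> real" and A B
  have E1: "E P A B \<in> sets (gaussK K)" if "finite A" "finite B" for P A B
    using that unfolding E_def by measurable
  have inc: "incseq (\<lambda>l. E P A (G l))" for P A
    unfolding incseq_def E_def using incseqD[OF G(3)]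
    by (intro allI impI Collect_mono) (meson subsetD)
  have E2: "(\<Union>l. E P A (G l)) = E P A B" if fA: "finite A" for P A
  proof (intro equalityI subsetI)
    fix w assume "w \<in> (\<Union>l. E P A (G l))"
    then show "w \<in> E P A B" using G(2) unfolding E_def by blast
  next
    fix w assume w: "w \<in> E P A B"
    have "\<forall>i\<in>A. \<forall>\<^sub>F l in sequentially. \<exists>j\<in>G l. linear_form K P w i j > t i j"
    proof
      fix i assume "i \<in> A"
      then obtain j where j: "j \<in> B" "linear_form K P w i j > t i j"
        using w unfolding E_def by blast
      then have "j \<in> (\<Union>k. G k)" unfolding G(4) by simp
      then obtain l where l: "j \<in> G l" by (rule UN_E)
      show "\<forall>\<^sub>F l in sequentially. \<exists>j\<in>G l. linear_form K P w i j > t i j"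
      proof (rule eventually_sequentiallyI)
        fix l' assume "l \<le> l'"
        then have "j \<in> G l'" using l incseqD[OF G(3)] by (meson subsetD)
        then show "\<exists>j\<in>G l'. linear_form K P w i j > t i j" using j(2) by (rule bexI[rotated])
      qed
    qed
    then have "\<forall>\<^sub>F l in sequentially. \<forall>i\<in>A. \<exists>j\<in>G l. linear_form K P w i j > t i j"
      by (rule eventually_ball_finite[OF fA])
    then obtain l where "\<forall>i\<in>A. \<exists>j\<in>G l. linear_form K P w i j > t i j"
      by (auto simp: eventually_sequentially)
    then show "w \<in> (\<Union>l. E P A (G l))" using w unfolding E_def by blast
  qed
  have lim1: "(\<lambda>l. measure (gaussK K) (E P A (G l))) \<longlonglongrightarrow> measure (gaussK K) (E P A B)" if "finite A" for P A
  proof -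
    have "range (\<lambda>l. E P A (G l)) \<subseteq> sets (gaussK K)" using E1[OF that G(1)] by blast
    from N.finite_Lim_measure_incseq[OF this inc] show ?thesis unfolding E2[OF that] .
  qed
  have E3: "E P (F k) B \<in> sets (gaussK K)" for P k
  proof -
    have "range (\<lambda>l. E P (F k) (G l)) \<subseteq> sets (gaussK K)" using E1[OF F(1) G(1)] by blast
    from sets.countable_UN[OF this] show ?thesis unfolding E2[OF F(1)] .
  qed
  have dec: "decseq (\<lambda>k. E P (F k) B)" for P
    unfolding decseq_def E_def using incseqD[OF F(3)] by (intro allI impI Collect_mono) (meson subsetD)
  have E4: "(\<Inter>k. E P (F k) B) = E P A B" for P
    unfolding F(4)[symmetric] by (auto simp: E_def)
  have lim2: "(\<lambda>k. measure (gaussK K) (E P (F k) B)) \<longlonglongrightarrow> measure (gaussK K) (E P A B)" for P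
  proof -
    have "range (\<lambda>k. E P (F k) B) \<subseteq> sets (gaussK K)" using E3 by blast
    from N.finite_Lim_measure_decseq[OF this dec] show ?thesis unfolding E4 .
  qed
  have "measure (gaussK K) (E Q (F k) (G l)) \<le> measure (gaussK K) (E P (F k) (G l))" for k l
    unfolding E_def
    by (rule gordon_finite) (use F(1,2)[of k] G(1,2)[of l] K in \<open>auto intro!: cross same diff\<close>)
  then have "measure (gaussK K) (E Q (F k) B) \<le> measure (gaussK K) (E P (F k) B)" for k
    by (intro LIMSEQ_le[OF lim1 lim1] F) auto
  then have "measure (gaussK K) (E Q A B) \<le> measure (gaussK K) (E P A B)"
    by (intro LIMSEQ_le[OF lim2 lim2]) auto
  then show ?thesis unfolding E_def .
qed

text \<open>The Gaussians \<open>Inl (Some (i, j))\<close> are the matrix entries, \<open>Inl None\<close> is the auxiliary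
  scalar, and \<open>Inr\<close> carries the two comparison vectors of lengths \<open>n\<close> and \<open>m\<close>.\<close>

type_synonym gindex = "(nat \<times> nat) option + (nat + nat)"

definition gindices :: "nat \<Rightarrow> nat \<Rightarrow> gindex set" where
  "gindices m n = insert None (Some ` ({..<m} \<times> {..<n})) <+> ({..<n} <+> {..<m})"

lemma finite_gindices [simp]: "finite (gindices m n)"
  unfolding gindices_def by simp

lemma sum_gindices:
  "(\<Sum>k\<in>gindices m n. f k) = f (Inl None) + (\<Sum>i<m. \<Sum>j<n. f (Inl (Some (i, j))))
     + (\<Sum>j<n. f (Inr (Inl j))) + (\<Sum>i<m. f (Inr (Inr i)))" for f :: "gindex \<Rightarrow> real"
  unfolding gindices_def
  by (simp add: sum.Plus sum.reindex sum.cartesian_product add_ac)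

lemma L2_set_inner: "(\<Sum>i\<in>A. x i * x i) = L2_set x A * L2_set x A"
  by (simp add: L2_set_def sum_nonneg power2_eq_square)

lemma inner_le_L2_set: "(\<Sum>i\<in>A. x i * y i) \<le> L2_set x A * L2_set y A"
  by (rule order_trans[OF sum_mono L2_set_mult_ineq]) (simp add: abs_mult[symmetric])

abbreviation gmatrix :: "(gindex \<Rightarrow> real) \<Rightarrow> nat \<Rightarrow> nat \<Rightarrow> real" where
  "gmatrix w \<equiv> \<lambda>i j. w (Inl (Some (i, j)))"

abbreviation coupled :: "nat \<Rightarrow> nat \<Rightarrow> (gindex \<Rightarrow> real) \<Rightarrow> (nat \<Rightarrow> real) \<Rightarrow> (nat \<Rightarrow> real) \<Rightarrow> real" where
  "coupled m n w l x \<equiv> (\<Sum>i<m. l i * (\<Sum>j<n. w (Inl (Some (i, j))) * x j))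
     + w (Inl None) * L2_set l {..<m} * L2_set x {..<n}"

abbreviation decoupled :: "nat \<Rightarrow> nat \<Rightarrow> (gindex \<Rightarrow> real) \<Rightarrow> (nat \<Rightarrow> real) \<Rightarrow> (nat \<Rightarrow> real) \<Rightarrow> real" where
  "decoupled m n w l x \<equiv> L2_set l {..<m} * (\<Sum>j<n. w (Inr (Inl j)) * x j)
     + L2_set x {..<n} * (\<Sum>i<m. w (Inr (Inr i)) * l i)"

text \<open>The covariance difference factors into two Cauchy-Schwarz gaps, one for the pair of
  \<open>l\<close> and one for the pair of \<open>x\<close>. The first gap is zero when the two
  \<open>l\<close> agree, which gives the required equality. The auxiliary scalar contributes
  exactly the product of the four norms that completes this factorisation.\<close>

lemma gordon_matrix:
  fixes A B :: "(nat \<Rightarrow> real) set" and T :: "(nat \<Rightarrow> real) \<Rightarrow> real"  and m n :: nat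
  assumes "countable A" "countable B"
  defines "K \<equiv> gindices m n"
  shows "\<P>(w in gaussK K. \<forall>l\<in>A. \<exists>x\<in>B.
        decoupled m n w l x > T l)
     \<le> \<P>(w in gaussK K. \<forall>l\<in>A. \<exists>x\<in>B.
        coupled m n w l x > T l)"
proof -
  define P :: "(nat \<Rightarrow> real) \<Rightarrow> (nat \<Rightarrow> real) \<Rightarrow> gindex \<Rightarrow> real" where
    "P l x k = (case k of Inl None \<Rightarrow> L2_set l {..<m} * L2_set x {..<n} | Inl (Some (i, j)) \<Rightarrow> l i * x j | Inr _ \<Rightarrow> 0)"
    for l x k
  define Q :: "(nat \<Rightarrow> real) \<Rightarrow> (nat \<Rightarrow> real) \<Rightarrow> gindex \<Rightarrow> real" where
    "Q l x k = (case k of Inl _ \<Rightarrow> 0 | Inr (Inl j) \<Rightarrow> L2_set l {..<m} * x j | Inr (Inr i) \<Rightarrow> L2_set x {..<n} * l i)"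
    for l x k
  have PP: "(\<Sum>k\<in>K. P l x k * P l' x' k) =
      L2_set l {..<m} * L2_set x {..<n} * (L2_set l' {..<m} * L2_set x' {..<n}) + (\<Sum>i<m. l i * l' i) * (\<Sum>j<n. x j * x' j)" for l x l' x'
    unfolding K_def sum_gindices P_def by (simp add: sum_product mult_ac)
  have QQ: "(\<Sum>k\<in>K. Q l x k * Q l' x' k) =
      L2_set l {..<m} * L2_set l' {..<m} * (\<Sum>j<n. x j * x' j) + L2_set x {..<n} * L2_set x' {..<n} * (\<Sum>i<m. l i * l' i)" for l x l' x'
    unfolding K_def sum_gindices Q_def by (simp add: sum_distrib_left mult_ac)
  have lP: "linear_form K P w l x = coupled m n w l x" for w l x
    unfolding linear_form_def K_def sum_gindices P_def by (simp add: sum_distrib_left mult_ac)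
  have lQ: "linear_form K Q w l x = decoupled m n w l x" for w l x
    unfolding linear_form_def K_def sum_gindices Q_def by (simp add: sum_distrib_left mult_ac)
  have "\<P>(w in gaussK K. \<forall>l\<in>A. \<exists>x\<in>B. linear_form K Q w l x > T l)
     \<le> \<P>(w in gaussK K. \<forall>l\<in>A. \<exists>x\<in>B. linear_form K P w l x > T l)"
  proof (rule gordon_countable[OF assms(1,2)])
    show "finite K" by (simp add: K_def)
    show "(\<Sum>k\<in>K. P l x k * Q l' x' k) = 0" for l x l' x'
      unfolding P_def Q_def by (rule sum.neutral) (auto split: sum.split)
    show "(\<Sum>k\<in>K. P l x k * P l x' k) = (\<Sum>k\<in>K. Q l x k * Q l x' k)" for l x x'
      unfolding PP QQ L2_set_inner by (simp add: algebra_simps)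
    show "(\<Sum>k\<in>K. Q l x k * Q l' x' k) \<le> (\<Sum>k\<in>K. P l x k * P l' x' k)" for l x l' x'
    proof -
      have "0 \<le> (L2_set l {..<m} * L2_set l' {..<m} - (\<Sum>i<m. l i * l' i)) * (L2_set x {..<n} * L2_set x' {..<n} - (\<Sum>j<n. x j * x' j))"
        by (intro mult_nonneg_nonneg) (simp_all add: inner_le_L2_set)
      then show ?thesis unfolding PP QQ by (simp add: algebra_simps)
    qed
  qed
  then show ?thesis unfolding lP lQ .
qed

section \<open>Chernoff bounds\<close>

text \<open>At s = 0 the moment generating function of \<open>Z - \<mu>\<close> is 1 and its slope
  is the negative mean, so it dips below 1 for some small s > 0. Dominated convergence of the
  difference quotients along \<open>s k\<close> replaces differentiation under the integral.\<close>

lemma integral_exp_tilt_less_1: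
  fixes Z :: "real \<Rightarrow> real"
  assumes [measurable]: "Z \<in> borel_measurable borel"
    and Z: "integrable gauss Z" and b: "b > 0" and E: "integrable gauss (\<lambda>x. exp (b * Z x))"
    and \<mu>: "integral\<^sup>L gauss Z < \<mu>"
  shows "\<exists>s>0. integrable gauss (\<lambda>x. exp (s * (Z x - \<mu>))) \<and> (\<integral>x. exp (s * (Z x - \<mu>)) \<partial>gauss) < 1"
proof -
  interpret G: prob_space gauss by simp
  define W where "W x = Z x - \<mu>" for x
  have [measurable]: "W \<in> borel_measurable borel" unfolding W_def[abs_def] by measurable
  have intW: "integrable gauss W" unfolding W_def[abs_def] using Z by auto
  have intE: "integrable gauss (\<lambda>x. exp (b * W x))"
    unfolding W_def using integrable_mult_right[OF E, of "exp (- b * \<mu>)"]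
    by (simp add: exp_add[symmetric] algebra_simps)
  define s where "s k = b / real (Suc k)" for k
  have s: "s k > 0" "s k \<le> b" for k using b by (auto simp: s_def divide_le_eq mult_le_cancel_left1)
  define h where "h k x = (exp (s k * W x) - 1) / s k" for k x
  have low: "W x \<le> h k x" for k x
  proof -
    have "s k * W x \<le> exp (s k * W x) - 1"
      using exp_ge_add_one_self[of "s k * W x"] by linarith
    then have "W x * s k \<le> exp (s k * W x) - 1" by (simp only: mult.commute)
    then show ?thesis using s(1)[of k] by (simp add: h_def le_divide_eq)
  qed
  \<comment> \<open>By convexity of exp the difference quotient at \<open>s k\<close> is at most the
    one at \<open>b\<close>; together with \<open>low\<close> this dominates the whole
    sequence.\<close>
  have up: "h k x \<le> (exp (b * W x) - 1) / b" for k x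
  proof -
    let ?r = "s k / b"
    have r: "0 \<le> ?r" "?r \<le> 1" using s b by (auto simp: less_imp_le)
    have "exp ((1 - ?r) *\<^sub>R 0 + ?r *\<^sub>R (b * W x)) \<le> (1 - ?r) * exp 0 + ?r * exp (b * W x)"
      by (rule convex_onD[OF exp_convex]) (use r in auto)
    also have "(1 - ?r) *\<^sub>R 0 + ?r *\<^sub>R (b * W x) = s k * W x" using b by simp
    finally have "exp (s k * W x) - 1 \<le> s k * ((exp (b * W x) - 1) / b)"
      by (simp add: algebra_simps diff_divide_distrib)
    then show ?thesis using s(1)[of k] by (simp only: h_def pos_divide_le_eq mult.commute)
  qed
  have lim: "(\<lambda>k. integral\<^sup>L gauss (h k)) \<longlonglongrightarrow> integral\<^sup>L gauss W"
  proof (rule integral_dominated_convergence[where w="\<lambda>x. \<bar>W x\<bar> + \<bar>(exp (b * W x) - 1) / b\<bar>"])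
    show "integrable gauss (\<lambda>x. \<bar>W x\<bar> + \<bar>(exp (b * W x) - 1) / b\<bar>)"
      using intW intE by auto
    show "AE x in gauss. (\<lambda>k. h k x) \<longlonglongrightarrow> W x"
    proof (rule AE_I2)
      fix x
      have "((\<lambda>u. exp (u * W x)) has_real_derivative W x) (at 0)"
        by (auto intro!: derivative_eq_intros)
      then have "((\<lambda>u. (exp (u * W x) - 1) / u) \<longlongrightarrow> W x) (at 0)"
        by (simp add: DERIV_def)
      moreover have "filterlim s (at 0) sequentially"
        unfolding filterlim_at
      proof
        show "s \<longlonglongrightarrow> 0" unfolding s_def by real_asymp
        show "\<forall>\<^sub>F k in sequentially. s k \<in> UNIV \<and> s k \<noteq> 0" using s(1) by (auto simp: less_imp_neq[symmetric])
      qed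
      ultimately show "(\<lambda>k. h k x) \<longlonglongrightarrow> W x"
        unfolding h_def using filterlim_compose by blast
    qed
    show "AE x in gauss. norm (h k x) \<le> \<bar>W x\<bar> + \<bar>(exp (b * W x) - 1) / b\<bar>" for k
    proof (rule AE_I2)
      fix x
      show "norm (h k x) \<le> \<bar>W x\<bar> + \<bar>(exp (b * W x) - 1) / b\<bar>"
        using low[of x k] up[of k x] unfolding real_norm_def by linarith
    qed
  qed (auto simp: h_def[abs_def])
  have "integral\<^sup>L gauss W < 0"
    unfolding W_def using Z \<mu> G.prob_space by simp
  then have "\<forall>\<^sub>F k in sequentially. integral\<^sup>L gauss (h k) < 0"
    using order_tendstoD(2)[OF lim] by blast
  then obtain k where k: "integral\<^sup>L gauss (h k) < 0"
    by (auto simp: eventually_sequentially)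
  have int: "integrable gauss (\<lambda>x. exp (s k * W x))"
  proof (rule Bochner_Integration.integrable_bound)
    show "integrable gauss (\<lambda>x. 1 + exp (b * W x))" using intE by auto
    show "AE x in gauss. norm (exp (s k * W x)) \<le> norm (1 + exp (b * W x))"
    proof (rule AE_I2)
      fix x
      have "exp (s k * W x) \<le> 1 + exp (b * W x)"
      proof (cases "W x \<ge> 0")
        case True
        then have e: "exp (s k * W x) \<le> exp (b * W x)" using s(2)[of k] by (simp add: mult_right_mono)
        show ?thesis using e exp_gt_zero by linarith
      next
        case False
        then have "exp (s k * W x) \<le> 1" using s(1)[of k] by (simp add: mult_nonneg_nonpos)
        then show ?thesis by (simp add: add_increasing2)
      qed
      then show "norm (exp (s k * W x)) \<le> norm (1 + exp (b * W x))" by simp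
    qed
  qed simp
  have "(\<integral>x. exp (s k * W x) \<partial>gauss) = 1 + s k * integral\<^sup>L gauss (h k)"
    unfolding h_def using s(1)[of k] int G.prob_space by simp
  also have "\<dots> < 1" using k s(1)[of k] by (simp add: mult_pos_neg)
  finally show ?thesis using int s(1)[of k] unfolding W_def by blast
qed

abbreviation sum_tail :: "'k set \<Rightarrow> 'k set \<Rightarrow> (real \<Rightarrow> real) \<Rightarrow> real \<Rightarrow> real" where
  "sum_tail K L Z \<mu> \<equiv> \<P>(w in gaussK K. (\<Sum>l\<in>L. Z (w l)) \<ge> real (card L) * \<mu>)"

text \<open>Chernoff's bound. The rate is fixed before \<open>K\<close> and \<open>L\<close>, hence
  uniform in the dimension, and \<open>L\<close> may be a proper part of \<open>K\<close> because
  each sum uses only one block of the Gaussian coordinates.\<close>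

lemma gauss_sum_upper_tail:
  fixes Z :: "real \<Rightarrow> real"
  assumes [measurable]: "Z \<in> borel_measurable borel"
    and "integrable gauss Z" and "b > 0" and "integrable gauss (\<lambda>x. exp (b * Z x))"
    and "integral\<^sup>L gauss Z < \<mu>"
  shows "\<exists>c>0. \<forall>(K :: 'k set) L. finite K \<longrightarrow> L \<subseteq> K \<longrightarrow>
     sum_tail K L Z \<mu> \<le> exp (- c * real (card L))"
proof -
  obtain s where s: "s > 0" and int: "integrable gauss (\<lambda>x. exp (s * (Z x - \<mu>)))"
    and less: "(\<integral>x. exp (s * (Z x - \<mu>)) \<partial>gauss) < 1"
    using integral_exp_tilt_less_1[OF assms] by blast
  \<comment> \<open>The maximum with 1/2 guarantees \<open>0 < q\<close>, so that
    \<open>ln q\<close> is a genuine logarithm.\<close>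
  define q where "q = max (1/2) (\<integral>x. exp (s * (Z x - \<mu>)) \<partial>gauss)"
  have q: "0 < q" "q < 1" using less by (auto simp: q_def)
  show ?thesis
  proof (intro exI[of _ "- ln q"] conjI allI impI)
    show "- ln q > 0" using q by simp
    fix K :: "'k set" and L assume K: "finite K" and L: "L \<subseteq> K"
    interpret N: prob_space "gaussK K" by (rule prob_space_gaussK)
    interpret product_prob_space "\<lambda>_::'k. gauss" by (rule product_prob_space_gauss)
    have [measurable]: "(\<lambda>w. w l) \<in> borel_measurable (gaussK K)" if "l \<in> L" for l
      by (rule measurable_gaussK_component) (use L that in blast)
    have fL: "finite L" using K L finite_subset by blast
    \<comment> \<open>Padding by 1 outside \<open>L\<close> gives a product over all of
      \<open>K\<close>, whose integral factorises.\<close>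
    define f where "f l x = (if l \<in> L then exp (s * (Z x - \<mu>)) else 1)" for l :: 'k and x
    have intf: "integrable gauss (f l)" for l
      unfolding f_def[abs_def] by (cases "l \<in> L") (auto simp: int)
    have prodf: "(\<Prod>l\<in>K. f l (w l)) = exp (s * ((\<Sum>l\<in>L. Z (w l)) - real (card L) * \<mu>))" for w
    proof -
      have "(\<Prod>l\<in>K. f l (w l)) = (\<Prod>l\<in>L. exp (s * (Z (w l) - \<mu>)))"
        unfolding f_def using K L by (simp add: prod.inter_restrict[symmetric] Int_absorb1 prod.If_cases)
      also have "\<dots> = exp (\<Sum>l\<in>L. s * (Z (w l) - \<mu>))" using fL by (simp add: exp_sum)
      also have "(\<Sum>l\<in>L. s * (Z (w l) - \<mu>)) = s * ((\<Sum>l\<in>L. Z (w l)) - real (card L) * \<mu>)"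
        by (simp add: sum_distrib_left[symmetric] sum_subtractf)
      finally show ?thesis .
    qed
    let ?A = "{w \<in> space (gaussK K). (\<Sum>l\<in>L. Z (w l)) \<ge> real (card L) * \<mu>}"
    have [measurable]: "?A \<in> sets (gaussK K)" by measurable
    have "measure (gaussK K) ?A = (\<integral>w. indicator ?A w \<partial>gaussK K)" by simp
    also have "\<dots> \<le> (\<integral>w. (\<Prod>l\<in>K. f l (w l)) \<partial>gaussK K)"
    proof (rule integral_mono)
      show "integrable (gaussK K) (\<lambda>w. \<Prod>l\<in>K. f l (w l))"
        by (intro product_integrable_prod K intf)
      show "indicator ?A w \<le> (\<Prod>l\<in>K. f l (w l))" for w
        unfolding prodf using s by (simp add: indicator_def)
    qed (simp add: N.integrable_const_bound[where B=1])
    also have "\<dots> = (\<Prod>l\<in>K. integral\<^sup>L gauss (f l))"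
      by (intro product_integral_prod K intf)
    also have "\<dots> = (\<Prod>l\<in>L. \<integral>x. exp (s * (Z x - \<mu>)) \<partial>gauss)"
    proof -
      have "integral\<^sup>L gauss (f l) = (if l \<in> L then \<integral>x. exp (s * (Z x - \<mu>)) \<partial>gauss else 1)" for l
        unfolding f_def[abs_def] using prob_space.prob_space[OF prob_space_gauss] by (simp del: space_gauss)
      then show ?thesis using K L by (simp add: prod.inter_restrict[symmetric] Int_absorb1 prod.If_cases)
    qed
    also have "\<dots> \<le> q ^ card L"
      by (simp add: q_def power_mono)
    also have "\<dots> = exp (- (- ln q) * real (card L))"
      using q exp_of_nat_mult[of "card L" "ln q"] by (simp add: mult.commute)
    finally show "measure (gaussK K) ?A \<le> exp (- (- ln q) * real (card L))" .
  qed
qed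

text \<open>Any coefficient below 1/2 is integrable; 1/4 turns the integrand into a multiple of the
  normal density of variance 2.\<close>

lemma integrable_gauss_exp_square: "integrable gauss (\<lambda>x. exp (x\<^sup>2 / 4))"
proof (subst integrable_gauss_iff)
  have "std_normal_density x * exp (x\<^sup>2 / 4) = sqrt 2 * normal_density 0 (sqrt 2) x" for x
    by (simp add: normal_density_def real_sqrt_mult exp_add[symmetric] field_simps)
  then show "integrable lborel (\<lambda>x. std_normal_density x * exp (x\<^sup>2 / 4))" by simp
qed simp

text \<open>Markov's inequality for \<open>exp (x\<^sup>2 / 4)\<close>. The constant is uniform in
  \<open>K\<close> and \<open>a\<close>; adding 1 to the integral makes its positivity
  immediate.\<close>

lemma gauss_coordinate_tail:
  fixes k :: 'k
  shows "\<exists>C>0. \<forall>(K :: 'k set) a. k \<in> K \<longrightarrow> 0 \<le> a \<longrightarrow>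
     \<P>(w in gaussK K. w k \<ge> a) \<le> C * exp (- (a\<^sup>2 / 4))"
proof (intro exI[of _ "1 + (\<integral>x. exp (x\<^sup>2 / 4) \<partial>gauss)"] conjI allI impI)
  have pos: "0 \<le> (\<integral>x. exp (x\<^sup>2 / 4) \<partial>gauss)" by (rule Bochner_Integration.integral_nonneg) simp
  then show "0 < 1 + (\<integral>x. exp (x\<^sup>2 / 4) \<partial>gauss)" by linarith
  fix K :: "'k set" and a :: real assume k: "k \<in> K" and a: "0 \<le> a"
  interpret N: prob_space "gaussK K" by (rule prob_space_gaussK)
  let ?A = "{w \<in> space (gaussK K). w k \<ge> a}"
  have [measurable]: "(\<lambda>w. w k) \<in> borel_measurable (gaussK K)" using k by (rule measurable_gaussK_component)
  have [measurable]: "?A \<in> sets (gaussK K)" by measurable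
  have "measure (gaussK K) ?A = (\<integral>w. indicator ?A w \<partial>gaussK K)" by simp
  also have "\<dots> \<le> (\<integral>w. exp (- (a\<^sup>2 / 4)) * exp ((w k)\<^sup>2 / 4) \<partial>gaussK K)"
  proof (rule integral_mono)
    show "integrable (gaussK K) (\<lambda>w. exp (- (a\<^sup>2 / 4)) * exp ((w k)\<^sup>2 / 4))"
      by (intro integrable_mult_right integrable_gaussK_component[where f="\<lambda>x. exp (x\<^sup>2 / 4)"] k integrable_gauss_exp_square)
    show "indicator ?A w \<le> exp (- (a\<^sup>2 / 4)) * exp ((w k)\<^sup>2 / 4)" for w
      using a power_mono[of a "w k" 2] by (auto simp: indicator_def exp_add[symmetric])
  qed (simp add: N.integrable_const_bound[where B=1])
  also have "\<dots> = exp (- (a\<^sup>2 / 4)) * (\<integral>x. exp (x\<^sup>2 / 4) \<partial>gauss)"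
  proof -
    have "(\<integral>x. exp (x\<^sup>2 / 4) \<partial>distr (gaussK K) gauss (\<lambda>w. w k)) = (\<integral>w. exp ((w k)\<^sup>2 / 4) \<partial>gaussK K)"
      using k by (intro integral_distr) (auto simp: measurable_cong_sets[OF sets_gauss refl])
    then show ?thesis using distr_gaussK_component[OF k] by simp
  qed
  also have "\<dots> \<le> (1 + (\<integral>x. exp (x\<^sup>2 / 4) \<partial>gauss)) * exp (- (a\<^sup>2 / 4))"
    by (simp add: algebra_simps)
  finally show "measure (gaussK K) ?A \<le> (1 + (\<integral>x. exp (x\<^sup>2 / 4) \<partial>gauss)) * exp (- (a\<^sup>2 / 4))" .
qed

section \<open>Gaussian tail moments\<close>

lemma set_integral_atLeast_FTC:
  fixes f F :: "real \<Rightarrow> real"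
  assumes deriv: "\<And>x. (F has_real_derivative f x) (at x)" and cont: "\<And>x. isCont f x"
    and int: "integrable lborel f" and lim: "(F \<longlongrightarrow> L) at_top"
  shows "(LBINT x:{a..}. f x) = L - F a"
proof -
  have "(LBINT x=ereal a..\<infinity>. f x) = L - F a"
  proof (rule interval_integral_FTC_integrable)
    show "(F has_vector_derivative f x) (at x)" for x
      using deriv by (simp add: has_real_derivative_iff_has_vector_derivative)
    show "set_integrable lborel (einterval (ereal a) \<infinity>) f"
      unfolding set_integrable_def using integrable_mult_indicator[OF _ int] by simp
    show "((F \<circ> real_of_ereal) \<longlongrightarrow> L) (at_left \<infinity>)"
      using lim by (simp add: ereal_tendsto_simps1)
    have "(F \<longlongrightarrow> F a) (at_right a)"
      using DERIV_isCont[OF deriv] by (simp add: isCont_def filterlim_at_split)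
    then show "((F \<circ> real_of_ereal) \<longlongrightarrow> F a) (at_right (ereal a))"
      by (simp add: ereal_tendsto_simps1)
  qed (use cont in auto)
  moreover have "(LBINT x:{a<..}. f x) = (LBINT x:{a..}. f x)"
    unfolding set_lebesgue_integral_def
  proof (rule integral_cong_AE)
    show "AE x in lborel. indicator {a<..} x *\<^sub>R f x = indicator {a..} x *\<^sub>R f x"
      using AE_lborel_singleton[of a] by eventually_elim (auto simp: indicator_def)
  qed (use int in auto)
  ultimately show ?thesis by (simp add: interval_integral_to_infinity_eq)
qed

definition Q_tail :: "real \<Rightarrow> real" where
  "Q_tail a = (LBINT z:{a..}. std_normal_density z)"

lemma std_normal_density_times_id_tendsto:
  "((\<lambda>z. z * std_normal_density z) \<longlongrightarrow> 0) at_top"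
proof -
  have "((\<lambda>z::real. z * exp (- z\<^sup>2 / 2)) \<longlongrightarrow> 0) at_top" by real_asymp
  from tendsto_mult[OF tendsto_const[of "1 / sqrt (2*pi)"] this]
  show ?thesis unfolding std_normal_density_def by (simp add: mult_ac)
qed

lemma isCont_std_normal_density: "isCont std_normal_density x"
  using DERIV_std_normal_density DERIV_isCont by blast

lemma tail_moment_1: "(LBINT z:{a..}. std_normal_density z * z) = std_normal_density a"
proof -
  have "(LBINT z:{a..}. std_normal_density z * z) = 0 - (- std_normal_density a)"
  proof (rule set_integral_atLeast_FTC)
    show "((\<lambda>z. - std_normal_density z) has_real_derivative std_normal_density x * x) (at x)" for x
      by (auto intro!: derivative_eq_intros DERIV_std_normal_density)
    show "((\<lambda>z. - std_normal_density z) \<longlongrightarrow> 0) at_top"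
      using tendsto_minus[OF std_normal_density_tendsto(1)] by simp
    show "integrable lborel (\<lambda>z. std_normal_density z * z)"
      using integrable_std_normal_moment[of 1] by simp
  qed (intro continuous_intros isCont_std_normal_density)
  then show ?thesis by simp
qed

lemma set_integrable_tail: "set_integrable lborel {a..} (\<lambda>z::real. std_normal_density z * z ^ k)"
  unfolding set_integrable_def
  using integrable_mult_indicator[OF _ integrable_std_normal_moment[of k]] by simp

lemma tail_moment_2: "(LBINT z:{a..}. std_normal_density z * z\<^sup>2) = a * std_normal_density a + Q_tail a"
proof -
  have "(LBINT z:{a..}. std_normal_density z * z\<^sup>2 - std_normal_density z) = 0 - (- (a * std_normal_density a))"
  proof (rule set_integral_atLeast_FTC)
    show "((\<lambda>z. - (z * std_normal_density z)) has_real_derivative std_normal_density x * x\<^sup>2 - std_normal_density x) (at x)" for x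
      by (auto intro!: derivative_eq_intros DERIV_std_normal_density simp: power2_eq_square)
    show "((\<lambda>z. - (z * std_normal_density z)) \<longlongrightarrow> 0) at_top"
      using tendsto_minus[OF std_normal_density_times_id_tendsto] by simp
    show "integrable lborel (\<lambda>z. std_normal_density z * z\<^sup>2 - std_normal_density z)"
      using integrable_std_normal_moment[of 2] integrable_std_normal_moment[of 0] by simp
  qed (intro continuous_intros isCont_std_normal_density)
  moreover have "(LBINT z:{a..}. std_normal_density z * z\<^sup>2 - std_normal_density z)
     = (LBINT z:{a..}. std_normal_density z * z\<^sup>2) - Q_tail a"
    unfolding Q_tail_def
    using set_integrable_tail[of a 2] set_integrable_tail[of a 0] by (subst set_integral_diff) auto
  ultimately show ?thesis by simp
qed

lemma std_normal_density_minus [simp]: "std_normal_density (- z) = std_normal_density z"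
  by (simp add: std_normal_density_def)

lemma set_integral_reflect:
  fixes f :: "real \<Rightarrow> real"
  shows "(LBINT z:{- c..}. f z) = (LBINT z:{..c}. f (- z))"
proof -
  have "(LBINT z:{- c..}. f z) = (LBINT z. indicator {- c..} (- z) * f (- z))"
    unfolding set_lebesgue_integral_def
    using lborel_integral_real_affine[of "-1" "\<lambda>z. indicator {- c..} z *\<^sub>R f z" 0] by simp
  also have "\<dots> = (LBINT z:{..c}. f (- z))"
    unfolding set_lebesgue_integral_def
    by (intro Bochner_Integration.integral_cong) (auto simp: indicator_def)
  finally show ?thesis .
qed

lemma Q_tail_minus: "Q_tail (- a) = 1 - Q_tail a"
proof -
  have i: "integrable lborel std_normal_density" using integrable_std_normal_moment[of 0] by simp
  have "Q_tail (- a) = (LBINT z:{..a}. std_normal_density z)"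
    unfolding Q_tail_def by (subst set_integral_reflect) simp
  moreover have "(LBINT z:{..a}. std_normal_density z) + Q_tail a = (LBINT z. std_normal_density z)"
    unfolding Q_tail_def set_lebesgue_integral_def
  proof (subst Bochner_Integration.integral_add[symmetric])
    show "integrable lborel (\<lambda>x. indicat_real {..a} x *\<^sub>R std_normal_density x)"
      "integrable lborel (\<lambda>x. indicat_real {a..} x *\<^sub>R std_normal_density x)"
      using integrable_mult_indicator[OF _ i] by auto
    show "(LBINT x. indicat_real {..a} x *\<^sub>R std_normal_density x + indicat_real {a..} x *\<^sub>R std_normal_density x)
       = (LBINT z. std_normal_density z)"
    proof (rule integral_cong_AE)
      show "AE x in lborel. indicat_real {..a} x *\<^sub>R std_normal_density x + indicat_real {a..} x *\<^sub>R std_normal_density x = std_normal_density x"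
        using AE_lborel_singleton[of a] by eventually_elim (auto simp: indicator_def)
    qed auto
  qed
  ultimately show ?thesis by simp
qed

lemma Q_tail_0: "Q_tail 0 = 1 / 2"
  using Q_tail_minus[of 0] by simp

text \<open>The substitution \<open>t = z / sqrt 2\<close> moves everything to the normal tail, in
  terms of which the truncated moments above are expressed.\<close>

lemma erfc_eq_Q_tail: "erfc x = 2 * Q_tail (sqrt 2 * x)"
proof -
  have "(LBINT t:{x..}. exp (- t\<^sup>2)) = 1 / sqrt 2 * (LBINT z. indicator {x..} (z / sqrt 2) * exp (- (z / sqrt 2)\<^sup>2))"
    unfolding set_lebesgue_integral_def
    using lborel_integral_real_affine[of "1 / sqrt 2" "\<lambda>t. indicator {x..} t *\<^sub>R exp (- t\<^sup>2)" 0] by simp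
  also have "(LBINT z. indicator {x..} (z / sqrt 2) * exp (- (z / sqrt 2)\<^sup>2))
      = (LBINT z. sqrt (2 * pi) * (indicator {sqrt 2 * x..} z * std_normal_density z))"
    by (intro Bochner_Integration.integral_cong)
       (auto simp: indicator_def std_normal_density_def le_divide_eq mult.commute power_divide)
  also have "\<dots> = sqrt (2 * pi) * Q_tail (sqrt 2 * x)"
    unfolding Q_tail_def set_lebesgue_integral_def by simp
  finally show ?thesis unfolding erfc_def by (simp add: real_sqrt_mult)
qed

lemma f_gar_alt:
  "f_gar c = (LBINT z:{- c..}. std_normal_density z * (z + c)\<^sup>2)"
proof -
  have "std_normal_density z * (z + c)\<^sup>2 = 1 / sqrt (2 * pi) * ((z + c)\<^sup>2 * exp (- (z\<^sup>2 / 2)))" for z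
    by (simp add: std_normal_density_def)
  then show ?thesis unfolding f_gar_def by simp
qed

lemma f_gar_reflect:
  "f_gar c = 1 / sqrt (2 * pi) * (LBINT z:{..c}. (z - c)\<^sup>2 * exp (- (z\<^sup>2 / 2)))"
  unfolding f_gar_def set_integral_reflect by (simp add: power2_commute[of c])

lemma f_gar_closed: "f_gar c = c * std_normal_density c + (c\<^sup>2 + 1) * Q_tail (- c)"
proof -
  have "f_gar c = (LBINT z:{- c..}. std_normal_density z * z ^ 2 + (2 * c * (std_normal_density z * z ^ 1) + c\<^sup>2 * (std_normal_density z * z ^ 0)))"
    unfolding f_gar_alt by (simp add: power2_sum algebra_simps power2_eq_square)
  also have "\<dots> = (LBINT z:{- c..}. std_normal_density z * z ^ 2) + (2 * c * (LBINT z:{- c..}. std_normal_density z * z ^ 1) + c\<^sup>2 * (LBINT z:{- c..}. std_normal_density z * z ^ 0))"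
    using set_integrable_tail[of "-c" 2] set_integrable_tail[of "-c" 1] set_integrable_tail[of "-c" 0]
    by (subst set_integral_add; (intro set_integral_add set_integrable_mult_right)?; simp?)
  also have "\<dots> = c * std_normal_density c + (c\<^sup>2 + 1) * Q_tail (- c)"
    using tail_moment_1[of "-c"] tail_moment_2[of "-c"] by (simp add: Q_tail_def[symmetric] algebra_simps power2_eq_square)
  finally show ?thesis .
qed

text \<open>The sum of \<open>l i * (c - h i)\<close> over a nonnegative unit vector
  \<open>l\<close> is at most the norm of the positive part of \<open>c - h\<close>; the entries of
  its square have this mean, which is how \<open>f_gar\<close> enters the argument.\<close>

lemma f_gar_eq_integral: "f_gar c = (\<integral>h. (max 0 (c - h))\<^sup>2 \<partial>gauss)"
proof -
  have "f_gar c = (LBINT z:{..c}. std_normal_density z * (c - z)\<^sup>2)"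
    unfolding f_gar_alt set_integral_reflect by (simp add: algebra_simps)
  also have "\<dots> = (\<integral>h. (max 0 (c - h))\<^sup>2 \<partial>gauss)"
    unfolding set_lebesgue_integral_def
    by (subst integral_gauss) (auto intro!: Bochner_Integration.integral_cong simp: indicator_def max_def)
  finally show ?thesis .
qed

section \<open>The clipped direction\<close>

text \<open>The minimiser of \<open>\<gamma> y\<^sup>2 - g y\<close> over \<open>y \<in> [-1, 1]\<close>.\<close>

definition clip :: "real \<Rightarrow> real \<Rightarrow> real" where
  "clip \<gamma> g = max (- 1) (min 1 (g / (2 * \<gamma>)))"

lemma measurable_clip [measurable]: "clip \<gamma> \<in> borel_measurable borel"
  unfolding clip_def[abs_def] by measurable

lemma clip_abs_le_1: "\<bar>clip \<gamma> g\<bar> \<le> 1"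
  by (auto simp: clip_def abs_le_iff)

lemma clip_cases:
  assumes "\<gamma> > 0"
  shows "\<bar>g\<bar> \<le> 2 * \<gamma> \<Longrightarrow> clip \<gamma> g = g / (2 * \<gamma>)"
    and "g \<ge> 2 * \<gamma> \<Longrightarrow> clip \<gamma> g = 1"
    and "g \<le> - (2 * \<gamma>) \<Longrightarrow> clip \<gamma> g = - 1"
  using assms by (auto simp: clip_def max_def min_def field_simps abs_le_iff)

lemma clip_minus: "\<gamma> > 0 \<Longrightarrow> clip \<gamma> (- g) = - clip \<gamma> g"
  by (auto simp: clip_def max_def min_def field_simps)

lemma mult_clip_nonneg: "\<gamma> > 0 \<Longrightarrow> 0 \<le> g * clip \<gamma> g"
  by (auto simp: clip_def max_def min_def field_simps zero_le_mult_iff)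

lemma abs_mult_clip_le: "\<bar>g * clip \<gamma> g\<bar> \<le> \<bar>g\<bar>"
  using mult_left_mono[OF clip_abs_le_1[of \<gamma> g], of "\<bar>g\<bar>"] by (simp add: abs_mult)

lemma clip_sq_le_1: "(clip \<gamma> g)\<^sup>2 \<le> 1"
  using clip_abs_le_1[of \<gamma> g] by (simp add: abs_square_le_1)

lemma integrable_clip_sq: "integrable gauss (\<lambda>g. (clip \<gamma> g)\<^sup>2)"
  by (rule integrable_gauss_bounded[where B=1]) (auto simp: clip_sq_le_1)

lemma integrable_mult_clip: "integrable gauss (\<lambda>g. g * clip \<gamma> g)"
proof (rule Bochner_Integration.integrable_bound)
  show "integrable gauss (\<lambda>g. \<bar>g\<bar>)" using integrable_gauss_id by (rule integrable_abs)
  show "AE g in gauss. norm (g * clip \<gamma> g) \<le> norm \<bar>g\<bar>"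
    using abs_mult_clip_le by (auto intro!: AE_I2)
qed simp

definition clip_corr :: "real \<Rightarrow> real" where
  "clip_corr \<gamma> = (\<integral>g. g * clip \<gamma> g \<partial>gauss)"

definition clip_energy :: "real \<Rightarrow> real" where
  "clip_energy \<gamma> = (\<integral>g. (clip \<gamma> g)\<^sup>2 \<partial>gauss)"

text \<open>The first and third bounds compare the minimum with the values of
  \<open>\<gamma> * y\<^sup>2 - g * y\<close> at y = 0 and y = sgn g; the second drops the
  nonnegative square.\<close>

lemma clip_objective_bounds:
  assumes "\<gamma> > 0"
  shows "\<gamma> * (clip \<gamma> g)\<^sup>2 - g * clip \<gamma> g \<le> 0"
    and "- \<bar>g\<bar> \<le> \<gamma> * (clip \<gamma> g)\<^sup>2 - g * clip \<gamma> g"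
    and "\<gamma> * (clip \<gamma> g)\<^sup>2 - g * clip \<gamma> g \<le> - \<bar>g\<bar> + \<gamma>"
proof -
  consider "\<bar>g\<bar> \<le> 2 * \<gamma>" | "g \<ge> 2 * \<gamma>" | "g \<le> - (2 * \<gamma>)" by linarith
  note cases = this
  show "\<gamma> * (clip \<gamma> g)\<^sup>2 - g * clip \<gamma> g \<le> 0"
    using assms by (cases rule: cases) (simp_all add: clip_cases power2_eq_square field_simps)
  have "\<bar>g * clip \<gamma> g\<bar> \<le> \<bar>g\<bar>" "0 \<le> \<gamma> * (clip \<gamma> g)\<^sup>2"
    using abs_mult_clip_le assms by auto
  then show "- \<bar>g\<bar> \<le> \<gamma> * (clip \<gamma> g)\<^sup>2 - g * clip \<gamma> g" by linarith
  show "\<gamma> * (clip \<gamma> g)\<^sup>2 - g * clip \<gamma> g \<le> - \<bar>g\<bar> + \<gamma>"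
  proof (cases rule: cases)
    case 1
    have "0 \<le> (\<bar>g\<bar> - 2 * \<gamma>)\<^sup>2" by simp
    then have "\<bar>g\<bar> * (\<gamma> * 4) \<le> g\<^sup>2 + 4 * \<gamma>\<^sup>2" by (simp add: power2_diff algebra_simps power_mult_distrib)
    with 1 assms show ?thesis by (simp add: clip_cases power2_eq_square field_simps)
  qed (use assms in \<open>simp_all add: clip_cases\<close>)
qed

lemma clip_objective_expectation:
  assumes \<gamma>: "\<gamma> > 0"
  shows "(\<integral>g. \<gamma> * (clip \<gamma> g)\<^sup>2 - g * clip \<gamma> g \<partial>gauss) = - clip_corr \<gamma> + \<gamma> * clip_energy \<gamma>"
    and "integrable gauss (\<lambda>g. \<gamma> * (clip \<gamma> g)\<^sup>2 - g * clip \<gamma> g)"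
  using integrable_clip_sq integrable_mult_clip by (auto simp: clip_corr_def clip_energy_def)

text \<open>The erfc formula is, up to sign, the Lagrange dual function with multiplier \<gamma>:
  the mean of the pointwise minimum over y in [-1, 1], with the constraint level \<beta> subtracted.
  Evenness reduces the integral to the positive half-line.\<close>

lemma f_box_expr_eq:
  assumes \<gamma>: "\<gamma> > 0"
  shows "f_box_expr \<beta> \<gamma> = - clip_corr \<gamma> + \<gamma> * clip_energy \<gamma> - \<gamma> * \<beta>"
proof -
  define u where "u g = \<gamma> * (clip \<gamma> g)\<^sup>2 - g * clip \<gamma> g" for g
  have [measurable]: "u \<in> borel_measurable borel" unfolding u_def[abs_def] by measurable
  let ?\<phi> = std_normal_density
  \<comment> \<open>For \<open>z \<ge> 0\<close>, \<open>u z\<close> is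
    \<open>- z\<^sup>2 / (4 * \<gamma>)\<close> below \<open>2 * \<gamma>\<close> and
    \<open>\<gamma> - z\<close> above. Extending the first branch to all of \<open>{0..}\<close> and
    correcting it on \<open>{2 * \<gamma>..}\<close> leaves only half-line moments.\<close>
  have pw: "indicator {0..} z *\<^sub>R (?\<phi> z * u z) =
      (- (1 / (4 * \<gamma>))) * (indicator {0..} z *\<^sub>R (?\<phi> z * z ^ 2))
      + ((1 / (4 * \<gamma>)) * (indicator {2 * \<gamma>..} z *\<^sub>R (?\<phi> z * z ^ 2))
      + (\<gamma> * (indicator {2 * \<gamma>..} z *\<^sub>R (?\<phi> z * z ^ 0)) - indicator {2 * \<gamma>..} z *\<^sub>R (?\<phi> z * z ^ 1)))" for z
  proof -
    consider "z < 0" | "0 \<le> z" "z < 2 * \<gamma>" | "2 * \<gamma> \<le> z" by linarith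
    then show ?thesis
      using \<gamma> by cases (simp_all add: u_def clip_cases indicator_def power2_eq_square field_simps)
  qed
  have i: "integrable lborel (\<lambda>z. indicator {a..} z *\<^sub>R (?\<phi> z * z ^ k))" for a k
    using integrable_mult_indicator[OF _ integrable_std_normal_moment[of k]] by simp
  have hb: "has_bochner_integral lborel (\<lambda>z. indicator {0..} z *\<^sub>R (?\<phi> z * u z))
     ((- (1 / (4 * \<gamma>))) * (LBINT z:{0..}. ?\<phi> z * z ^ 2)
      + ((1 / (4 * \<gamma>)) * (LBINT z:{2*\<gamma>..}. ?\<phi> z * z ^ 2)
      + (\<gamma> * (LBINT z:{2*\<gamma>..}. ?\<phi> z * z ^ 0) - (LBINT z:{2*\<gamma>..}. ?\<phi> z * z ^ 1))))"
    unfolding pw set_lebesgue_integral_def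
    by (intro has_bochner_integral_add has_bochner_integral_diff has_bochner_integral_mult_right
        has_bochner_integral_integrable i)
  have "has_bochner_integral lborel (\<lambda>z. ?\<phi> z * u z)
     (2 *\<^sub>R ((- (1 / (4 * \<gamma>))) * (LBINT z:{0..}. ?\<phi> z * z ^ 2)
      + ((1 / (4 * \<gamma>)) * (LBINT z:{2*\<gamma>..}. ?\<phi> z * z ^ 2)
      + (\<gamma> * (LBINT z:{2*\<gamma>..}. ?\<phi> z * z ^ 0) - (LBINT z:{2*\<gamma>..}. ?\<phi> z * z ^ 1)))))"
    by (rule has_bochner_integral_even_function[OF hb]) (simp add: u_def clip_minus \<gamma>)
  then have "integral\<^sup>L gauss u = 2 * ((- (1 / (4 * \<gamma>))) * (LBINT z:{0..}. ?\<phi> z * z ^ 2)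
      + ((1 / (4 * \<gamma>)) * (LBINT z:{2*\<gamma>..}. ?\<phi> z * z ^ 2)
      + (\<gamma> * (LBINT z:{2*\<gamma>..}. ?\<phi> z * z ^ 0) - (LBINT z:{2*\<gamma>..}. ?\<phi> z * z ^ 1))))"
    by (subst integral_gauss) (simp_all add: has_bochner_integral_integral_eq)
  also have "\<dots> = 2 * (- (1 / (8 * \<gamma>)) + (1 / (4 * \<gamma>)) * (2 * \<gamma> * ?\<phi> (2 * \<gamma>) + Q_tail (2 * \<gamma>)) + \<gamma> * Q_tail (2 * \<gamma>) - ?\<phi> (2 * \<gamma>))"
    using tail_moment_1[of "2 * \<gamma>"] by (simp add: tail_moment_2 Q_tail_def[symmetric] Q_tail_0)
  also have "\<dots> = - ?\<phi> (2 * \<gamma>) + 2 * \<gamma> * Q_tail (2 * \<gamma>) - 1 / (4 * \<gamma>) * (1 - 2 * Q_tail (2 * \<gamma>))"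
    using \<gamma> by (simp add: field_simps)
  finally have u: "integral\<^sup>L gauss u = - ?\<phi> (2 * \<gamma>) + 2 * \<gamma> * Q_tail (2 * \<gamma>) - 1 / (4 * \<gamma>) * (1 - 2 * Q_tail (2 * \<gamma>))" .
  have s2: "sqrt 2 * (2 * \<gamma> / sqrt 2) = 2 * \<gamma>" "sqrt 2 * (- (2 * \<gamma> / sqrt 2)) = - (2 * \<gamma>)" by simp_all
  have "f_box_expr \<beta> \<gamma> = integral\<^sup>L gauss u - \<gamma> * \<beta>"
    unfolding u f_box_expr_def erfc_eq_Q_tail s2 Q_tail_minus
    by (simp add: std_normal_density_def power_mult_distrib algebra_simps)
  then show ?thesis
    using clip_objective_expectation[OF \<gamma>] unfolding u_def[abs_def] by simp
qed

text \<open>The first bound keeps the supremum in \<open>f_box_hat\<close> at or below 0; the other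
  two squeeze the expression as \<gamma> tends to 0 from the right and thereby determine its value
  at \<gamma> = 0.\<close>

lemma clip_objective_mean_bounds:
  assumes \<gamma>: "\<gamma> > 0"
  shows "- clip_corr \<gamma> + \<gamma> * clip_energy \<gamma> \<le> 0"
    and "- (\<integral>g. \<bar>g\<bar> \<partial>gauss) \<le> - clip_corr \<gamma> + \<gamma> * clip_energy \<gamma>"
    and "- clip_corr \<gamma> + \<gamma> * clip_energy \<gamma> \<le> - (\<integral>g. \<bar>g\<bar> \<partial>gauss) + \<gamma>"
proof -
  interpret G: prob_space gauss by simp
  have i: "integrable gauss (\<lambda>g. - \<bar>g\<bar>)" using integrable_gauss_id by auto
  have "(\<integral>g. \<gamma> * (clip \<gamma> g)\<^sup>2 - g * clip \<gamma> g \<partial>gauss) \<le> (\<integral>g. 0 \<partial>gauss)"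
    using clip_objective_bounds(1)[OF \<gamma>] clip_objective_expectation(2)[OF \<gamma>] by (intro integral_mono) auto
  then show "- clip_corr \<gamma> + \<gamma> * clip_energy \<gamma> \<le> 0" using clip_objective_expectation(1)[OF \<gamma>] by simp
  have "(\<integral>g. - \<bar>g\<bar> \<partial>gauss) \<le> (\<integral>g. \<gamma> * (clip \<gamma> g)\<^sup>2 - g * clip \<gamma> g \<partial>gauss)"
    using clip_objective_bounds(2)[OF \<gamma>] clip_objective_expectation(2)[OF \<gamma>] i by (intro integral_mono) auto
  then show "- (\<integral>g. \<bar>g\<bar> \<partial>gauss) \<le> - clip_corr \<gamma> + \<gamma> * clip_energy \<gamma>"
    using clip_objective_expectation(1)[OF \<gamma>] by simp
  have "(\<integral>g. \<gamma> * (clip \<gamma> g)\<^sup>2 - g * clip \<gamma> g \<partial>gauss) \<le> (\<integral>g. - \<bar>g\<bar> + \<gamma> \<partial>gauss)"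
    using clip_objective_bounds(3)[OF \<gamma>] clip_objective_expectation(2)[OF \<gamma>] i by (intro integral_mono) auto
  also have "\<dots> = - (\<integral>g. \<bar>g\<bar> \<partial>gauss) + \<gamma>"
    using integrable_abs[OF integrable_gauss_id] G.prob_space by simp
  finally show "- clip_corr \<gamma> + \<gamma> * clip_energy \<gamma> \<le> - (\<integral>g. \<bar>g\<bar> \<partial>gauss) + \<gamma>"
    using clip_objective_expectation(1)[OF \<gamma>] by simp
qed

lemma f_box_expr_Lim: "Lim (at_right 0) (f_box_expr \<beta>) = - (\<integral>g. \<bar>g\<bar> \<partial>gauss)"
proof (rule tendsto_Lim)
  let ?e = "\<integral>g. \<bar>g\<bar> \<partial>gauss"
  have ev: "\<forall>\<^sub>F \<gamma> in at_right 0. (0::real) < \<gamma>" by (simp add: eventually_at_right_less)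
  show "(f_box_expr \<beta> \<longlongrightarrow> - ?e) (at_right 0)"
  proof (rule tendsto_sandwich)
    show "\<forall>\<^sub>F \<gamma> in at_right 0. - ?e - \<gamma> * \<beta> \<le> f_box_expr \<beta> \<gamma>"
      using ev by eventually_elim (use clip_objective_mean_bounds in \<open>simp add: f_box_expr_eq\<close>)
    show "\<forall>\<^sub>F \<gamma> in at_right 0. f_box_expr \<beta> \<gamma> \<le> - ?e + \<gamma> - \<gamma> * \<beta>"
      using ev by eventually_elim (use clip_objective_mean_bounds in \<open>simp add: f_box_expr_eq\<close>)
    show "((\<lambda>\<gamma>. - ?e - \<gamma> * \<beta>) \<longlongrightarrow> - ?e) (at_right 0)"
      by (auto intro!: tendsto_eq_intros)
    show "((\<lambda>\<gamma>. - ?e + \<gamma> - \<gamma> * \<beta>) \<longlongrightarrow> - ?e) (at_right 0)"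
      by (auto intro!: tendsto_eq_intros)
  qed
qed simp

text \<open>The second bound is weak duality: each multiplier gives an upper estimate of
  \<open>- f_box_hat \<beta>\<close>. Its excess over
  \<open>clip_corr \<gamma> / sqrt \<beta>\<close> is the complementary slackness term, which a
  suitable \<gamma> makes small.\<close>

lemma f_box_hat_bounds:
  assumes \<beta>: "0 < \<beta>"
  shows "f_box_hat \<beta> \<le> 0"
    and "\<gamma> > 0 \<Longrightarrow> - f_box_hat \<beta> \<le> (clip_corr \<gamma> + \<gamma> * (\<beta> - clip_energy \<gamma>)) / sqrt \<beta>"
proof -
  define v where "v \<gamma> = (if \<gamma> = 0 then Lim (at_right 0) (f_box_expr \<beta>) else f_box_expr \<beta> \<gamma>)" for \<gamma>
  have v0: "v \<gamma> \<le> 0" if \<gamma>: "\<gamma> \<ge> 0" for \<gamma>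
  proof (cases "\<gamma> = 0")
    case True
    then show ?thesis by (simp add: v_def f_box_expr_Lim)
  next
    case False
    then have "\<gamma> > 0" "0 \<le> \<gamma> * \<beta>" using \<gamma> \<beta> by auto
    then show ?thesis using clip_objective_mean_bounds(1)[of \<gamma>] False by (simp add: v_def f_box_expr_eq)
  qed
  have bdd: "bdd_above (v ` {0..})" by (rule bdd_aboveI[of _ 0]) (use v0 in auto)
  have hat: "f_box_hat \<beta> = 1 / sqrt \<beta> * (SUP \<gamma>\<in>{0..}. v \<gamma>)"
    unfolding f_box_hat_def v_def ..
  have "(SUP \<gamma>\<in>{0..}. v \<gamma>) \<le> 0" by (rule cSUP_least) (use v0 in auto)
  then show "f_box_hat \<beta> \<le> 0" unfolding hat using \<beta> by (simp add: divide_nonpos_pos)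
  assume \<gamma>: "\<gamma> > 0"
  then have "v \<gamma> \<le> (SUP \<gamma>\<in>{0..}. v \<gamma>)" by (intro cSUP_upper bdd) auto
  then have "- (SUP \<gamma>\<in>{0..}. v \<gamma>) \<le> clip_corr \<gamma> + \<gamma> * (\<beta> - clip_energy \<gamma>)"
    using \<gamma> by (simp add: v_def f_box_expr_eq algebra_simps)
  then show "- f_box_hat \<beta> \<le> (clip_corr \<gamma> + \<gamma> * (\<beta> - clip_energy \<gamma>)) / sqrt \<beta>"
    unfolding hat using \<beta> divide_right_mono[of _ _ "sqrt \<beta>"] by fastforce
qed

lemma clip_sq_eq: "\<gamma> > 0 \<Longrightarrow> (clip \<gamma> g)\<^sup>2 = min (g\<^sup>2 / (4 * \<gamma>\<^sup>2)) 1"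
proof -
  assume \<gamma>: "\<gamma> > 0"
  consider "\<bar>g\<bar> \<le> 2 * \<gamma>" | "g \<ge> 2 * \<gamma>" | "g \<le> - (2 * \<gamma>)" by linarith
  then show ?thesis
  proof cases
    case 1
    then have "g\<^sup>2 \<le> (2 * \<gamma>)\<^sup>2" using abs_le_square_iff[of g "2 * \<gamma>"] \<gamma> by simp
    then show ?thesis using 1 \<gamma> by (simp add: clip_cases power_divide power_mult_distrib)
  next
    case 2
    then have "(2 * \<gamma>)\<^sup>2 \<le> g\<^sup>2" using abs_le_square_iff[of "2 * \<gamma>" g] \<gamma> by simp
    then show ?thesis using 2 \<gamma> by (simp add: clip_cases power_mult_distrib le_divide_eq)
  next
    case 3
    then have "(2 * \<gamma>)\<^sup>2 \<le> g\<^sup>2" using abs_le_square_iff[of "2 * \<gamma>" g] \<gamma> by simp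
    then show ?thesis using 3 \<gamma> by (simp add: clip_cases power_mult_distrib le_divide_eq)
  qed
qed

text \<open>Approximate complementary slackness. For \<beta> < 1 the energy is a continuous function
  of \<open>b = 1 / (4 * \<gamma>\<^sup>2)\<close>, equal to 0 at b = 0 and with limit 1, so some
  multiplier hits \<beta> exactly. At \<beta> = 1 the energy lies in [0, 1] and the choice \<gamma>
  = \<eta> already bounds the slackness by \<eta>.\<close>

lemma ex_clip_energy:
  assumes \<beta>: "0 < \<beta>" "\<beta> \<le> 1" and \<eta>: "\<eta> > 0"
  shows "\<exists>\<gamma>>0. clip_energy \<gamma> \<le> \<beta> \<and> \<gamma> * (\<beta> - clip_energy \<gamma>) \<le> \<eta>"
proof (cases "\<beta> = 1")
  case True
  interpret G: prob_space gauss by simp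
  have "clip_energy \<eta> \<le> (\<integral>g. 1 \<partial>gauss)" unfolding clip_energy_def
    by (rule integral_mono) (auto simp: clip_sq_le_1 integrable_clip_sq)
  then have "clip_energy \<eta> \<le> 1" using G.prob_space by simp
  moreover have "0 \<le> clip_energy \<eta>" unfolding clip_energy_def
    by (rule Bochner_Integration.integral_nonneg) simp
  ultimately show ?thesis using True \<eta> by (intro exI[of _ \<eta>]) (simp add: mult_left_le)
next
  case False
  interpret G: prob_space gauss by simp
  define N where "N b = (\<integral>g. min (b * g\<^sup>2) 1 \<partial>gauss)" for b
  have i: "integrable gauss (\<lambda>g. min (b * g\<^sup>2) 1)" if "b \<ge> 0" for b
    by (rule integrable_gauss_bounded[where B=1]) (use that in \<open>auto simp: abs_le_iff min_def add_increasing\<close>)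
  \<comment> \<open>Truncation at 1 is 1-Lipschitz and the second moment of \<open>gauss\<close> is
    1, hence the constant 1.\<close>
  have lip: "\<bar>N b - N b'\<bar> \<le> \<bar>b - b'\<bar>" if "b \<ge> 0" "b' \<ge> 0" for b b'
  proof -
    have "N b - N b' = (\<integral>g. min (b * g\<^sup>2) 1 - min (b' * g\<^sup>2) 1 \<partial>gauss)"
      unfolding N_def using i that by simp
    also have "\<bar>\<dots>\<bar> \<le> (\<integral>g. \<bar>b - b'\<bar> * g\<^sup>2 \<partial>gauss)"
    proof (rule integral_abs_bound_integral)
      fix g
      have "\<bar>min (b * g\<^sup>2) 1 - min (b' * g\<^sup>2) 1\<bar> \<le> \<bar>b * g\<^sup>2 - b' * g\<^sup>2\<bar>" by (auto simp: min_def)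
      also have "\<dots> = \<bar>b - b'\<bar> * g\<^sup>2" by (simp add: left_diff_distrib[symmetric] abs_mult)
      finally show "\<bar>min (b * g\<^sup>2) 1 - min (b' * g\<^sup>2) 1\<bar> \<le> \<bar>b - b'\<bar> * g\<^sup>2" .
    qed (use i that integrable_gauss_power in auto)
    finally show ?thesis by (simp add: integral_gauss_square)
  qed
  have cont: "continuous_on {0..B} N" for B
  proof (rule continuous_onI)
    fix x e assume "x \<in> {0..B}" "(e::real) > 0"
    then show "\<exists>d>0. \<forall>x'\<in>{0..B}. dist x' x < d \<longrightarrow> dist (N x') (N x) \<le> e"
      using lip by (intro exI[of _ e]) (force simp: dist_real_def)
  qed
  have "(\<lambda>k. N (real k)) \<longlonglongrightarrow> (\<integral>g. 1 \<partial>gauss)"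
    unfolding N_def
  proof (rule integral_dominated_convergence[where w="\<lambda>_. 1"])
    \<comment> \<open>At g = 0 the minimum is 0 for every k, so the convergence to 1 holds only off
      a null set.\<close>
    have ne: "AE g in gauss. g \<noteq> 0"
      unfolding gauss_def by (subst AE_density) (use AE_lborel_singleton[of 0] in auto)
    show "AE g in gauss. (\<lambda>k. min (real k * g\<^sup>2) 1) \<longlonglongrightarrow> 1"
      using ne
    proof eventually_elim
      fix g :: real assume g: "g \<noteq> 0"
      have "\<forall>\<^sub>F k in sequentially. min (real k * g\<^sup>2) 1 = 1"
      proof (rule eventually_sequentiallyI)
        fix k assume "nat \<lceil>1 / g\<^sup>2\<rceil> \<le> k"
        then have "1 / g\<^sup>2 \<le> real k" by linarith
        then show "min (real k * g\<^sup>2) 1 = 1" using g by (simp add: divide_le_eq)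
      qed
      then show "(\<lambda>k. min (real k * g\<^sup>2) 1) \<longlonglongrightarrow> 1" by (rule tendsto_eventually)
    qed
  qed (auto simp: abs_le_iff min_def add_increasing)
  then have "(\<lambda>k. N (real k)) \<longlonglongrightarrow> 1" using G.prob_space by simp
  moreover have "\<beta> < 1" using \<beta> False by simp
  ultimately have "\<forall>\<^sub>F k in sequentially. \<beta> < N (real k)" using order_tendstoD(1) by blast
  then obtain k where k: "\<beta> < N (real k)" by (auto simp: eventually_sequentially)
  have N0: "N 0 = 0" by (simp add: N_def)
  obtain b where b: "0 \<le> b" "N b = \<beta>"
    using IVT'[of N 0 \<beta> "real k"] cont k N0 \<beta> by auto
  have b0: "b > 0" using b N0 \<beta> by (cases "b = 0") auto
  define \<gamma> where "\<gamma> = 1 / (2 * sqrt b)"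
  have \<gamma>: "\<gamma> > 0" using b0 by (simp add: \<gamma>_def)
  have "g\<^sup>2 / (4 * \<gamma>\<^sup>2) = b * g\<^sup>2" for g
    using b0 by (simp add: \<gamma>_def power_divide power_mult_distrib)
  then have "clip_energy \<gamma> = N b" unfolding clip_energy_def N_def using \<gamma> by (simp add: clip_sq_eq)
  then show ?thesis using \<gamma> b \<eta> by (intro exI[of _ \<gamma>]) auto
qed

text \<open>Jensen's inequality through the tangent at h = 0 of the convex squared hinge. As a
  consequence any \<tau> above \<open>f_gar c\<close> also dominates \<open>c\<^sup>2\<close>, which
  controls primal vectors of norm below 1.\<close>

lemma f_gar_ge: "c \<ge> 0 \<Longrightarrow> c\<^sup>2 \<le> f_gar c"
  and integrable_hinge: "integrable gauss (\<lambda>h. (max 0 (c - h))\<^sup>2)"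
proof -
  interpret G: prob_space gauss by simp
  show i: "integrable gauss (\<lambda>h. (max 0 (c - h))\<^sup>2)" for c
  proof (rule Bochner_Integration.integrable_bound)
    show "integrable gauss (\<lambda>h. c\<^sup>2 - 2 * c * h + h\<^sup>2)"
      using integrable_gauss_id integrable_gauss_power[of 2] by simp
    show "AE h in gauss. norm ((max 0 (c - h))\<^sup>2) \<le> norm (c\<^sup>2 - 2 * c * h + h\<^sup>2)"
    proof (rule AE_I2)
      fix h
      have "(max 0 (c - h))\<^sup>2 \<le> (c - h)\<^sup>2" by (auto simp: max_def)
      then show "norm ((max 0 (c - h))\<^sup>2) \<le> norm (c\<^sup>2 - 2 * c * h + h\<^sup>2)"
        by (simp add: power2_diff)
    qed
  qed simp
  assume c: "c \<ge> 0"
  have "(\<integral>h. c\<^sup>2 - 2 * c * h \<partial>gauss) \<le> f_gar c"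
    unfolding f_gar_eq_integral
  proof (rule integral_mono)
    fix h
    have "0 \<le> (max 0 (c - h) - c)\<^sup>2" by simp
    then have "2 * c * max 0 (c - h) - c\<^sup>2 \<le> (max 0 (c - h))\<^sup>2" by (simp add: power2_diff algebra_simps)
    moreover have "2 * c * (c - h) \<le> 2 * c * max 0 (c - h)" using c by (intro mult_left_mono) auto
    ultimately show "c\<^sup>2 - 2 * c * h \<le> (max 0 (c - h))\<^sup>2" by (simp add: algebra_simps power2_eq_square)
  qed (use i integrable_gauss_id in auto)
  moreover have "(\<integral>h. c\<^sup>2 - 2 * c * h \<partial>gauss) = c\<^sup>2"
    using integrable_gauss_id G.prob_space by (simp add: integral_gauss_id)
  ultimately show "c\<^sup>2 \<le> f_gar c" by simp
qed

lemma feasibility_margin_witness: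
  assumes \<beta>: "\<beta> \<in> {0<..1}" and pos: "\<alpha> > 0" "\<kappa> > 0" "\<epsilon>1m > 0" "\<epsilon>1n > 0" "\<epsilon>5g > 0"
    and margin: "feasibility_margin \<alpha> \<kappa> \<epsilon>1m \<epsilon>1n \<epsilon>5g \<beta> > 0"
  shows "\<exists>\<gamma>>0. clip_energy \<gamma> \<le> \<beta> \<and> sqrt (\<alpha> * f_gar (\<kappa> / sqrt \<beta>)) < clip_corr \<gamma> / sqrt \<beta>"
proof -
  let ?A = "sqrt (\<alpha> * f_gar (\<kappa> / sqrt \<beta>))" and ?B = "- f_box_hat \<beta>"
  have b: "0 < \<beta>" "\<beta> \<le> 1" using \<beta> by auto
  have "0 \<le> (\<kappa> / sqrt \<beta>)\<^sup>2" by simp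
  also have "\<dots> \<le> f_gar (\<kappa> / sqrt \<beta>)" using pos b by (intro f_gar_ge) auto
  finally have A: "0 \<le> ?A" using pos by simp
  have B: "0 \<le> ?B" using f_box_hat_bounds(1)[OF b(1)] by simp
  have m: "(1 - \<epsilon>1n) * ?B > (1 + \<epsilon>1m) * ?A + \<epsilon>5g"
    using margin unfolding feasibility_margin_def by (simp add: algebra_simps)
  have "(1 - \<epsilon>1n) * ?B \<le> ?B" using mult_nonneg_nonneg[of \<epsilon>1n ?B] B pos by (simp add: algebra_simps)
  moreover have "?A \<le> (1 + \<epsilon>1m) * ?A" using mult_nonneg_nonneg[of \<epsilon>1m ?A] A pos by (simp add: algebra_simps)
  ultimately have AB: "?A + \<epsilon>5g < ?B" using m by linarith
  obtain \<gamma> where \<gamma>: "\<gamma> > 0" "clip_energy \<gamma> \<le> \<beta>" "\<gamma> * (\<beta> - clip_energy \<gamma>) \<le> \<epsilon>5g * sqrt \<beta>"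
    using ex_clip_energy[OF b, of "\<epsilon>5g * sqrt \<beta>"] pos b by auto
  have "?B \<le> (clip_corr \<gamma> + \<gamma> * (\<beta> - clip_energy \<gamma>)) / sqrt \<beta>"
    by (rule f_box_hat_bounds(2)[OF b(1) \<gamma>(1)])
  also have "\<dots> \<le> (clip_corr \<gamma> + \<epsilon>5g * sqrt \<beta>) / sqrt \<beta>"
    using \<gamma>(3) b by (intro divide_right_mono) auto
  also have "\<dots> = clip_corr \<gamma> / sqrt \<beta> + \<epsilon>5g" using b by (simp add: add_divide_distrib)
  finally show ?thesis using \<gamma> AB by (intro exI[of _ \<gamma>]) auto
qed

section \<open>Primal and dual geometry\<close>

definition ball_box :: "real \<Rightarrow> nat \<Rightarrow> (nat \<Rightarrow> real) set" where
  "ball_box \<beta> n = {x \<in> scaled_box \<beta> n. L2_set x {..<n} \<le> 1}"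

text \<open>Multiplication by \<open>sqrt \<beta>\<close> maps solutions of this system to solutions
  of the original one. At \<beta> = 1 the ball constraint follows from the box, so both systems
  coincide for n > 0.\<close>

definition feasible_at :: "real \<Rightarrow> nat \<Rightarrow> nat \<Rightarrow> (nat \<Rightarrow> nat \<Rightarrow> real) \<Rightarrow> real \<Rightarrow> bool" where
  "feasible_at \<kappa> m n H \<beta> \<longleftrightarrow> (\<exists>x\<in>ball_box \<beta> n. \<forall>i<m. mat_vec n H x i \<ge> \<kappa> / sqrt \<beta>)"

lemma compact_PiE_real:
  fixes a b :: real
  shows "compact ({..<n} \<rightarrow>\<^sub>E {a..b} :: (nat \<Rightarrow> real) set)"
proof -
  \<comment> \<open>Extensional functions form a product over all indices, with the singleton
    \<open>{undefined}\<close> as factor outside \<open>{..<n}\<close>; compactness is then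
    Tychonoff's theorem.\<close>
  have "compactin (product_topology (\<lambda>_. euclidean) UNIV) (Pi\<^sub>E UNIV (\<lambda>i. if i < n then {a..b} else {undefined}))"
    unfolding compactin_PiE by auto
  moreover have "Pi\<^sub>E UNIV (\<lambda>i. if i < n then {a..b} else {undefined}) = {..<n} \<rightarrow>\<^sub>E {a..b}"
  proof (rule set_eqI)
    fix x :: "nat \<Rightarrow> real"
    \<comment> \<open>An opaque name for the interval keeps membership in it from being unfolded
      into inequalities.\<close>
    obtain S where S: "S = {a..b}" by simp
    show "x \<in> Pi\<^sub>E UNIV (\<lambda>i. if i < n then {a..b} else {undefined}) \<longleftrightarrow> x \<in> {..<n} \<rightarrow>\<^sub>E {a..b}"
      unfolding S[symmetric] PiE_iff extensional_def
      by (simp add: if_distrib[of "\<lambda>S. _ \<in> S"]) blast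
  qed
  ultimately show ?thesis by (simp add: euclidean_product_topology)
qed

lemma continuous_on_coordinate [continuous_intros]: "continuous_on S (\<lambda>x::nat \<Rightarrow> real. x i)"
  by (rule continuous_on_subset[OF continuous_on_product_coordinates]) simp

lemma compact_ball_box: "compact (ball_box \<beta> n)"
proof -
  have "closed {x :: nat \<Rightarrow> real. L2_set x {..<n} \<le> 1}"
    unfolding L2_set_def by (intro closed_Collect_le continuous_intros)
  moreover have "ball_box \<beta> n = scaled_box \<beta> n \<inter> {x. L2_set x {..<n} \<le> 1}"
    by (auto simp: ball_box_def)
  ultimately show ?thesis
    unfolding scaled_box_def by (auto intro!: compact_Int_closed compact_PiE_real)
qed

lemma zero_in_ball_box: "\<beta> \<ge> 0 \<Longrightarrow> (\<lambda>j\<in>{..<n}. 0) \<in> ball_box \<beta> n"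
proof -
  assume "\<beta> \<ge> 0"
  moreover have "L2_set (\<lambda>j\<in>{..<n}. 0) {..<n} = (0::real)" by (rule L2_set_0') simp
  ultimately show ?thesis by (auto simp: ball_box_def scaled_box_def)
qed

lemma ball_box_segment:
  assumes x: "x \<in> ball_box \<beta> n" and y: "y \<in> ball_box \<beta> n" and t: "0 \<le> t" "t \<le> 1"
  shows "(\<lambda>j\<in>{..<n}. (1 - t) * x j + t * y j) \<in> ball_box \<beta> n"
proof -
  let ?z = "\<lambda>j\<in>{..<n}. (1 - t) * x j + t * y j"
  define r where "r = 1 / sqrt (\<beta> * real n)"
  have "L2_set ?z {..<n} = L2_set (\<lambda>j. (1 - t) * x j + t * y j) {..<n}"
    by (rule L2_set_cong) auto
  also have "\<dots> \<le> L2_set (\<lambda>j. (1 - t) * x j) {..<n} + L2_set (\<lambda>j. t * y j) {..<n}"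
    by (rule L2_set_triangle_ineq)
  also have "\<dots> = (1 - t) * L2_set x {..<n} + t * L2_set y {..<n}"
    using t by (simp add: L2_set_right_distrib)
  also have "\<dots> \<le> (1 - t) * 1 + t * 1"
    using x y t by (intro add_mono mult_left_mono) (auto simp: ball_box_def)
  finally have "L2_set ?z {..<n} \<le> 1" by simp
  moreover have "(1 - t) * x j + t * y j \<in> {- r..r}" if "j < n" for j
  proof -
    have "x j \<in> {-r..r}" "y j \<in> {-r..r}"
      using x y that by (auto simp: ball_box_def scaled_box_def r_def PiE_iff)
    moreover have "(1 - t) * x j + t * y j \<le> (1 - t) * r + t * r"
      using calculation t by (intro add_mono mult_left_mono) auto
    moreover have "(1 - t) * (- r) + t * (- r) \<le> (1 - t) * x j + t * y j"
      using calculation t by (intro add_mono mult_left_mono) auto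
    ultimately show ?thesis by (simp add: algebra_simps)
  qed
  ultimately show ?thesis by (auto simp: ball_box_def scaled_box_def r_def PiE_iff)
qed

definition residual :: "real \<Rightarrow> nat \<Rightarrow> (nat \<Rightarrow> nat \<Rightarrow> real) \<Rightarrow> (nat \<Rightarrow> real) \<Rightarrow> nat \<Rightarrow> real" where
  "residual c n H x i = max 0 (c - mat_vec n H x i)"

lemma residual_minimiser:
  assumes "\<beta> \<ge> 0"
  obtains x where "x \<in> ball_box \<beta> n"
    "\<And>y. y \<in> ball_box \<beta> n \<Longrightarrow> L2_set (residual c n H x) {..<m} \<le> L2_set (residual c n H y) {..<m}"
proof -
  have "continuous_on (ball_box \<beta> n) (\<lambda>x. L2_set (residual c n H x) {..<m})"
    unfolding L2_set_def residual_def mat_vec_def by (intro continuous_intros)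
  from continuous_attains_inf[OF compact_ball_box _ this] zero_in_ball_box[OF assms] that
  show ?thesis by blast
qed

lemma residual_zero_imp_feasible:
  assumes "x \<in> ball_box \<beta> n" "L2_set (residual (\<kappa> / sqrt \<beta>) n H x) {..<m} = 0"
  shows "feasible_at \<kappa> m n H \<beta>"
proof -
  have "\<kappa> / sqrt \<beta> \<le> mat_vec n H x i" if "i < m" for i
  proof -
    have "residual (\<kappa> / sqrt \<beta>) n H x i = 0" using assms(2) that by (simp add: L2_set_eq_0_iff)
    then show ?thesis unfolding residual_def by linarith
  qed
  then show ?thesis using assms(1) unfolding feasible_at_def by blast
qed

text \<open>First-order optimality of the residual \<open>r\<close> at its minimiser \<open>x\<close> along a segment of
  \<open>ball_box\<close>; truncation only helps because \<open>max 0 (a - s) \<le> \<bar>max 0 a - s\<bar>\<close>.\<close>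

lemma residual_separation:
  assumes x: "x \<in> ball_box \<beta> n" and y: "y \<in> ball_box \<beta> n"
    and min: "\<And>y. y \<in> ball_box \<beta> n \<Longrightarrow> L2_set (residual c n H x) {..<m} \<le> L2_set (residual c n H y) {..<m}"
  defines "r \<equiv> residual c n H x"
  shows "(\<Sum>i<m. r i * mat_vec n H y i) \<le> c * (\<Sum>i<m. r i) - (L2_set r {..<m})\<^sup>2"
proof -
  define b where "b i = mat_vec n H y i - mat_vec n H x i" for i
  define S where "S = (\<Sum>i<m. r i * b i)"
  have quad: "2 * S \<le> t * (\<Sum>i<m. (b i)\<^sup>2)" if t: "0 < t" "t \<le> 1" for t
  proof -
    let ?z = "\<lambda>j\<in>{..<n}. (1 - t) * x j + t * y j"
    have Hz: "mat_vec n H ?z i = mat_vec n H x i + t * b i" for i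
      unfolding b_def mat_vec_def
      by (simp add: sum_distrib_left sum_subtractf[symmetric] sum.distrib[symmetric] algebra_simps)
    have z: "?z \<in> ball_box \<beta> n" using ball_box_segment[OF x y] t by simp
    have "(\<Sum>i<m. (r i)\<^sup>2) \<le> (\<Sum>i<m. (residual c n H ?z i)\<^sup>2)"
      using min[OF z] unfolding r_def L2_set_def by simp
    also have "\<dots> \<le> (\<Sum>i<m. (r i - t * b i)\<^sup>2)"
    proof (rule sum_mono)
      fix i
      have "\<bar>residual c n H ?z i\<bar> \<le> \<bar>r i - t * b i\<bar>"
        unfolding r_def residual_def Hz by (auto simp: max_def)
      then show "(residual c n H ?z i)\<^sup>2 \<le> (r i - t * b i)\<^sup>2" by (rule abs_le_square_iff[THEN iffD1])
    qed
    also have "\<dots> = (\<Sum>i<m. (r i)\<^sup>2) - 2 * t * S + t\<^sup>2 * (\<Sum>i<m. (b i)\<^sup>2)"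
      unfolding S_def
      by (simp add: power2_diff sum.distrib sum_subtractf sum_distrib_left power_mult_distrib mult_ac)
    finally have "t * (2 * S) \<le> t * (t * (\<Sum>i<m. (b i)\<^sup>2))"
      by (simp add: power2_eq_square algebra_simps)
    then show ?thesis using t by (simp only: mult_le_cancel_left_pos)
  qed
  have "((\<lambda>t. t * (\<Sum>i<m. (b i)\<^sup>2)) \<longlongrightarrow> 0) (at_right 0)"
    by (auto intro!: tendsto_eq_intros)
  moreover have "\<forall>\<^sub>F t in at_right (0::real). 2 * S \<le> t * (\<Sum>i<m. (b i)\<^sup>2)"
    using eventually_at_right_real[of 0 1] by (auto elim!: eventually_mono intro!: quad)
  ultimately have "2 * S \<le> 0" by (rule tendsto_lowerbound) simp
  \<comment> \<open>Where the residual is nonzero it equals \<open>c - mat_vec n H x i\<close>, so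
    every product is a square.\<close>
  moreover have "(\<Sum>i<m. r i * (c - mat_vec n H x i)) = (L2_set r {..<m})\<^sup>2"
  proof -
    have "r i * (c - mat_vec n H x i) = (r i)\<^sup>2" for i
      unfolding r_def residual_def by (simp add: max_def power2_eq_square)
    then show ?thesis by (simp add: L2_set_def sum_nonneg)
  qed
  moreover have "S = (\<Sum>i<m. r i * mat_vec n H y i) - (\<Sum>i<m. r i * mat_vec n H x i)"
    unfolding S_def b_def by (simp only: right_diff_distrib sum_subtractf)
  moreover have "(\<Sum>i<m. r i * (c - mat_vec n H x i)) = c * (\<Sum>i<m. r i) - (\<Sum>i<m. r i * mat_vec n H x i)"
    unfolding sum_distrib_left by (simp only: right_diff_distrib sum_subtractf mult.commute)
  ultimately show ?thesis by linarith
qed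

lemma abs_le_L2_set:
  assumes "finite A" "i \<in> A"
  shows "\<bar>f i\<bar> \<le> L2_set f A"
  using member_le_L2_set[OF assms, of "\<lambda>i. \<bar>f i\<bar>"] by (simp add: L2_set_def)

lemma abs_mat_vec_le:
  assumes "x \<in> ball_box \<beta> n"
  shows "\<bar>mat_vec n H x i\<bar> \<le> (\<Sum>j<n. \<bar>H i j\<bar>)"
proof -
  have "\<bar>x j\<bar> \<le> 1" if "j < n" for j
    using abs_le_L2_set[of "{..<n}" j x] that assms by (simp add: ball_box_def)
  then show ?thesis
    unfolding mat_vec_def by (intro order_trans[OF sum_abs] sum_mono) (auto simp: abs_mult intro!: mult_left_le)
qed

text \<open>Normalising would destroy rationality, so the vectors keep arbitrary length. The zero
  vector is excluded because a strict test fails there.\<close>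

definition rational_duals :: "nat \<Rightarrow> (nat \<Rightarrow> real) set" where
  "rational_duals m = {l \<in> {..<m} \<rightarrow>\<^sub>E (\<rat> \<inter> {0..}). \<exists>i<m. l i \<noteq> 0}"

lemma ex_rational_above:
  fixes r e :: real
  assumes "0 < e"
  shows "\<exists>q\<in>\<rat>. r < q \<and> q < r + e"
  using Rats_dense_in_real[of r "r + e"] assms by auto

text \<open>An infeasible system has a nonzero minimal residual, which by
  \<open>residual_separation\<close> is a Farkas-type certificate with margin
  \<open>R\<^sup>2\<close>. Rounding its entries up to positive rationals costs less than this
  margin, so the rounded vector would violate the test.\<close>

lemma dual_test_imp_feasible:
  assumes \<beta>: "\<beta> \<ge> 0" and c: "c = \<kappa> / sqrt \<beta>"
    and test: "\<And>l. l \<in> rational_duals m \<Longrightarrow> \<exists>x\<in>ball_box \<beta> n. (\<Sum>i<m. l i * mat_vec n H x i) > c * (\<Sum>i<m. l i)"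
  shows "feasible_at \<kappa> m n H \<beta>"
proof (rule ccontr)
  assume inf: "\<not> feasible_at \<kappa> m n H \<beta>"
  obtain x where x: "x \<in> ball_box \<beta> n"
    and min: "\<And>y. y \<in> ball_box \<beta> n \<Longrightarrow> L2_set (residual c n H x) {..<m} \<le> L2_set (residual c n H y) {..<m}"
    using residual_minimiser[OF \<beta>] by blast
  define r where "r = residual c n H x"
  define R where "R = L2_set r {..<m}"
  have "R \<noteq> 0" using residual_zero_imp_feasible[OF x] inf unfolding R_def r_def c by blast
  then have R: "R > 0" using L2_set_nonneg[of r "{..<m}"] unfolding R_def by linarith
  then have m: "m > 0" unfolding R_def by (cases m) auto
  \<comment> \<open>Rounding errors of at most \<open>R\<^sup>2 / D\<close> per entry change the
    tested sum by at most \<open>R\<^sup>2 / D * (D - 1)\<close>, which is below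
    \<open>R\<^sup>2\<close>; the summand 1 also keeps \<open>D\<close> positive.\<close>
  define D where "D = 1 + (\<Sum>i<m. (\<Sum>j<n. \<bar>H i j\<bar>) + \<bar>c\<bar>)"
  have D: "D > 0" unfolding D_def by (intro add_pos_nonneg sum_nonneg) (auto intro!: sum_nonneg)
  have e: "0 < R\<^sup>2 / D" using R D by simp
  have "\<forall>i. \<exists>q\<in>\<rat>. r i < q \<and> q < r i + R\<^sup>2 / D" using ex_rational_above[OF e] by blast
  then obtain q where q: "\<And>i. q i \<in> \<rat>" "\<And>i. r i < q i" "\<And>i. q i < r i + R\<^sup>2 / D" by metis
  have r0: "0 \<le> r i" for i unfolding r_def residual_def by simp
  have q0: "0 < q i" for i using q(2)[of i] r0[of i] by linarith
  define l where "l = restrict q {..<m}"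
  have "l \<in> rational_duals m"
    using q(1) q0 m unfolding rational_duals_def l_def
    by (auto simp: less_imp_le less_imp_neq[symmetric] intro!: exI[of _ 0])
  then obtain y where y: "y \<in> ball_box \<beta> n" and gt: "(\<Sum>i<m. l i * mat_vec n H y i) > c * (\<Sum>i<m. l i)"
    using test by blast
  have "(\<Sum>i<m. l i * (mat_vec n H y i - c)) \<le> (\<Sum>i<m. r i * (mat_vec n H y i - c) + R\<^sup>2 / D * ((\<Sum>j<n. \<bar>H i j\<bar>) + \<bar>c\<bar>))"
  proof (rule sum_mono)
    fix i assume i: "i \<in> {..<m}"
    have "\<bar>(l i - r i) * (mat_vec n H y i - c)\<bar> \<le> R\<^sup>2 / D * ((\<Sum>j<n. \<bar>H i j\<bar>) + \<bar>c\<bar>)"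
      unfolding abs_mult
    proof (rule mult_mono)
      show "\<bar>l i - r i\<bar> \<le> R\<^sup>2 / D" using q(2,3)[of i] i by (auto simp: l_def)
      show "\<bar>mat_vec n H y i - c\<bar> \<le> (\<Sum>j<n. \<bar>H i j\<bar>) + \<bar>c\<bar>"
        using abs_mat_vec_le[OF y, of H i] by linarith
    qed (use e in auto)
    then show "l i * (mat_vec n H y i - c) \<le> r i * (mat_vec n H y i - c) + R\<^sup>2 / D * ((\<Sum>j<n. \<bar>H i j\<bar>) + \<bar>c\<bar>)"
      by (simp add: left_diff_distrib abs_le_iff)
  qed
  also have "\<dots> = (\<Sum>i<m. r i * mat_vec n H y i) - c * (\<Sum>i<m. r i) + R\<^sup>2 / D * (D - 1)"
  proof -
    have "(\<Sum>i<m. r i * (mat_vec n H y i - c) + e * h i) = (\<Sum>i<m. r i * mat_vec n H y i) - c * (\<Sum>i<m. r i) + e * (\<Sum>i<m. h i)"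
      for e h
      by (simp add: sum.distrib sum_subtractf sum_distrib_left right_diff_distrib mult.commute)
    note * = this
    have **: "(\<Sum>i<m. (\<Sum>j<n. \<bar>H i j\<bar>) + \<bar>c\<bar>) = D - 1" by (simp add: D_def)
    show ?thesis unfolding * ** by (rule refl)
  qed
  also have "\<dots> \<le> - R\<^sup>2 + R\<^sup>2 / D * (D - 1)"
    using residual_separation[OF x y min] unfolding R_def r_def by simp
  also have "\<dots> \<le> 0"
    using R D by (simp add: field_simps)
  finally have "(\<Sum>i<m. l i * mat_vec n H y i) \<le> c * (\<Sum>i<m. l i)"
    by (simp add: right_diff_distrib sum_subtractf sum_distrib_left mult.commute)
  then show False using gt by simp
qed

section \<open>Lipschitz dependence of the optimal values on the matrix\<close>

abbreviation entry_dist :: "nat \<Rightarrow> nat \<Rightarrow> (nat \<Rightarrow> nat \<Rightarrow> real) \<Rightarrow> (nat \<Rightarrow> nat \<Rightarrow> real) \<Rightarrow> real" where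
  "entry_dist m n H H' \<equiv> \<Sum>i<m. \<Sum>j<n. \<bar>H i j - H' i j\<bar>"

lemma objective_eq: "objective \<kappa> \<beta> m n H x l = (\<Sum>i<m. l i * (\<kappa> / sqrt \<beta> - mat_vec n H x i))"
  unfolding objective_def right_diff_distrib sum_subtractf sum_distrib_left by (simp only: mult.commute)

text \<open>Up to sign the coefficient of the entry \<open>H i j\<close> is
  \<open>l i * x j\<close>, which has modulus at most 1 on the unit balls.\<close>

lemma objective_diff:
  assumes x: "x \<in> ball_box \<beta> n" and l: "L2_set l {..<m} \<le> 1"
  shows "\<bar>objective \<kappa> \<beta> m n H x l - objective \<kappa> \<beta> m n H' x l\<bar> \<le> entry_dist m n H H'"
proof -
  have l1: "\<bar>l i\<bar> \<le> 1" if "i < m" for i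
    using abs_le_L2_set[of "{..<m}" i l] that l by simp
  have "objective \<kappa> \<beta> m n H x l - objective \<kappa> \<beta> m n H' x l
      = (\<Sum>i<m. l i * mat_vec n (\<lambda>i j. H' i j - H i j) x i)"
    unfolding objective_def mat_vec_def
    by (simp add: sum_subtractf left_diff_distrib right_diff_distrib)
  also have "\<bar>\<dots>\<bar> \<le> (\<Sum>i<m. \<bar>mat_vec n (\<lambda>i j. H' i j - H i j) x i\<bar>)"
    by (intro order_trans[OF sum_abs] sum_mono abs_mult_le_one l1) auto
  also have "\<dots> \<le> (\<Sum>i<m. \<Sum>j<n. \<bar>H' i j - H i j\<bar>)"
    by (intro sum_mono abs_mat_vec_le[OF x])
  finally show ?thesis by (simp add: abs_minus_commute)
qed

lemma objective_bounds:
  assumes \<kappa>: "\<kappa> > 0" "\<beta> > 0" and x: "x \<in> ball_box \<beta> n"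
    and l: "l \<in> {..<m} \<rightarrow>\<^sub>E {0..}" "L2_set l {..<m} \<le> 1"
  shows "- (\<Sum>i<m. \<Sum>j<n. \<bar>H i j\<bar>) \<le> objective \<kappa> \<beta> m n H x l"
    and "objective \<kappa> \<beta> m n H x l \<le> \<kappa> / sqrt \<beta> * real m + (\<Sum>i<m. \<Sum>j<n. \<bar>H i j\<bar>)"
proof -
  have "\<bar>objective \<kappa> \<beta> m n H x l - objective \<kappa> \<beta> m n (\<lambda>_ _. 0) x l\<bar> \<le> (\<Sum>i<m. \<Sum>j<n. \<bar>H i j\<bar>)"
    using objective_diff[OF x l(2), where H'="\<lambda>_ _. 0"] by simp
  moreover have "objective \<kappa> \<beta> m n (\<lambda>_ _. 0) x l = \<kappa> / sqrt \<beta> * (\<Sum>i<m. l i)"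
    unfolding objective_def mat_vec_def by simp
  moreover have "0 \<le> \<kappa> / sqrt \<beta> * (\<Sum>i<m. l i)"
    using \<kappa> l(1) by (intro mult_nonneg_nonneg sum_nonneg) (auto simp: PiE_iff)
  moreover have "\<kappa> / sqrt \<beta> * (\<Sum>i<m. l i) \<le> \<kappa> / sqrt \<beta> * real m"
  proof (rule mult_left_mono)
    have "(\<Sum>i<m. l i) \<le> (\<Sum>i<m. 1)"
      by (intro sum_mono order_trans[OF member_le_L2_set l(2)]) auto
    then show "(\<Sum>i<m. l i) \<le> real m" by simp
  qed (use \<kappa> in auto)
  ultimately show "- (\<Sum>i<m. \<Sum>j<n. \<bar>H i j\<bar>) \<le> objective \<kappa> \<beta> m n H x l"
    "objective \<kappa> \<beta> m n H x l \<le> \<kappa> / sqrt \<beta> * real m + (\<Sum>i<m. \<Sum>j<n. \<bar>H i j\<bar>)" by linarith+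
qed

lemma SUP_diff_le:
  fixes f g :: "'a \<Rightarrow> real"
  assumes "\<And>a. a \<in> A \<Longrightarrow> \<bar>f a - g a\<bar> \<le> d" and "bdd_above (f ` A)" "bdd_above (g ` A)" and d: "0 \<le> d"
  shows "\<bar>(SUP a\<in>A. f a) - (SUP a\<in>A. g a)\<bar> \<le> d"
proof (cases "A = {}")
  case False
  have "(SUP a\<in>A. f a) \<le> (SUP a\<in>A. g a) + d" if f: "\<And>a. a \<in> A \<Longrightarrow> \<bar>f a - g a\<bar> \<le> d" and g: "bdd_above (g ` A)" for f g
  proof (rule cSUP_least[OF False])
    fix a assume a: "a \<in> A"
    have "g a \<le> (SUP a\<in>A. g a)" by (rule cSUP_upper[OF a g])
    then show "f a \<le> (SUP a\<in>A. g a) + d" using f[OF a] by linarith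
  qed
  from this[of f g] this[of g f] show ?thesis using assms by (simp add: abs_minus_commute abs_le_iff)
qed (use d in simp)

lemma INF_diff_le:
  fixes f g :: "'a \<Rightarrow> real"
  assumes "\<And>a. a \<in> A \<Longrightarrow> \<bar>f a - g a\<bar> \<le> d" and "bdd_below (f ` A)" "bdd_below (g ` A)" and d: "0 \<le> d"
  shows "\<bar>(INF a\<in>A. f a) - (INF a\<in>A. g a)\<bar> \<le> d"
proof (cases "A = {}")
  case False
  have "(INF a\<in>A. g a) - d \<le> (INF a\<in>A. f a)" if f: "\<And>a. a \<in> A \<Longrightarrow> \<bar>f a - g a\<bar> \<le> d" and g: "bdd_below (g ` A)" for f g
  proof (rule cINF_greatest[OF False])
    fix a assume a: "a \<in> A"
    have "(INF a\<in>A. g a) \<le> g a" by (rule cINF_lower[OF g a])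
    then show "(INF a\<in>A. g a) - d \<le> f a" using f[OF a] by linarith
  qed
  from this[of f g] this[of g f] show ?thesis using assms by (simp add: abs_minus_commute abs_le_iff)
qed (use d in simp)

definition inner_max ::
  "real \<Rightarrow> nat \<Rightarrow> nat \<Rightarrow> (nat \<Rightarrow> real) set \<Rightarrow> (nat \<Rightarrow> nat \<Rightarrow> real) \<Rightarrow> real \<Rightarrow> (nat \<Rightarrow> real) \<Rightarrow> real" where
  "inner_max \<kappa> m n L H \<beta> x = (SUP l\<in>L. objective \<kappa> \<beta> m n H x l)"

text \<open>The constraint sets are parameters so that the ball version and the sphere version share
  one argument.\<close>

definition outer_min ::
  "real \<Rightarrow> nat \<Rightarrow> nat \<Rightarrow> (nat \<Rightarrow> real) set \<Rightarrow> (real \<Rightarrow> (nat \<Rightarrow> real) set) \<Rightarrow>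
    (nat \<Rightarrow> nat \<Rightarrow> real) \<Rightarrow> real \<Rightarrow> real" where
  "outer_min \<kappa> m n L X H \<beta> = (INF x\<in>X \<beta>. inner_max \<kappa> m n L H \<beta> x)"

context
  fixes \<kappa> :: real and m n :: nat and X :: "real \<Rightarrow> (nat \<Rightarrow> real) set" and L :: "(nat \<Rightarrow> real) set"
  assumes \<kappa>: "\<kappa> > 0"
    and X: "\<And>\<beta>. X \<beta> \<subseteq> ball_box \<beta> n"
    and L: "L \<subseteq> {l \<in> {..<m} \<rightarrow>\<^sub>E {0..}. L2_set l {..<m} \<le> 1}"
begin

lemma objective_bdd_above:
  assumes "\<beta> > 0" "x \<in> X \<beta>"
  shows "bdd_above ((\<lambda>l. objective \<kappa> \<beta> m n H x l) ` L)"
  by (rule bdd_aboveI2, rule objective_bounds(2)[OF \<kappa> assms(1) subsetD[OF X assms(2)]]) (use subsetD[OF L] in auto)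

text \<open>The sphere of duals is empty for m = 0, where the supremum takes the unspecified value
  \<open>Sup {}\<close>. Admitting that value in the bound covers all dimensions at once;
  \<open>Inf {}\<close> below plays the same part for n = 0.\<close>

lemma inner_max_lower:
  assumes "\<beta> > 0" "x \<in> X \<beta>"
  shows "min (Sup {}) (- (\<Sum>i<m. \<Sum>j<n. \<bar>H i j\<bar>)) \<le> inner_max \<kappa> m n L H \<beta> x"
proof (cases "L = {}")
  case False
  then obtain l where l: "l \<in> L" by blast
  have "- (\<Sum>i<m. \<Sum>j<n. \<bar>H i j\<bar>) \<le> objective \<kappa> \<beta> m n H x l"
    by (rule objective_bounds(1)[OF \<kappa> assms(1) subsetD[OF X assms(2)]]) (use subsetD[OF L l] in simp_all)
  also have "\<dots> \<le> inner_max \<kappa> m n L H \<beta> x"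
    unfolding inner_max_def by (rule cSUP_upper[OF l objective_bdd_above[OF assms]])
  finally show ?thesis by simp
qed (simp add: inner_max_def)

lemma outer_min_lower:
  assumes "\<beta> > 0"
  shows "min (Inf {}) (min (Sup {}) (- (\<Sum>i<m. \<Sum>j<n. \<bar>H i j\<bar>))) \<le> outer_min \<kappa> m n L X H \<beta>"
proof (cases "X \<beta> = {}")
  case False
  then have "min (Sup {}) (- (\<Sum>i<m. \<Sum>j<n. \<bar>H i j\<bar>)) \<le> outer_min \<kappa> m n L X H \<beta>"
    unfolding outer_min_def by (intro cINF_greatest inner_max_lower assms)
  then show ?thesis by simp
qed (simp add: outer_min_def)

lemma inner_max_bdd_below: "\<beta> > 0 \<Longrightarrow> bdd_below (inner_max \<kappa> m n L H \<beta> ` X \<beta>)"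
  by (rule bdd_belowI2) (rule inner_max_lower)

lemma outer_min_bdd_below: "bdd_below (outer_min \<kappa> m n L X H ` {0<..1})"
  by (rule bdd_belowI2) (rule outer_min_lower, simp)

text \<open>Suprema and infima differ by no more than the functions do. The bound is free of
  \<beta>, so it survives the further infimum over \<open>{0<..1}\<close>.\<close>

lemma outer_min_diff:
  assumes "\<beta> > 0"
  shows "\<bar>outer_min \<kappa> m n L X H \<beta> - outer_min \<kappa> m n L X H' \<beta>\<bar> \<le> entry_dist m n H H'"
  unfolding outer_min_def
proof (rule INF_diff_le)
  fix x assume x: "x \<in> X \<beta>"
  show "\<bar>inner_max \<kappa> m n L H \<beta> x - inner_max \<kappa> m n L H' \<beta> x\<bar> \<le> entry_dist m n H H'"
    unfolding inner_max_def
  proof (rule SUP_diff_le)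
    show "\<bar>objective \<kappa> \<beta> m n H x l - objective \<kappa> \<beta> m n H' x l\<bar> \<le> entry_dist m n H H'" if "l \<in> L" for l
      by (rule objective_diff[OF subsetD[OF X x]]) (use subsetD[OF L that] in simp)
  qed (rule objective_bdd_above[OF assms x] sum_nonneg abs_ge_zero)+
qed (rule inner_max_bdd_below[OF assms] sum_nonneg abs_ge_zero)+

lemma INF_outer_min_diff:
  "\<bar>(INF \<beta>\<in>{0<..1}. outer_min \<kappa> m n L X H \<beta>) - (INF \<beta>\<in>{0<..1}. outer_min \<kappa> m n L X H' \<beta>)\<bar> \<le> entry_dist m n H H'"
proof (rule INF_diff_le)
  show "\<bar>outer_min \<kappa> m n L X H \<beta> - outer_min \<kappa> m n L X H' \<beta>\<bar> \<le> entry_dist m n H H'"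
    if "\<beta> \<in> {0<..1}" for \<beta> using that by (intro outer_min_diff) simp
qed (rule outer_min_bdd_below sum_nonneg abs_ge_zero)+

end

lemma xi_box_r_at_eq:
  "xi_box_r_at \<kappa> m n H \<beta> =
     outer_min \<kappa> m n {l \<in> {..<m} \<rightarrow>\<^sub>E {0..}. L2_set l {..<m} \<le> 1} (\<lambda>\<beta>. ball_box \<beta> n) H \<beta>"
  unfolding xi_box_r_at_def outer_min_def inner_max_def ball_box_def by (rule refl)

lemma xi_box_at_eq:
  "xi_box_at \<kappa> m n H \<beta> =
     outer_min \<kappa> m n {l \<in> {..<m} \<rightarrow>\<^sub>E {0..}. L2_set l {..<m} = 1}
       (\<lambda>\<beta>. {x \<in> scaled_box \<beta> n. (L2_set x {..<n})\<^sup>2 = 1}) H \<beta>"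
  unfolding xi_box_at_def outer_min_def inner_max_def by (rule refl)

lemma box_sphere_subset: "{x \<in> scaled_box \<beta> n. (L2_set x {..<n})\<^sup>2 = 1} \<subseteq> ball_box \<beta> n"
  by (auto simp: ball_box_def power2_eq_1_iff)

lemma xi_box_r_at_bdd_below: "\<kappa> > 0 \<Longrightarrow> bdd_below (xi_box_r_at \<kappa> m n H ` {0<..1})"
  unfolding xi_box_r_at_eq[abs_def] by (rule outer_min_bdd_below) auto

lemma xi_box_at_bdd_below: "\<kappa> > 0 \<Longrightarrow> bdd_below (xi_box_at \<kappa> m n H ` {0<..1})"
  unfolding xi_box_at_eq[abs_def]
  by (rule outer_min_bdd_below) (assumption, rule box_sphere_subset, rule Collect_mono, simp)

lemma xi_box_r_at_Lipschitz:
  "\<kappa> > 0 \<Longrightarrow> \<beta> > 0 \<Longrightarrow>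
    \<bar>xi_box_r_at \<kappa> m n H \<beta> - xi_box_r_at \<kappa> m n H' \<beta>\<bar> \<le> entry_dist m n H H'"
  unfolding xi_box_r_at_eq by (rule outer_min_diff) simp_all

lemma xi_box_r_Lipschitz:
  "\<kappa> > 0 \<Longrightarrow> \<bar>xi_box_r \<kappa> m n H - xi_box_r \<kappa> m n H'\<bar> \<le> entry_dist m n H H'"
  unfolding xi_box_r_def xi_box_r_at_eq by (rule INF_outer_min_diff) simp_all

lemma xi_box_Lipschitz:
  "\<kappa> > 0 \<Longrightarrow> \<bar>xi_box \<kappa> m n H - xi_box \<kappa> m n H'\<bar> \<le> entry_dist m n H H'"
  unfolding xi_box_def xi_box_at_eq
  by (rule INF_outer_min_diff) (assumption, rule box_sphere_subset, rule Collect_mono, simp)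

text \<open>The extension of \<open>H\<close> by \<open>0\<close> makes a function Lipschitz in finitely many entries
  continuous for the product topology.\<close>

lemma borel_measurable_Lipschitz_entries:
  fixes \<Phi> :: "(nat \<Rightarrow> nat \<Rightarrow> real) \<Rightarrow> real" and H :: "'w \<Rightarrow> nat \<Rightarrow> nat \<Rightarrow> real"
  assumes lip: "\<And>H H'. \<bar>\<Phi> H - \<Phi> H'\<bar> \<le> entry_dist m n H H'"
    and meas: "\<And>i j. i < m \<Longrightarrow> j < n \<Longrightarrow> (\<lambda>w. H w i j) \<in> borel_measurable M"
  shows "(\<lambda>w. \<Phi> (H w)) \<in> borel_measurable M"
proof -
  define G where "G w = (\<lambda>i j. if i < m \<and> j < n then H w i j else 0)" for w
  have "\<Phi> (H w) = \<Phi> (G w)" for w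
  proof -
    have "(\<Sum>i<m. \<Sum>j<n. \<bar>H w i j - G w i j\<bar>) = 0" by (simp add: G_def)
    then show ?thesis using lip[of "H w" "G w"] by simp
  qed
  moreover have "(\<lambda>w. \<Phi> (G w)) \<in> borel_measurable M"
  proof (rule measurable_compose[of G M borel])
    show "G \<in> borel_measurable M"
    proof (intro measurable_coordinatewise_then_product)
      show "(\<lambda>w. G w i j) \<in> borel_measurable M" for i j
        by (cases "i < m \<and> j < n") (auto simp: G_def meas)
    qed
    have "continuous_on UNIV \<Phi>"
      unfolding continuous_on_def
    proof
      fix H0 :: "nat \<Rightarrow> nat \<Rightarrow> real"
      have c: "((\<lambda>H::nat \<Rightarrow> nat \<Rightarrow> real. H i j) \<longlongrightarrow> H0 i j) (at H0)" for i j
      proof -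
        have "continuous_on UNIV (\<lambda>H::nat \<Rightarrow> nat \<Rightarrow> real. H i j)"
          by (rule continuous_on_compose2[OF continuous_on_product_coordinates[of j] continuous_on_product_coordinates[of i]]) auto
        then show ?thesis by (auto simp: continuous_on_def)
      qed
      have "((\<lambda>H. \<Sum>i<m. \<Sum>j<n. \<bar>H i j - H0 i j\<bar>) \<longlongrightarrow> (\<Sum>i<m. \<Sum>j<n. \<bar>H0 i j - H0 i j\<bar>)) (at H0)"
        by (intro tendsto_intros c)
      then have lim: "((\<lambda>H. \<Sum>i<m. \<Sum>j<n. \<bar>H i j - H0 i j\<bar>) \<longlongrightarrow> 0) (at H0)" by simp
      have "\<forall>\<^sub>F H in at H0. norm (\<Phi> H - \<Phi> H0) \<le> (\<Sum>i<m. \<Sum>j<n. \<bar>H i j - H0 i j\<bar>)"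
        unfolding real_norm_def by (intro always_eventually allI lip)
      from this lim have "((\<lambda>H. \<Phi> H - \<Phi> H0) \<longlongrightarrow> 0) (at H0)" by (rule Lim_null_comparison)
      then show "(\<Phi> \<longlongrightarrow> \<Phi> H0) (at H0)" by (rule LIM_zero_cancel)
    qed
    then show "\<Phi> \<in> borel_measurable borel" by (rule borel_measurable_continuous_onI)
  qed
  ultimately show ?thesis by simp
qed

text \<open>The inner maximum is at least the residual norm, as testing with the normalised residual
  shows. A nonpositive infimum therefore forces the least residual norm to be 0, and compactness
  provides a point where it is attained. Conversely, at a feasible point every term of the objective
  is nonpositive.\<close>

lemma xi_box_r_at_le_0_iff:
  assumes \<kappa>: "\<kappa> > 0" and \<beta>: "\<beta> > 0"
  shows "xi_box_r_at \<kappa> m n H \<beta> \<le> 0 \<longleftrightarrow> feasible_at \<kappa> m n H \<beta>"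
proof -
  define L where "L = {l \<in> {..<m} \<rightarrow>\<^sub>E {0..}. L2_set l {..<m} \<le> 1}"
  have xi: "xi_box_r_at \<kappa> m n H \<beta> = (INF x\<in>ball_box \<beta> n. inner_max \<kappa> m n L H \<beta> x)"
    unfolding xi_box_r_at_eq outer_min_def L_def by (rule refl)
  have bdd: "bdd_below (inner_max \<kappa> m n L H \<beta> ` ball_box \<beta> n)"
    by (rule inner_max_bdd_below[where X="\<lambda>\<beta>. ball_box \<beta> n"]) (auto simp: \<kappa> \<beta> L_def)
  have up: "objective \<kappa> \<beta> m n H x l \<le> inner_max \<kappa> m n L H \<beta> x" if "x \<in> ball_box \<beta> n" "l \<in> L" for x l
    unfolding inner_max_def
    by (rule cSUP_upper[OF that(2) objective_bdd_above[where X="\<lambda>\<beta>. ball_box \<beta> n"]])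
       (use that in \<open>auto simp: \<kappa> \<beta> L_def\<close>)
  have L0: "(\<lambda>i\<in>{..<m}. 0) \<in> L"
  proof -
    have "L2_set (\<lambda>i\<in>{..<m}. 0) {..<m} = (0::real)" by (rule L2_set_0') simp
    then show ?thesis by (auto simp: L_def)
  qed
  show ?thesis
  proof
    assume "feasible_at \<kappa> m n H \<beta>"
    then obtain x where x: "x \<in> ball_box \<beta> n" "\<And>i. i < m \<Longrightarrow> mat_vec n H x i \<ge> \<kappa> / sqrt \<beta>"
      unfolding feasible_at_def by blast
    have "inner_max \<kappa> m n L H \<beta> x \<le> 0"
      unfolding inner_max_def
    proof (rule cSUP_least)
      show "L \<noteq> {}" using L0 by blast
      show "objective \<kappa> \<beta> m n H x l \<le> 0" if "l \<in> L" for l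
        unfolding objective_eq
      proof (intro sum_nonpos mult_nonneg_nonpos)
        fix i assume "i \<in> {..<m}"
        then show "0 \<le> l i" "\<kappa> / sqrt \<beta> - mat_vec n H x i \<le> 0"
          using that x(2)[of i] by (auto simp: L_def)
      qed
    qed
    moreover have "xi_box_r_at \<kappa> m n H \<beta> \<le> inner_max \<kappa> m n L H \<beta> x"
      unfolding xi by (rule cINF_lower[OF bdd x(1)])
    ultimately show "xi_box_r_at \<kappa> m n H \<beta> \<le> 0" by simp
  next
    assume le: "xi_box_r_at \<kappa> m n H \<beta> \<le> 0"
    obtain x where x: "x \<in> ball_box \<beta> n"
      and min: "\<And>y. y \<in> ball_box \<beta> n \<Longrightarrow>
        L2_set (residual (\<kappa> / sqrt \<beta>) n H x) {..<m} \<le> L2_set (residual (\<kappa> / sqrt \<beta>) n H y) {..<m}"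
      by (rule residual_minimiser[OF less_imp_le[OF \<beta>], of n "\<kappa> / sqrt \<beta>" H m], rule that)
    have "L2_set (residual (\<kappa> / sqrt \<beta>) n H x) {..<m} \<le> (INF x\<in>ball_box \<beta> n. inner_max \<kappa> m n L H \<beta> x)"
    proof (rule cINF_greatest)
      show "ball_box \<beta> n \<noteq> {}" using x by blast
      fix y assume y: "y \<in> ball_box \<beta> n"
      define r where "r = residual (\<kappa> / sqrt \<beta>) n H y"
      define R where "R = L2_set r {..<m}"
      have "R \<le> inner_max \<kappa> m n L H \<beta> y"
      proof (cases "R = 0")
        case True
        have "0 \<le> objective \<kappa> \<beta> m n H y (\<lambda>i\<in>{..<m}. 0)" unfolding objective_def by simp
        then show ?thesis using up[OF y L0] True by simp
      next
        case False
        then have R: "R > 0" using L2_set_nonneg[of r "{..<m}"] unfolding R_def by linarith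
        let ?l = "\<lambda>i\<in>{..<m}. r i / R"
        have "L2_set ?l {..<m} = L2_set (\<lambda>i. r i * (1 / R)) {..<m}"
          by (rule L2_set_cong) auto
        also have "\<dots> = R * (1 / R)" unfolding R_def by (rule L2_set_left_distrib[symmetric]) simp
        also have "\<dots> = 1" using R by simp
        finally have "?l \<in> L" using R by (auto simp: L_def r_def residual_def)
        then have "objective \<kappa> \<beta> m n H y ?l \<le> inner_max \<kappa> m n L H \<beta> y" by (rule up[OF y])
        moreover have "objective \<kappa> \<beta> m n H y ?l = (\<Sum>i<m. (r i)\<^sup>2) / R"
          unfolding objective_eq sum_divide_distrib
          by (intro sum.cong) (auto simp: r_def residual_def max_def power2_eq_square)
        moreover have "(\<Sum>i<m. (r i)\<^sup>2) / R = R"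
          using R by (simp add: R_def L2_set_def real_div_sqrt sum_nonneg)
        ultimately show ?thesis by simp
      qed
      then show "L2_set (residual (\<kappa> / sqrt \<beta>) n H x) {..<m} \<le> inner_max \<kappa> m n L H \<beta> y"
        using min[OF y] unfolding R_def r_def by linarith
    qed
    then have "L2_set (residual (\<kappa> / sqrt \<beta>) n H x) {..<m} = 0"
      using le L2_set_nonneg[of "residual (\<kappa> / sqrt \<beta>) n H x" "{..<m}"] unfolding xi by linarith
    then show "feasible_at \<kappa> m n H \<beta>" by (rule residual_zero_imp_feasible[OF x])
  qed
qed

section \<open>Passing between the scaled systems\<close>

lemma scaled_box_abs_le:
  assumes "x \<in> scaled_box \<beta> n" "j < n"
  shows "\<bar>x j\<bar> \<le> 1 / sqrt (\<beta> * real n)"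
proof -
  have "x j \<in> {- (1 / sqrt (\<beta> * real n))..1 / sqrt (\<beta> * real n)}"
    by (rule PiE_mem[OF assms(1)[unfolded scaled_box_def]]) (use assms(2) in simp)
  then show ?thesis by auto
qed

lemma restrict_in_scaled_box:
  assumes "\<And>j. j < n \<Longrightarrow> \<bar>f j\<bar> \<le> 1 / sqrt (\<beta> * real n)"
  shows "restrict f {..<n} \<in> scaled_box \<beta> n"
  unfolding scaled_box_def
proof (rule restrict_PiE_iff[THEN iffD2], rule ballI)
  fix j assume "j \<in> {..<n}"
  then have "\<bar>f j\<bar> \<le> 1 / sqrt (\<beta> * real n)" using assms by simp
  then show "f j \<in> {- (1 / sqrt (\<beta> * real n))..1 / sqrt (\<beta> * real n)}" unfolding atLeastAtMost_iff by linarith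
qed

lemma feasible_at_1_iff: "feasible_at \<kappa> m n H 1 \<longleftrightarrow> box_feasible \<kappa> m n H" if n: "n > 0"
proof -
  have "L2_set x {..<n} \<le> 1" if "x \<in> {..<n} \<rightarrow>\<^sub>E {- (1 / sqrt (real n))..1 / sqrt (real n)}" for x
  proof -
    have "(\<Sum>j<n. (x j)\<^sup>2) \<le> (\<Sum>j<n. 1 / real n)"
    proof (rule sum_mono)
      fix j assume "j \<in> {..<n}"
      then have "x j \<in> {- (1 / sqrt (real n))..1 / sqrt (real n)}" using that by (rule PiE_mem[rotated])
      then have "\<bar>x j\<bar> \<le> 1 / sqrt (real n)" by auto
      then have "(x j)\<^sup>2 \<le> (1 / sqrt (real n))\<^sup>2" by (intro power2_le_iff_abs_le[THEN iffD2]) auto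
      then show "(x j)\<^sup>2 \<le> 1 / real n" by (simp add: power_divide)
    qed
    also have "\<dots> = 1" using n by simp
    finally show ?thesis by (simp add: L2_set_def)
  qed
  then have "ball_box 1 n = {..<n} \<rightarrow>\<^sub>E {- (1 / sqrt (real n))..1 / sqrt (real n)}"
    unfolding ball_box_def scaled_box_def by auto
  then show ?thesis unfolding feasible_at_def box_feasible_def by simp
qed

lemma feasible_at_imp_box_feasible:
  assumes \<beta>: "0 < \<beta>" and f: "feasible_at \<kappa> m n H \<beta>"
  shows "box_feasible \<kappa> m n H"
proof -
  obtain x where x: "x \<in> ball_box \<beta> n" "\<And>i. i < m \<Longrightarrow> mat_vec n H x i \<ge> \<kappa> / sqrt \<beta>"
    using f unfolding feasible_at_def by blast
  let ?y = "\<lambda>j\<in>{..<n}. sqrt \<beta> * x j"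
  have "\<bar>sqrt \<beta> * x j\<bar> \<le> 1 / sqrt (real n)" if "j < n" for j
  proof -
    have "\<bar>x j\<bar> \<le> 1 / sqrt (\<beta> * real n)"
      using scaled_box_abs_le[of x \<beta> n j] x(1) that by (simp add: ball_box_def)
    then have "sqrt \<beta> * \<bar>x j\<bar> \<le> sqrt \<beta> * (1 / sqrt (\<beta> * real n))" using \<beta> by (intro mult_left_mono) auto
    then show ?thesis using \<beta> by (simp add: abs_mult real_sqrt_mult)
  qed
  then have "?y \<in> {..<n} \<rightarrow>\<^sub>E {- (1 / sqrt (real n))..1 / sqrt (real n)}"
    using restrict_in_scaled_box[of n "\<lambda>j. sqrt \<beta> * x j" 1] by (simp add: scaled_box_def)
  moreover have "mat_vec n H ?y i \<ge> \<kappa>" if "i < m" for i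
  proof -
    have "mat_vec n H ?y i = sqrt \<beta> * mat_vec n H x i"
      by (simp add: mat_vec_def sum_distrib_left mult_ac)
    moreover have "sqrt \<beta> * (\<kappa> / sqrt \<beta>) \<le> sqrt \<beta> * mat_vec n H x i"
      using x(2)[OF that] \<beta> by (intro mult_left_mono) auto
    ultimately show ?thesis using \<beta> by simp
  qed
  ultimately show ?thesis unfolding box_feasible_def by blast
qed

text \<open>A feasible \<open>x\<close> is nonzero, and \<open>x / \<parallel>x\<parallel>\<close> is admissible for \<open>xi_box\<close> at \<open>\<beta> = \<parallel>x\<parallel>\<^sup>2\<close>.\<close>

lemma box_feasible_imp_xi_box_le_0:
  assumes \<kappa>: "\<kappa> > 0" and mn: "m > 0" "n > 0" and f: "box_feasible \<kappa> m n H"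
  shows "xi_box \<kappa> m n H \<le> 0"
proof -
  obtain x where x: "x \<in> ball_box 1 n" "\<And>i. i < m \<Longrightarrow> mat_vec n H x i \<ge> \<kappa>"
    using f unfolding feasible_at_1_iff[OF mn(2), symmetric] feasible_at_def by auto
  define R where "R = L2_set x {..<n}"
  have "R \<noteq> 0"
  proof
    assume "R = 0"
    then have "mat_vec n H x 0 = 0" by (simp add: R_def L2_set_eq_0_iff mat_vec_def)
    then show False using x(2)[OF mn(1)] \<kappa> by simp
  qed
  then have R: "0 < R" "R \<le> 1" using L2_set_nonneg[of x "{..<n}"] x(1) unfolding R_def ball_box_def by (auto simp: less_le)
  define \<beta> where "\<beta> = R\<^sup>2"
  have \<beta>: "\<beta> \<in> {0<..1}" and s\<beta>: "sqrt \<beta> = R" using R by (auto simp: \<beta>_def power_le_one)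
  define y where "y = (\<lambda>j\<in>{..<n}. x j * (1 / R))"
  define L where "L = {l \<in> {..<m} \<rightarrow>\<^sub>E {0..}. L2_set l {..<m} = (1::real)}"
  define X where "X \<beta> = {x \<in> scaled_box \<beta> n. (L2_set x {..<n})\<^sup>2 = 1}" for \<beta>
  have XB: "X \<beta> \<subseteq> ball_box \<beta> n" for \<beta> unfolding X_def by (rule box_sphere_subset)
  have LB: "L \<subseteq> {l \<in> {..<m} \<rightarrow>\<^sub>E {0..}. L2_set l {..<m} \<le> 1}" unfolding L_def by (rule Collect_mono) simp
  have y: "y \<in> X \<beta>"
  proof -
    have "L2_set y {..<n} = L2_set (\<lambda>j. x j * (1 / R)) {..<n}"
      by (rule L2_set_cong) (auto simp: y_def)
    also have "\<dots> = R * (1 / R)" unfolding R_def by (rule L2_set_left_distrib[symmetric]) simp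
    also have "\<dots> = 1" using R by simp
    finally have "L2_set y {..<n} = 1" .
    moreover have "\<bar>x j * (1 / R)\<bar> \<le> 1 / sqrt (\<beta> * real n)" if "j < n" for j
    proof -
      have "\<bar>x j\<bar> \<le> 1 / sqrt (real n)"
        using scaled_box_abs_le[of x 1 n j] x(1) that by (simp add: ball_box_def)
      then have "\<bar>x j\<bar> * (1 / R) \<le> 1 / sqrt (real n) * (1 / R)" using R by (intro mult_right_mono) auto
      then show ?thesis using R by (simp add: abs_mult real_sqrt_mult s\<beta> mult.commute)
    qed
    then have "y \<in> scaled_box \<beta> n" unfolding y_def by (rule restrict_in_scaled_box)
    ultimately show ?thesis by (simp add: X_def)
  qed
  have Hy: "mat_vec n H y i = mat_vec n H x i / R" for i
    by (simp add: y_def mat_vec_def sum_divide_distrib)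
  have "inner_max \<kappa> m n L H \<beta> y \<le> 0"
    unfolding inner_max_def
  proof (rule cSUP_least)
    \<comment> \<open>The constant unit vector shows that the sphere of duals is nonempty for m > 0;
      a supremum over the empty set would be unspecified.\<close>
    have "L2_set (\<lambda>i\<in>{..<m}. 1 / sqrt (real m)) {..<m} = L2_set (\<lambda>i. 1 / sqrt (real m)) {..<m}"
      by (rule L2_set_cong) auto
    also have "\<dots> = 1" using mn by (simp add: L2_set_constant)
    finally have "(\<lambda>i\<in>{..<m}. 1 / sqrt (real m)) \<in> L" by (auto simp: L_def)
    then show "L \<noteq> {}" by blast
    fix l assume l: "l \<in> L"
    have "\<kappa> / R \<le> mat_vec n H y i" if "i < m" for i
      unfolding Hy using x(2)[OF that] R by (intro divide_right_mono) auto
    then show "objective \<kappa> \<beta> m n H y l \<le> 0"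
      unfolding objective_eq s\<beta>
    proof (intro sum_nonpos mult_nonneg_nonpos)
      fix i assume i: "i \<in> {..<m}"
      then show "0 \<le> l i" using l by (auto simp: L_def)
      show "\<kappa> / R - mat_vec n H y i \<le> 0" using i \<open>\<And>i. i < m \<Longrightarrow> \<kappa> / R \<le> mat_vec n H y i\<close>[of i] by simp
    qed
  qed
  moreover have "outer_min \<kappa> m n L X H \<beta> \<le> inner_max \<kappa> m n L H \<beta> y"
    unfolding outer_min_def
    by (rule cINF_lower[OF inner_max_bdd_below[OF \<kappa> XB LB] y]) (use \<beta> in auto)
  moreover have "xi_box \<kappa> m n H \<le> outer_min \<kappa> m n L X H \<beta>"
  proof -
    have "xi_box \<kappa> m n H \<le> xi_box_at \<kappa> m n H \<beta>"
      unfolding xi_box_def by (rule cINF_lower[OF xi_box_at_bdd_below[OF \<kappa>] \<beta>])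
    then show ?thesis unfolding xi_box_at_eq L_def X_def[abs_def] .
  qed
  ultimately show ?thesis by simp
qed

section \<open>The decoupled process\<close>

definition rational_primals :: "real \<Rightarrow> nat \<Rightarrow> (nat \<Rightarrow> real) set" where
  "rational_primals \<beta> n = ball_box \<beta> n \<inter> ({..<n} \<rightarrow>\<^sub>E \<rat>)"

lemma countable_rational_primals: "countable (rational_primals \<beta> n)"
proof -
  have "countable ({..<n} \<rightarrow>\<^sub>E (\<rat> :: real set))" by (intro countable_PiE countable_rat) auto
  then show ?thesis unfolding rational_primals_def by (rule countable_Int2)
qed

lemma countable_rational_duals: "countable (rational_duals m)"
proof -
  have "countable ({..<m} \<rightarrow>\<^sub>E (\<rat> \<inter> {0..} :: real set))"
    by (intro countable_PiE countable_Int1 countable_rat) auto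
  then show ?thesis unfolding rational_duals_def by (rule countable_subset[rotated]) auto
qed

text \<open>Rounding towards 0 never increases a modulus, so it respects the box and the ball
  simultaneously.\<close>

lemma rational_shrink:
  fixes v e :: real
  assumes "e > 0"
  shows "\<exists>q\<in>\<rat>. \<bar>q\<bar> \<le> \<bar>v\<bar> \<and> \<bar>q - v\<bar> < e"
proof (cases v "0 :: real" rule: linorder_cases)
  case less
  then obtain q where "q \<in> \<rat>" "v < q" "q < min 0 (v + e)"
    using Rats_dense_in_real[of v "min 0 (v + e)"] assms by auto
  then show ?thesis by (intro bexI[of _ q]) auto
next
  case greater
  then obtain q where "q \<in> \<rat>" "max 0 (v - e) < q" "q < v"
    using Rats_dense_in_real[of "max 0 (v - e)" v] assms by auto
  then show ?thesis by (intro bexI[of _ q]) auto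
qed (use assms in auto)

lemma rational_primals_dense:
  assumes x: "x \<in> ball_box \<beta> n"
  obtains q :: "nat \<Rightarrow> nat \<Rightarrow> real" where "\<And>k. q k \<in> rational_primals \<beta> n" "\<And>j. j < n \<Longrightarrow> (\<lambda>k. q k j) \<longlonglongrightarrow> x j"
proof -
  have "\<exists>q. q \<in> \<rat> \<and> \<bar>q\<bar> \<le> \<bar>x j\<bar> \<and> \<bar>q - x j\<bar> < 1 / real (Suc k)" for k j
    using rational_shrink[of "1 / real (Suc k)" "x j"] by auto
  then have "\<forall>k. \<exists>f. \<forall>j. f j \<in> \<rat> \<and> \<bar>f j\<bar> \<le> \<bar>x j\<bar> \<and> \<bar>f j - x j\<bar> < 1 / real (Suc k)"
    by (intro allI choice)
  then obtain f where "\<forall>k j. f k j \<in> \<rat> \<and> \<bar>f k j\<bar> \<le> \<bar>x j\<bar> \<and> \<bar>f k j - x j\<bar> < 1 / real (Suc k)"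
    by (rule exE[OF choice])
  then have f: "\<And>k j. f k j \<in> \<rat>" "\<And>k j. \<bar>f k j\<bar> \<le> \<bar>x j\<bar>" "\<And>k j. \<bar>f k j - x j\<bar> < 1 / real (Suc k)"
    by simp_all
  define q where "q k = restrict (f k) {..<n}" for k
  have box: "q k \<in> rational_primals \<beta> n" for k
  proof -
    have "L2_set (q k) {..<n} = L2_set (\<lambda>j. \<bar>f k j\<bar>) {..<n}"
      by (simp add: q_def L2_set_def)
    also have "\<dots> \<le> L2_set (\<lambda>j. \<bar>x j\<bar>) {..<n}" by (rule L2_set_mono) (auto simp: f)
    also have "\<dots> \<le> 1" using x by (simp add: ball_box_def L2_set_def)
    finally have 1: "L2_set (q k) {..<n} \<le> 1" .
    have "q k \<in> scaled_box \<beta> n"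
      unfolding q_def
    proof (rule restrict_in_scaled_box)
      fix j assume "j < n"
      then have "\<bar>x j\<bar> \<le> 1 / sqrt (\<beta> * real n)"
        using x scaled_box_abs_le[of x \<beta> n j] by (simp add: ball_box_def)
      then show "\<bar>f k j\<bar> \<le> 1 / sqrt (\<beta> * real n)" using f(2)[of k j] by linarith
    qed
    moreover have "q k \<in> {..<n} \<rightarrow>\<^sub>E \<rat>" unfolding q_def using f(1) by (simp add: restrict_PiE_iff)
    ultimately show ?thesis using 1 by (simp add: rational_primals_def ball_box_def)
  qed
  have "(\<lambda>k. q k j) \<longlonglongrightarrow> x j" if "j < n" for j
  proof -
    have "(\<lambda>k. f k j - x j) \<longlonglongrightarrow> 0"
    proof (rule Lim_null_comparison)
      show "\<forall>\<^sub>F k in sequentially. norm (f k j - x j) \<le> 1 / real (Suc k)"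
        using f(3) by (intro always_eventually allI) (simp add: less_imp_le)
      show "(\<lambda>k. 1 / real (Suc k)) \<longlonglongrightarrow> 0" by real_asymp
    qed
    then show ?thesis using that by (simp add: q_def LIM_zero_iff)
  qed
  then show ?thesis using that box by blast
qed

lemma inner_le_L2_set_nonneg:
  assumes "\<And>i. i \<in> A \<Longrightarrow> 0 \<le> l i"
  shows "(\<Sum>i\<in>A. l i * a i) \<le> L2_set l A * L2_set (\<lambda>i. max 0 (a i)) A"
proof -
  have "(\<Sum>i\<in>A. l i * a i) \<le> (\<Sum>i\<in>A. l i * max 0 (a i))"
    by (intro sum_mono mult_left_mono assms) auto
  also have "\<dots> \<le> L2_set l A * L2_set (\<lambda>i. max 0 (a i)) A" by (rule inner_le_L2_set)
  finally show ?thesis .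
qed

text \<open>Convexity in \<open>s\<close> between the ends s = 0 and s = 1. The chosen primal vector
  may have a norm \<open>s\<close> below 1, which scales \<open>h\<close> by \<open>s\<close>; the
  interpolation then needs control only of \<open>c\<^sup>2\<close> and of the full hinge.\<close>

lemma hinge_square_convex:
  fixes c h s :: real
  assumes c: "c \<ge> 0" and s: "0 \<le> s" "s \<le> 1"
  shows "(max 0 (c - s * h))\<^sup>2 \<le> (1 - s) * c\<^sup>2 + s * (max 0 (c - h))\<^sup>2"
proof -
  let ?p = "max 0 (c - h)"
  have "c - s * h = (1 - s) * c + s * (c - h)" by (simp add: algebra_simps)
  also have "\<dots> \<le> (1 - s) * c + s * ?p" using s by (intro add_left_mono mult_left_mono) auto
  finally have "max 0 (c - s * h) \<le> (1 - s) * c + s * ?p"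
    using c s by (auto intro!: add_nonneg_nonneg mult_nonneg_nonneg)
  then have "(max 0 (c - s * h))\<^sup>2 \<le> ((1 - s) * c + s * ?p)\<^sup>2" by (rule power_mono) simp
  also have "\<dots> = (1 - s) * c\<^sup>2 + s * ?p\<^sup>2 - s * (1 - s) * (c - ?p)\<^sup>2"
    by (simp add: power2_eq_square algebra_simps)
  also have "\<dots> \<le> (1 - s) * c\<^sup>2 + s * ?p\<^sup>2" using s by simp
  finally show ?thesis .
qed

text \<open>One clipped vector serves every \<open>l\<close>; only its rational approximation
  depends on \<open>l\<close>. Here \<rho> is slack in the energy, \<nu> bounds the empirical
  correlation from below, \<tau> bounds the mean squared hinge from above, and \<open>t\<close> sets
  the margin reserved for the auxiliary scalar.\<close>

lemma comparison_process_large: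
  fixes g h :: "nat \<Rightarrow> real"
  assumes \<beta>: "0 < \<beta>" and \<gamma>: "\<gamma> > 0" and \<rho>: "\<rho> \<ge> 1" and c: "c \<ge> 0" and n: "n > 0" and t: "t \<ge> 0"
    and E1: "(\<Sum>j<n. (clip \<gamma> (g j))\<^sup>2) \<le> real n * (\<beta> * \<rho>\<^sup>2)"
    and E2: "(\<Sum>j<n. g j * clip \<gamma> (g j)) \<ge> real n * \<nu>"
    and E3: "(\<Sum>i<m. (max 0 (c - h i))\<^sup>2) \<le> real m * \<tau>" "c\<^sup>2 \<le> \<tau>"
    and num: "sqrt (real m * \<tau>) + t * sqrt (real n) < sqrt (real n) * (\<nu> / (\<rho> * sqrt \<beta>))"
    and l: "\<And>i. i < m \<Longrightarrow> 0 \<le> l i" "L2_set l {..<m} > 0"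
  shows "\<exists>x\<in>rational_primals \<beta> n.
     L2_set l {..<m} * (\<Sum>j<n. g j * x j) + L2_set x {..<n} * (\<Sum>i<m. h i * l i)
       > c * (\<Sum>i<m. l i) + t * sqrt (real n) * L2_set l {..<m}"
proof -
  \<comment> \<open>With this scale \<open>E1\<close> says exactly that \<open>x\<close> has norm at
    most 1, and \<rho> \<ge> 1 keeps \<open>x\<close> inside the box.\<close>
  define r where "r = 1 / (\<rho> * sqrt (\<beta> * real n))"
  have r: "r > 0" using \<rho> \<beta> n by (simp add: r_def)
  define x where "x = (\<lambda>j\<in>{..<n}. clip \<gamma> (g j) * r)"
  define s where "s = L2_set x {..<n}"
  have x: "x \<in> ball_box \<beta> n"
  proof -
    have "(\<Sum>j<n. (x j)\<^sup>2) = r\<^sup>2 * (\<Sum>j<n. (clip \<gamma> (g j))\<^sup>2)"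
      by (simp add: x_def power_mult_distrib sum_distrib_left mult.commute)
    also have "\<dots> \<le> r\<^sup>2 * (real n * (\<beta> * \<rho>\<^sup>2))" by (intro mult_left_mono E1) simp
    also have "\<dots> = 1" using \<beta> n \<rho> by (simp add: r_def power_divide power_mult_distrib)
    finally have "L2_set x {..<n} \<le> 1" by (simp add: L2_set_def)
    moreover have "x \<in> scaled_box \<beta> n"
      unfolding x_def
    proof (rule restrict_in_scaled_box)
      fix j
      have "\<bar>clip \<gamma> (g j) * r\<bar> \<le> 1 * r"
        unfolding abs_mult using r clip_abs_le_1[of \<gamma> "g j"] by (intro mult_mono) auto
      also have "1 * r \<le> 1 / sqrt (\<beta> * real n)"
      proof -
        have "1 * sqrt (\<beta> * real n) \<le> \<rho> * sqrt (\<beta> * real n)"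
          using \<rho> \<beta> by (intro mult_right_mono) auto
        then show ?thesis
          unfolding r_def mult_1 using \<rho> \<beta> n by (intro divide_left_mono) auto
      qed
      finally show "\<bar>clip \<gamma> (g j) * r\<bar> \<le> 1 / sqrt (\<beta> * real n)" .
    qed
    ultimately show ?thesis by (simp add: ball_box_def)
  qed
  have s: "0 \<le> s" "s \<le> 1" using x unfolding s_def ball_box_def by auto
  let ?\<Lambda> = "L2_set l {..<m}"
  have gx: "(\<Sum>j<n. g j * x j) \<ge> sqrt (real n) * (\<nu> / (\<rho> * sqrt \<beta>))"
  proof -
    have "real n * r = (real n / sqrt (real n)) / (\<rho> * sqrt \<beta>)"
      by (simp add: r_def real_sqrt_mult)
    then have "real n * r = sqrt (real n) / (\<rho> * sqrt \<beta>)" by (simp add: real_div_sqrt)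
    then have "sqrt (real n) * (\<nu> / (\<rho> * sqrt \<beta>)) = r * (real n * \<nu>)"
      by (simp add: field_simps)
    also have "\<dots> \<le> r * (\<Sum>j<n. g j * clip \<gamma> (g j))" using r by (intro mult_left_mono E2) simp
    also have "\<dots> = (\<Sum>j<n. g j * x j)" by (simp add: x_def sum_distrib_left mult_ac)
    finally show ?thesis .
  qed
  have hl: "c * (\<Sum>i<m. l i) - s * (\<Sum>i<m. h i * l i) \<le> ?\<Lambda> * sqrt (real m * \<tau>)"
  proof -
    have "c * (\<Sum>i<m. l i) - s * (\<Sum>i<m. h i * l i) = (\<Sum>i<m. l i * (c - s * h i))"
      by (simp add: sum_distrib_left sum_subtractf right_diff_distrib mult_ac)
    also have "\<dots> \<le> ?\<Lambda> * L2_set (\<lambda>i. max 0 (c - s * h i)) {..<m}"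
      by (rule inner_le_L2_set_nonneg) (use l in auto)
    also have "\<dots> \<le> ?\<Lambda> * sqrt (real m * \<tau>)"
    proof (rule mult_left_mono)
      have "(\<Sum>i<m. (max 0 (c - s * h i))\<^sup>2) \<le> (\<Sum>i<m. (1 - s) * c\<^sup>2 + s * (max 0 (c - h i))\<^sup>2)"
        by (intro sum_mono hinge_square_convex c s)
      also have "\<dots> = (1 - s) * (real m * c\<^sup>2) + s * (\<Sum>i<m. (max 0 (c - h i))\<^sup>2)"
        by (simp add: sum.distrib sum_distrib_left)
      also have "\<dots> \<le> (1 - s) * (real m * \<tau>) + s * (real m * \<tau>)"
        using s E3 by (intro add_mono mult_left_mono) auto
      also have "\<dots> = real m * \<tau>" by (simp add: algebra_simps)
      finally show "L2_set (\<lambda>i. max 0 (c - s * h i)) {..<m} \<le> sqrt (real m * \<tau>)"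
        unfolding L2_set_def by (rule real_sqrt_le_mono)
    qed simp
    finally show ?thesis .
  qed
  have strict: "?\<Lambda> * (\<Sum>j<n. g j * x j) + s * (\<Sum>i<m. h i * l i) > c * (\<Sum>i<m. l i) + t * sqrt (real n) * ?\<Lambda>"
  proof -
    have "?\<Lambda> * (sqrt (real m * \<tau>) + t * sqrt (real n)) < ?\<Lambda> * (\<Sum>j<n. g j * x j)"
      using num gx l(2) by (intro mult_strict_left_mono) auto
    then show ?thesis using hl by (simp add: distrib_left mult.commute mult.left_commute)
  qed
  \<comment> \<open>The strict inequality at \<open>x\<close> passes to a nearby rational point,
    since the process is continuous in the primal vector.\<close>
  obtain q where q: "\<And>k. q k \<in> rational_primals \<beta> n" "\<And>j. j < n \<Longrightarrow> (\<lambda>k. q k j) \<longlonglongrightarrow> x j"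
    using rational_primals_dense[OF x] by metis
  have "(\<lambda>k. ?\<Lambda> * (\<Sum>j<n. g j * q k j) + L2_set (q k) {..<n} * (\<Sum>i<m. h i * l i))
     \<longlonglongrightarrow> ?\<Lambda> * (\<Sum>j<n. g j * x j) + L2_set x {..<n} * (\<Sum>i<m. h i * l i)"
    unfolding L2_set_def[of "q _"] L2_set_def[of x] using q(2) by (intro tendsto_intros) auto
  from order_tendstoD(1)[OF this strict[unfolded s_def]]
  obtain k where "?\<Lambda> * (\<Sum>j<n. g j * q k j) + L2_set (q k) {..<n} * (\<Sum>i<m. h i * l i)
       > c * (\<Sum>i<m. l i) + t * sqrt (real n) * ?\<Lambda>"
    by (auto simp: eventually_sequentially)
  then show ?thesis using q(1) by blast
qed

section \<open>Probability of feasibility\<close>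

lemma measurable_matrix_entry:
  assumes "iid_std_normal_matrix M m n H" "i < m" "j < n"
  shows "(\<lambda>w. H w i j) \<in> borel_measurable M"
proof -
  have "distributed M lborel (\<lambda>w. H w i j) (\<lambda>z. ennreal (std_normal_density z))"
    using assms unfolding iid_std_normal_matrix_def by blast
  from distributed_measurable[OF this] show ?thesis by simp
qed

lemma distr_matrix:
  assumes H: "iid_std_normal_matrix M m n H" and mn: "m > 0" "n > 0"
  defines "I \<equiv> {..<m} \<times> {..<n}"
  shows "distr M (gaussK I) (\<lambda>w. \<lambda>p\<in>I. H w (fst p) (snd p)) = gaussK I"
proof -
  interpret M: prob_space M using H unfolding iid_std_normal_matrix_def by simp
  have ne: "I \<noteq> {}" using mn by (auto simp: I_def)
  have X: "(\<lambda>(i, j) w. H w i j) = (\<lambda>p w. H w (fst p) (snd p))" by auto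
  have ind: "M.indep_vars (\<lambda>_. borel) (\<lambda>p w. H w (fst p) (snd p)) I"
    using H unfolding iid_std_normal_matrix_def X I_def by simp
  have rv: "(\<lambda>w. H w (fst p) (snd p)) \<in> borel_measurable M" if "p \<in> I" for p
    by (rule measurable_matrix_entry[OF H]) (use that in \<open>auto simp: I_def\<close>)
  have gd: "distr M borel (\<lambda>w. H w (fst p) (snd p)) = gauss" if "p \<in> I" for p
  proof -
    have "distributed M lborel (\<lambda>w. H w (fst p) (snd p)) (\<lambda>z. ennreal (std_normal_density z))"
      using H that unfolding iid_std_normal_matrix_def I_def by auto
    then have "distr M lborel (\<lambda>w. H w (fst p) (snd p)) = gauss"
      unfolding gauss_def by (rule distributed_distr_eq_density[symmetric, THEN sym])
    moreover have "distr M borel (\<lambda>w. H w (fst p) (snd p)) = distr M lborel (\<lambda>w. H w (fst p) (snd p))"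
      by (rule distr_cong) auto
    ultimately show ?thesis by simp
  qed
  have "distr M (gaussK I) (\<lambda>w. \<lambda>p\<in>I. H w (fst p) (snd p))
      = distr M (Pi\<^sub>M I (\<lambda>_. borel)) (\<lambda>w. \<lambda>p\<in>I. H w (fst p) (snd p))"
    by (rule distr_cong) (auto intro!: sets_PiM_cong)
  also have "\<dots> = Pi\<^sub>M I (\<lambda>p. distr M borel (\<lambda>w. H w (fst p) (snd p)))"
    using M.indep_vars_iff_distr_eq_PiM'[where M'="\<lambda>_. borel" and X="\<lambda>p w. H w (fst p) (snd p)", OF ne] rv ind by blast
  also have "\<dots> = gaussK I" by (rule PiM_cong) (auto simp: gd)
  finally show ?thesis .
qed

lemma distr_gindices_matrix:
  fixes m n :: nat
  defines "I \<equiv> {..<m} \<times> {..<n}"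
  shows "distr (gaussK (gindices m n)) (gaussK I) (\<lambda>w. \<lambda>p\<in>I. w (Inl (Some p))) = gaussK I"
  by (rule distr_PiM_reindex[where f="\<lambda>p. Inl (Some p)"])
     (auto simp: I_def gindices_def inj_on_def)

text \<open>The Lipschitz hypothesis acts twice: it makes \<Phi> measurable and it makes \<Phi>
  depend only on the entries in the m by n block. The probability is then determined by the joint
  law of these entries, which is the same on both spaces.\<close>

lemma matrix_law:
  fixes \<Phi> :: "(nat \<Rightarrow> nat \<Rightarrow> real) \<Rightarrow> real"
  assumes lip: "\<And>H H'. \<bar>\<Phi> H - \<Phi> H'\<bar> \<le> entry_dist m n H H'"
    and H: "iid_std_normal_matrix M m n H" and mn: "m > 0" "n > 0"
  shows "measure M {w \<in> space M. \<Phi> (H w) \<le> 0} =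
    \<P>(w in gaussK (gindices m n). \<Phi> (gmatrix w) \<le> 0)"
proof -
  define I where "I = {..<m} \<times> {..<n}"
  define A where "A = {v \<in> space (gaussK I). \<Phi> (\<lambda>i j. v (i, j)) \<le> 0}"
  have local: "\<Phi> G = \<Phi> G'" if "\<And>i j. i < m \<Longrightarrow> j < n \<Longrightarrow> G i j = G' i j" for G G'
  proof -
    have "(\<Sum>i<m. \<Sum>j<n. \<bar>G i j - G' i j\<bar>) = 0" using that by simp
    then show ?thesis using lip[of G G'] by simp
  qed
  have "(\<lambda>v. \<Phi> (\<lambda>i j. v (i, j))) \<in> borel_measurable (gaussK I)"
    by (rule borel_measurable_Lipschitz_entries[OF lip])
       (rule measurable_gaussK_component, simp add: I_def)
  then have A: "A \<in> sets (gaussK I)" unfolding A_def by measurable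
  have pull: "measure N {w \<in> space N. \<Phi> (G w) \<le> 0} = measure (gaussK I) A"
    if X: "X \<in> measurable N (gaussK I)" and d: "distr N (gaussK I) X = gaussK I"
      and eq: "\<And>w i j. w \<in> space N \<Longrightarrow> i < m \<Longrightarrow> j < n \<Longrightarrow> X w (i, j) = G w i j" for N :: "'c measure" and X G
  proof -
    have "measure (gaussK I) A = measure N (X -` A \<inter> space N)"
      using measure_distr[OF X A] unfolding d .
    also have "X -` A \<inter> space N = {w \<in> space N. \<Phi> (G w) \<le> 0}"
    proof -
      have "\<Phi> (\<lambda>i j. X w (i, j)) = \<Phi> (G w)" if "w \<in> space N" for w
        by (rule local) (simp add: eq that)
      then show ?thesis using measurable_space[OF X] by (auto simp: A_def)
    qed
    finally show ?thesis by simp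
  qed
  have m1: "(\<lambda>w. \<lambda>p\<in>I. H w (fst p) (snd p)) \<in> measurable M (gaussK I)"
    by (rule measurable_restrict) (use measurable_matrix_entry[OF H] in \<open>auto simp: I_def measurable_cong_sets[OF refl sets_gauss]\<close>)
  have m2: "(\<lambda>w. \<lambda>p\<in>I. w (Inl (Some p))) \<in> measurable (gaussK (gindices m n)) (gaussK I)"
    by (rule measurable_restrict, rule measurable_component_singleton) (auto simp: I_def gindices_def)
  have "measure M {w \<in> space M. \<Phi> (H w) \<le> 0} = measure (gaussK I) A"
    by (rule pull[OF m1 distr_matrix[OF H mn, folded I_def]]) (simp add: I_def)
  also have "\<dots> = \<P>(w in gaussK (gindices m n). \<Phi> (gmatrix w) \<le> 0)"
    by (rule pull[symmetric, OF m2 distr_gindices_matrix[of m n, folded I_def]]) (simp add: I_def)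
  finally show ?thesis .
qed

section \<open>Exponential tails of the three empirical means\<close>

lemma integral_uminus_mult_clip: "integral\<^sup>L gauss (\<lambda>g. - (g * clip \<gamma> g)) = - clip_corr \<gamma>"
  using integrable_mult_clip[of \<gamma>] by (simp add: clip_corr_def)

lemma clip_energy_upper_tail:
  assumes "clip_energy \<gamma> < \<mu>"
  shows "\<exists>a>0. \<forall>(K :: 'k set) L. finite K \<longrightarrow> L \<subseteq> K \<longrightarrow>
     sum_tail K L (\<lambda>y. (clip \<gamma> y)\<^sup>2) \<mu> \<le> exp (- a * real (card L))"
proof (rule gauss_sum_upper_tail[where b=1])
  show "integrable gauss (\<lambda>x. exp (1 * (clip \<gamma> x)\<^sup>2))"
    by (rule integrable_gauss_bounded[where B="exp 1"]) (auto simp: clip_sq_le_1)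
qed (use assms in \<open>auto simp: integrable_clip_sq clip_energy_def\<close>)

text \<open>Negation turns a lower tail into an upper one, and nonnegativity of
  \<open>y * clip \<gamma> y\<close> bounds the exponential of the negated variable by 1.\<close>

lemma clip_corr_lower_tail:
  assumes "\<gamma> > 0" "\<mu> < clip_corr \<gamma>"
  shows "\<exists>a>0. \<forall>(K :: 'k set) L. finite K \<longrightarrow> L \<subseteq> K \<longrightarrow>
     sum_tail K L (\<lambda>y. - (y * clip \<gamma> y)) (- \<mu>) \<le> exp (- a * real (card L))"
proof (rule gauss_sum_upper_tail[where b=1])
  show "integrable gauss (\<lambda>x. exp (1 * - (x * clip \<gamma> x)))"
    by (rule integrable_gauss_bounded[where B=1]) (auto simp: mult_clip_nonneg assms)
qed (use assms in \<open>auto simp: integrable_mult_clip integral_uminus_mult_clip simp del: integral_minus\<close>)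

lemma hinge_upper_tail:
  assumes "f_gar c < \<mu>"
  shows "\<exists>a>0. \<forall>(K :: 'k set) L. finite K \<longrightarrow> L \<subseteq> K \<longrightarrow>
     sum_tail K L (\<lambda>y. (max 0 (c - y))\<^sup>2) \<mu> \<le> exp (- a * real (card L))"
\<comment> \<open>The estimate \<open>(c - x)\<^sup>2 \<le> 2 * c\<^sup>2 + 2 * x\<^sup>2\<close>
  doubles the coefficient, so 1/8 leads to the integrable
  \<open>exp (x\<^sup>2 / 4)\<close>.\<close>
proof (rule gauss_sum_upper_tail[where b="1/8"])
  show "integrable gauss (\<lambda>x. exp (1/8 * (max 0 (c - x))\<^sup>2))"
  proof (rule Bochner_Integration.integrable_bound)
    show "integrable gauss (\<lambda>x. exp (c\<^sup>2 / 4) * exp (x\<^sup>2 / 4))"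
      by (intro integrable_mult_right integrable_gauss_exp_square)
    show "AE x in gauss. norm (exp (1/8 * (max 0 (c - x))\<^sup>2)) \<le> norm (exp (c\<^sup>2 / 4) * exp (x\<^sup>2 / 4))"
    proof (rule AE_I2)
      fix x
      have "(max 0 (c - x))\<^sup>2 \<le> (c - x)\<^sup>2" by (auto simp: max_def)
      also have "\<dots> \<le> 2 * c\<^sup>2 + 2 * x\<^sup>2"
        using zero_le_power2[of "c + x"] by (simp add: power2_eq_square algebra_simps)
      finally have "1/8 * (max 0 (c - x))\<^sup>2 \<le> c\<^sup>2 / 4 + x\<^sup>2 / 4" by simp
      then show "norm (exp (1/8 * (max 0 (c - x))\<^sup>2)) \<le> norm (exp (c\<^sup>2 / 4) * exp (x\<^sup>2 / 4))"
        by (simp add: exp_add[symmetric])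
    qed
  qed simp
qed (use assms in \<open>auto simp: integrable_hinge f_gar_eq_integral\<close>)

text \<open>Feasibility quantifies over an uncountable set; it becomes measurable as a sublevel
  event of the Lipschitz functional \<open>xi_box_r_at\<close>.\<close>

lemma measurable_feasible_at:
  assumes "\<kappa> > 0" "\<beta> > 0"
  shows "{w \<in> space (gaussK (gindices m n)). feasible_at \<kappa> m n (gmatrix w) \<beta>}
    \<in> sets (gaussK (gindices m n))"
proof -
  have "(\<lambda>w. xi_box_r_at \<kappa> m n (gmatrix w) \<beta>) \<in> borel_measurable (gaussK (gindices m n))"
    by (rule borel_measurable_Lipschitz_entries[OF xi_box_r_at_Lipschitz[OF assms]])
       (rule measurable_gaussK_component, auto simp: gindices_def)
  then show ?thesis unfolding xi_box_r_at_le_0_iff[OF assms, symmetric] by measurable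
qed

lemma rational_dualsD:
  assumes "l \<in> rational_duals m"
  shows "i < m \<Longrightarrow> 0 \<le> l i" and "L2_set l {..<m} > 0"
proof -
  have l: "l \<in> {..<m} \<rightarrow>\<^sub>E (\<rat> \<inter> {0..})" using assms unfolding rational_duals_def by simp
  show "0 \<le> l i" if "i < m" using PiE_mem[OF l, of i] that by simp
  have "\<exists>i<m. l i \<noteq> 0" using assms unfolding rational_duals_def by simp
  then have "L2_set l {..<m} \<noteq> 0" by (auto simp: L2_set_eq_0_iff)
  then show "L2_set l {..<m} > 0" using L2_set_nonneg[of l "{..<m}"] by linarith
qed

lemma
  assumes A: "countable A" and P: "\<And>i. i \<in> A \<Longrightarrow> {x \<in> space M. P i x} \<in> sets M"
  shows sets_Collect_countable_bex: "{x \<in> space M. \<exists>i\<in>A. P i x} \<in> sets M"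
    and sets_Collect_countable_ball: "{x \<in> space M. \<forall>i\<in>A. P i x} \<in> sets M"
proof -
  have "{x \<in> space M. \<exists>i\<in>A. P i x} = (\<Union>i\<in>A. {x \<in> space M. P i x})" by blast
  then show "{x \<in> space M. \<exists>i\<in>A. P i x} \<in> sets M" using sets.countable_UN''[OF A P] by simp
  have "{x \<in> space M. \<forall>i\<in>A. P i x} = space M - (\<Union>i\<in>A. space M - {x \<in> space M. P i x})" by blast
  moreover have "(\<Union>i\<in>A. space M - {x \<in> space M. P i x}) \<in> sets M"
    by (rule sets.countable_UN''[OF A]) (intro sets.Diff sets.top P)
  ultimately show "{x \<in> space M. \<forall>i\<in>A. P i x} \<in> sets M" by (simp only: sets.Diff sets.top)
qed

text \<open>Off the first three bad events the decoupled inequality holds for all rational duals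
  with margin \<open>t * sqrt (real n) * L2_set l {..<m}\<close>. Gordon's theorem carries its
  probability over to the coupled process; off the fourth bad event the auxiliary scalar consumes at
  most that margin, and what remains is the dual test for feasibility.\<close>

lemma feasible_prob_lower_bound:
  fixes m n :: nat
  assumes \<kappa>: "\<kappa> > 0" and \<beta>: "\<beta> > 0" and \<gamma>: "\<gamma> > 0" and \<rho>: "\<rho> \<ge> 1" and n: "n > 0" and t: "t \<ge> 0"
  defines "c \<equiv> \<kappa> / sqrt \<beta>" and "K \<equiv> gindices m n"
  defines "L1 \<equiv> (\<lambda>j. Inr (Inl j)) ` {..<n}" and "L2 \<equiv> (\<lambda>i. Inr (Inr i)) ` {..<m}"
  assumes \<tau>: "c\<^sup>2 \<le> \<tau>"
    and num: "sqrt (real m * \<tau>) + t * sqrt (real n) < sqrt (real n) * (\<nu> / (\<rho> * sqrt \<beta>))"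
  shows "\<P>(w in gaussK K. feasible_at \<kappa> m n (gmatrix w) \<beta>)
    \<ge> 1 - sum_tail K L1 (\<lambda>y. (clip \<gamma> y)\<^sup>2) (\<beta> * \<rho>\<^sup>2)
        - sum_tail K L1 (\<lambda>y. - (y * clip \<gamma> y)) (- \<nu>)
        - sum_tail K L2 (\<lambda>y. (max 0 (c - y))\<^sup>2) \<tau>
        - \<P>(w in gaussK K. w (Inl None) \<ge> t * sqrt (real n))"
    (is "measure ?N ?F \<ge> 1 - measure ?N ?B1 - measure ?N ?B2 - measure ?N ?B3 - measure ?N ?B4")
proof -
  interpret N: prob_space "gaussK K" by (rule prob_space_gaussK)
  define T where "T l = c * (\<Sum>i<m. l i) + t * sqrt (real n) * L2_set l {..<m}" for l
  define YE where "YE = {w \<in> space ?N. \<forall>l\<in>rational_duals m. \<exists>x\<in>rational_primals \<beta> n.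
        decoupled m n w l x > T l}"
  define XE where "XE = {w \<in> space ?N. \<forall>l\<in>rational_duals m. \<exists>x\<in>rational_primals \<beta> n.
        coupled m n w l x > T l}"
  have sub: "L1 \<subseteq> K" "L2 \<subseteq> K" "Inl None \<in> K"
    by (auto simp: L1_def L2_def K_def gindices_def)
  have comp: "(\<lambda>w. w k) \<in> borel_measurable ?N" if "k \<in> K" for k
    by (rule measurable_gaussK_component[OF that])
  have c0: "c \<ge> 0" using \<kappa> \<beta> by (simp add: c_def)
  have inj: "inj_on (\<lambda>j. Inr (Inl j) :: gindex) {..<n}" "inj_on (\<lambda>i. Inr (Inr i) :: gindex) {..<m}"
    by (auto simp: inj_on_def)
  have s1: "(\<Sum>l\<in>L1. f (w l)) = (\<Sum>j<n. f (w (Inr (Inl j))))" and c1: "card L1 = n" for f :: "real \<Rightarrow> real" and w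
    unfolding L1_def by (simp_all add: sum.reindex[OF inj(1)] card_image[OF inj(1)])
  have s2: "(\<Sum>l\<in>L2. f (w l)) = (\<Sum>i<m. f (w (Inr (Inr i))))" and c2: "card L2 = m" for f :: "real \<Rightarrow> real" and w
    unfolding L2_def by (simp_all add: sum.reindex[OF inj(2)] card_image[OF inj(2)])
  have mB: "?B1 \<in> sets ?N" "?B2 \<in> sets ?N" "?B3 \<in> sets ?N" "?B4 \<in> sets ?N"
  proof -
    have [measurable]: "(\<lambda>w. w l) \<in> borel_measurable ?N" if "l \<in> L1" for l using comp sub(1) that by (meson subsetD)
    have [measurable]: "(\<lambda>w. w l) \<in> borel_measurable ?N" if "l \<in> L2" for l using comp sub(2) that by (meson subsetD)
    have [measurable]: "(\<lambda>w. w (Inl None)) \<in> borel_measurable ?N" using comp sub(3) .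
    show "?B1 \<in> sets ?N" "?B2 \<in> sets ?N" "?B3 \<in> sets ?N" "?B4 \<in> sets ?N" by measurable
  qed
  have mF: "?F \<in> sets ?N" unfolding K_def by (rule measurable_feasible_at[OF \<kappa> \<beta>])
  have mY: "YE \<in> sets ?N"
    unfolding YE_def
  proof (intro sets_Collect_countable_ball sets_Collect_countable_bex countable_rational_duals countable_rational_primals)
    fix l x :: "nat \<Rightarrow> real"
    have g: "(\<lambda>w. w (Inr (Inl j))) \<in> borel_measurable ?N" if "j \<in> {..<n}" for j
      by (rule comp) (use that in \<open>auto simp: K_def gindices_def\<close>)
    have h: "(\<lambda>w. w (Inr (Inr i))) \<in> borel_measurable ?N" if "i \<in> {..<m}" for i
      by (rule comp) (use that in \<open>auto simp: K_def gindices_def\<close>)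
    have "(\<lambda>w. decoupled m n w l x) \<in> borel_measurable ?N"
      by (intro borel_measurable_add borel_measurable_times borel_measurable_sum borel_measurable_const g h)
    then show "{w \<in> space ?N. T l < decoupled m n w l x} \<in> sets ?N"
      by measurable
  qed
  have "space ?N - (?B1 \<union> ?B2 \<union> ?B3) \<subseteq> YE"
  proof
    fix w assume w: "w \<in> space ?N - (?B1 \<union> ?B2 \<union> ?B3)"
    have nb: "\<not> (\<Sum>l\<in>L1. (clip \<gamma> (w l))\<^sup>2) \<ge> real (card L1) * (\<beta> * \<rho>\<^sup>2)"
        "\<not> (\<Sum>l\<in>L1. - (w l * clip \<gamma> (w l))) \<ge> real (card L1) * (- \<nu>)"
        "\<not> (\<Sum>l\<in>L2. (max 0 (c - w l))\<^sup>2) \<ge> real (card L2) * \<tau>"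
      using w by blast+
    have E1: "(\<Sum>j<n. (clip \<gamma> (w (Inr (Inl j))))\<^sup>2) \<le> real n * (\<beta> * \<rho>\<^sup>2)"
      using nb(1) s1[of "\<lambda>y. (clip \<gamma> y)\<^sup>2" w] unfolding c1 by linarith
    have E2: "(\<Sum>j<n. w (Inr (Inl j)) * clip \<gamma> (w (Inr (Inl j)))) \<ge> real n * \<nu>"
      using nb(2) s1[of "\<lambda>y. - (y * clip \<gamma> y)" w] unfolding c1 sum_negf by linarith
    have E3: "(\<Sum>i<m. (max 0 (c - w (Inr (Inr i))))\<^sup>2) \<le> real m * \<tau>"
      using nb(3) s2[of "\<lambda>y. (max 0 (c - y))\<^sup>2" w] unfolding c2 by linarith
    have "\<exists>x\<in>rational_primals \<beta> n.
        decoupled m n w l x > T l"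
      if "l \<in> rational_duals m" for l
      unfolding T_def
      by (rule comparison_process_large[OF \<beta> \<gamma> \<rho> c0 n t E1 E2 E3 \<tau> num rational_dualsD[OF that]])
    then show "w \<in> YE" using w unfolding YE_def by blast
  qed
  then have "measure ?N (space ?N - (?B1 \<union> ?B2 \<union> ?B3)) \<le> measure ?N YE"
    by (rule N.finite_measure_mono[OF _ mY])
  moreover have "measure ?N (space ?N - (?B1 \<union> ?B2 \<union> ?B3)) = 1 - measure ?N (?B1 \<union> ?B2 \<union> ?B3)"
    using mB by (intro N.prob_compl) auto
  moreover have "measure ?N (?B1 \<union> ?B2 \<union> ?B3) \<le> measure ?N ?B1 + measure ?N ?B2 + measure ?N ?B3"
    by (intro order_trans[OF measure_Un_le] add_right_mono measure_Un_le sets.Un mB)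
  moreover have "measure ?N YE \<le> measure ?N XE"
    unfolding YE_def XE_def K_def by (rule gordon_matrix[OF countable_rational_duals countable_rational_primals])
  moreover have "XE \<subseteq> ?F \<union> ?B4"
  proof
    fix w assume w: "w \<in> XE"
    show "w \<in> ?F \<union> ?B4"
    proof (cases "w (Inl None) \<ge> t * sqrt (real n)")
      case True
      then show ?thesis using w by (simp add: XE_def)
    next
      case False
      have "feasible_at \<kappa> m n (gmatrix w) \<beta>"
      proof (rule dual_test_imp_feasible[OF less_imp_le[OF \<beta>] c_def[THEN meta_eq_to_obj_eq]])
        fix l assume l: "l \<in> rational_duals m"
        then obtain x where x: "x \<in> rational_primals \<beta> n" and
          gt: "coupled m n w l x > T l"
          using w unfolding XE_def by blast
        have xb: "x \<in> ball_box \<beta> n" using x by (simp add: rational_primals_def)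
        have "w (Inl None) * L2_set x {..<n} \<le> t * sqrt (real n) * 1"
        proof -
          have "w (Inl None) * L2_set x {..<n} \<le> t * sqrt (real n) * L2_set x {..<n}"
            using False by (intro mult_right_mono) auto
          also have "\<dots> \<le> t * sqrt (real n) * 1"
            using xb t by (intro mult_left_mono) (auto simp: ball_box_def)
          finally show ?thesis .
        qed
        then have "w (Inl None) * L2_set x {..<n} * L2_set l {..<m} \<le> t * sqrt (real n) * L2_set l {..<m}"
          by (intro mult_right_mono) auto
        then have "(\<Sum>i<m. l i * (\<Sum>j<n. w (Inl (Some (i, j))) * x j)) > c * (\<Sum>i<m. l i)"
          using gt unfolding T_def by (simp add: mult.commute mult.left_commute)
        then show "\<exists>x\<in>ball_box \<beta> n. (\<Sum>i<m. l i * mat_vec n (gmatrix w) x i) > c * (\<Sum>i<m. l i)"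
          using xb unfolding mat_vec_def by (rule bexI)
      qed
      then show ?thesis using w by (simp add: XE_def)
    qed
  qed
  then have "measure ?N XE \<le> measure ?N (?F \<union> ?B4)"
    using mF mB by (intro N.finite_measure_mono) auto
  moreover have "measure ?N (?F \<union> ?B4) \<le> measure ?N ?F + measure ?N ?B4"
    by (intro measure_Un_le mF mB)
  ultimately show ?thesis by linarith
qed

lemma feasible_prob_exponential:
  fixes \<alpha> \<kappa> \<beta> \<gamma> :: real and m :: "nat \<Rightarrow> nat"
  assumes \<alpha>: "\<alpha> > 0" and \<kappa>: "\<kappa> > 0" and \<beta>: "\<beta> > 0" and \<gamma>: "\<gamma> > 0"
    and m: "\<And>n. \<bar>real (m n) - \<alpha> * real n\<bar> < 1"
    and energy: "clip_energy \<gamma> \<le> \<beta>"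
    and gap: "sqrt (\<alpha> * f_gar (\<kappa> / sqrt \<beta>)) < clip_corr \<gamma> / sqrt \<beta>"
  shows "\<exists>C>0. \<exists>a>0. \<exists>N0. \<forall>n\<ge>N0. m n > 0 \<and> n > 0 \<and>
    \<P>(w in gaussK (gindices (m n) n). feasible_at \<kappa> (m n) n (gmatrix w) \<beta>) \<ge> 1 - C * exp (- a * real n)"
proof -
  define c where "c = \<kappa> / sqrt \<beta>"
  define A where "A = sqrt (\<alpha> * f_gar c)"
  define B where "B = clip_corr \<gamma> / sqrt \<beta>"
  have c0: "c \<ge> 0" using \<kappa> \<beta> by (simp add: c_def)
  have fg: "c\<^sup>2 \<le> f_gar c" by (rule f_gar_ge[OF c0])
  then have fg0: "0 \<le> f_gar c" using zero_le_power2[of c] by linarith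
  have A0: "0 \<le> A" using \<alpha> fg0 by (simp add: A_def)
  have AB: "A < B" using gap by (simp add: A_def B_def c_def)
  \<comment> \<open>The gap is divided as \<open>A < r' < r' + t < r < B\<close>: \<open>r'\<close>
    leaves room for \<tau> above \<open>f_gar c\<close> and for the rounding of \<open>m n\<close>,
    \<open>t\<close> pays for the auxiliary scalar, and \<open>r\<close> leaves room for \<rho> and
    \<nu> below \<open>B\<close>.\<close>
  define r where "r = (A + B) / 2"
  define r' where "r' = (A + r) / 2"
  define t where "t = (r - r') / 2"
  have r: "A < r'" "r' < r" "r < B" "0 < t" "r' + t < r" "0 < r'" "0 < r"
    using A0 AB by (auto simp: r_def r'_def t_def field_simps)
  have "A\<^sup>2 < r'\<^sup>2" using A0 r by (intro power_strict_mono) auto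
  then have "f_gar c < r'\<^sup>2 / \<alpha>" using \<alpha> fg0 by (simp add: A_def field_simps)
  then obtain \<tau> where \<tau>: "f_gar c < \<tau>" "\<tau> < r'\<^sup>2 / \<alpha>" using dense by blast
  have \<tau>0: "0 < \<tau>" and c\<tau>: "c\<^sup>2 \<le> \<tau>" using \<tau> fg fg0 by linarith+
  have \<alpha>\<tau>: "\<alpha> * \<tau> < r'\<^sup>2" using \<tau>(2) \<alpha> by (simp add: field_simps)
  have rb: "r * sqrt \<beta> < clip_corr \<gamma>" using r(3) \<beta> by (simp add: B_def field_simps)
  have rs: "0 < r * sqrt \<beta>" using r \<beta> by simp
  \<comment> \<open>Chosen so that \<open>\<nu>\<close> is the midpoint of
    \<open>r * sqrt \<beta>\<close> and \<open>clip_corr \<gamma>\<close>; this secures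
    \<open>\<rho> > 1\<close> and \<open>\<nu> < clip_corr \<gamma>\<close> together.\<close>
  define \<rho> where "\<rho> = (1 + clip_corr \<gamma> / (r * sqrt \<beta>)) / 2"
  define \<nu> where "\<nu> = r * \<rho> * sqrt \<beta>"
  have \<rho>: "\<rho> > 1" using rb rs unfolding \<rho>_def by (simp add: less_divide_eq)
  have "\<nu> = (r * sqrt \<beta> + clip_corr \<gamma>) / 2"
    using r(7) \<beta> unfolding \<nu>_def \<rho>_def by (simp add: field_simps)
  then have \<nu>: "\<nu> < clip_corr \<gamma>" using rb by simp
  have \<nu>r: "\<nu> / (\<rho> * sqrt \<beta>) = r" using \<rho> \<beta> by (simp add: \<nu>_def)
  have "1 < \<rho>\<^sup>2" using \<rho> by (simp add: one_less_power)
  then have "\<beta> * 1 < \<beta> * \<rho>\<^sup>2" using \<beta> by (intro mult_strict_left_mono) auto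
  then have en: "clip_energy \<gamma> < \<beta> * \<rho>\<^sup>2" using energy by simp
  obtain a1 where a1: "a1 > 0" "\<And>(K :: gindex set) L. finite K \<Longrightarrow> L \<subseteq> K \<Longrightarrow>
     sum_tail K L (\<lambda>y. (clip \<gamma> y)\<^sup>2) (\<beta> * \<rho>\<^sup>2) \<le> exp (- a1 * real (card L))"
    using clip_energy_upper_tail[OF en] by blast
  obtain a2 where a2: "a2 > 0" "\<And>(K :: gindex set) L. finite K \<Longrightarrow> L \<subseteq> K \<Longrightarrow>
     sum_tail K L (\<lambda>y. - (y * clip \<gamma> y)) (- \<nu>) \<le> exp (- a2 * real (card L))"
    using clip_corr_lower_tail[OF \<gamma> \<nu>] by blast
  obtain a3 where a3: "a3 > 0" "\<And>(K :: gindex set) L. finite K \<Longrightarrow> L \<subseteq> K \<Longrightarrow>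
     sum_tail K L (\<lambda>y. (max 0 (c - y))\<^sup>2) \<tau> \<le> exp (- a3 * real (card L))"
    using hinge_upper_tail[OF \<tau>(1)] by blast
  obtain C4 where C4: "C4 > 0" "\<And>(K :: gindex set) a. Inl None \<in> K \<Longrightarrow> 0 \<le> a \<Longrightarrow>
     \<P>(w in gaussK K. w (Inl None) \<ge> a) \<le> C4 * exp (- (a\<^sup>2 / 4))"
    using gauss_coordinate_tail[of "Inl None :: gindex"] by blast
  define a where "a = Min {a1, a2, a3 * \<alpha>, t\<^sup>2 / 4}"
  have a: "a > 0" "a \<le> a1" "a \<le> a2" "a \<le> a3 * \<alpha>" "a \<le> t\<^sup>2 / 4"
    using a1(1) a2(1) a3(1) \<alpha> r(4) by (auto simp: a_def)
  \<comment> \<open>One summand per bad event. The factor \<open>exp a3\<close> compensates for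
    having only \<open>m n \<ge> \<alpha> * n - 1\<close> hinge terms.\<close>
  define C where "C = 1 + 1 + exp a3 + C4"
  have C: "C > 0" using C4(1) by (simp add: C_def add_pos_pos)
  \<comment> \<open>The thresholds yield in turn \<open>n > 0\<close>, then
    \<open>\<alpha> * n \<ge> 1\<close> and hence \<open>m n > 0\<close>, and finally
    \<open>(\<alpha> * n + 1) * \<tau> \<le> r'\<^sup>2 * n\<close>, which absorbs the rounding of
    \<open>m n\<close>.\<close>
  define N0 where "N0 = nat \<lceil>max (max 1 (1 / \<alpha>)) (\<tau> / (r'\<^sup>2 - \<alpha> * \<tau>))\<rceil>"
  have main: "m n > 0 \<and> n > 0 \<and>
    \<P>(w in gaussK (gindices (m n) n). feasible_at \<kappa> (m n) n (gmatrix w) \<beta>) \<ge> 1 - C * exp (- a * real n)"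
    if n: "n \<ge> N0" for n
  proof -
    have "max (max 1 (1 / \<alpha>)) (\<tau> / (r'\<^sup>2 - \<alpha> * \<tau>)) \<le> real n" using n unfolding N0_def by linarith
    then have n1: "1 \<le> real n" "1 / \<alpha> \<le> real n" "\<tau> / (r'\<^sup>2 - \<alpha> * \<tau>) \<le> real n" by auto
    have n0: "n > 0" using n1(1) by linarith
    have "1 \<le> \<alpha> * real n" using n1(2) \<alpha> by (simp add: field_simps)
    then have "0 < real (m n)" using m[of n] by linarith
    then have m0: "m n > 0" by simp
    have mle: "real (m n) \<le> \<alpha> * real n + 1" and mge: "\<alpha> * real n - 1 \<le> real (m n)" using m[of n] by linarith+
    have "real (m n) * \<tau> \<le> (\<alpha> * real n + 1) * \<tau>" using mle \<tau>0 by (intro mult_right_mono) auto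
    also have "\<dots> \<le> r'\<^sup>2 * real n"
      using n1(3) \<alpha>\<tau> by (simp add: divide_le_eq algebra_simps)
    finally have "sqrt (real (m n) * \<tau>) \<le> sqrt (r'\<^sup>2 * real n)" by (rule real_sqrt_le_mono)
    also have "\<dots> = r' * sqrt (real n)" using r by (simp add: real_sqrt_mult)
    finally have "sqrt (real (m n) * \<tau>) + t * sqrt (real n) \<le> (r' + t) * sqrt (real n)" by (simp add: distrib_right)
    also have "\<dots> < r * sqrt (real n)" using r n0 by (intro mult_strict_right_mono) auto
    finally have num: "sqrt (real (m n) * \<tau>) + t * sqrt (real n) < sqrt (real n) * (\<nu> / (\<rho> * sqrt \<beta>))"
      unfolding \<nu>r by (simp add: mult.commute)
    define K where "K = gindices (m n) n"
    define L1 where "L1 = (\<lambda>j. Inr (Inl j) :: gindex) ` {..<n}"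
    define L2 where "L2 = (\<lambda>i. Inr (Inr i) :: gindex) ` {..<m n}"
    have sub: "finite K" "L1 \<subseteq> K" "L2 \<subseteq> K" "Inl None \<in> K"
      by (auto simp: L1_def L2_def K_def gindices_def)
    have card: "card L1 = n" "card L2 = m n" unfolding L1_def L2_def by (simp_all add: card_image inj_on_def)
    have expo: "exp (- b * real n) \<le> exp (- a * real n)" if "a \<le> b" for b
      using that by (simp add: mult_right_mono)
    have b1: "sum_tail K L1 (\<lambda>y. (clip \<gamma> y)\<^sup>2) (\<beta> * \<rho>\<^sup>2) \<le> exp (- a * real n)"
      using a1(2)[OF sub(1,2)] expo[OF a(2)] unfolding card by linarith
    have b2: "sum_tail K L1 (\<lambda>y. - (y * clip \<gamma> y)) (- \<nu>) \<le> exp (- a * real n)"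
      using a2(2)[OF sub(1,2)] expo[OF a(3)] unfolding card by linarith
    have b3: "sum_tail K L2 (\<lambda>y. (max 0 (c - y))\<^sup>2) \<tau> \<le> exp a3 * exp (- a * real n)"
    proof -
      have "a3 * (\<alpha> * real n - 1) \<le> a3 * real (m n)" using mge a3(1) by (intro mult_left_mono) auto
      moreover have "a * real n \<le> a3 * \<alpha> * real n" using a(4) by (intro mult_right_mono) auto
      ultimately have "- a3 * real (m n) \<le> a3 + - a * real n" by (simp add: algebra_simps)
      then have "exp (- a3 * real (m n)) \<le> exp a3 * exp (- a * real n)" by (simp only: exp_add[symmetric] exp_le_cancel_iff)
      then show ?thesis using a3(2)[OF sub(1,3)] unfolding card by linarith
    qed
    have b4: "\<P>(w in gaussK K. w (Inl None) \<ge> t * sqrt (real n)) \<le> C4 * exp (- a * real n)"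
    proof -
      have "(t * sqrt (real n))\<^sup>2 / 4 = t\<^sup>2 / 4 * real n" by (simp add: power_mult_distrib)
      then have "exp (- ((t * sqrt (real n))\<^sup>2 / 4)) \<le> exp (- a * real n)" using expo[OF a(5)] by simp
      then have "C4 * exp (- ((t * sqrt (real n))\<^sup>2 / 4)) \<le> C4 * exp (- a * real n)" using C4(1) by (intro mult_left_mono) auto
      moreover have "0 \<le> t * sqrt (real n)" using r by simp
      ultimately show ?thesis using C4(2)[OF sub(4)] by (meson order_trans)
    qed
    have "\<P>(w in gaussK K. feasible_at \<kappa> (m n) n (gmatrix w) \<beta>)
       \<ge> 1 - sum_tail K L1 (\<lambda>y. (clip \<gamma> y)\<^sup>2) (\<beta> * \<rho>\<^sup>2)
        - sum_tail K L1 (\<lambda>y. - (y * clip \<gamma> y)) (- \<nu>)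
        - sum_tail K L2 (\<lambda>y. (max 0 (c - y))\<^sup>2) \<tau>
        - \<P>(w in gaussK K. w (Inl None) \<ge> t * sqrt (real n))"
      unfolding K_def L1_def L2_def c_def
      by (rule feasible_prob_lower_bound[OF \<kappa> \<beta> \<gamma> less_imp_le[OF \<rho>] n0 less_imp_le[OF r(4)] c\<tau>[unfolded c_def] num])
    moreover have "C * exp (- a * real n) = exp (- a * real n) + exp (- a * real n) + exp a3 * exp (- a * real n) + C4 * exp (- a * real n)"
      by (simp add: C_def distrib_right)
    ultimately show ?thesis using b1 b2 b3 b4 m0 n0 unfolding K_def[symmetric] by linarith
  qed
  show ?thesis
    by (rule exI[of _ C], rule conjI[OF C], rule exI[of _ a], rule conjI[OF a(1)], rule exI[of _ N0]) (use main in blast)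
qed

text \<open>Enlarging the constant by \<open>exp (a * real N0)\<close> makes the lower bound
  nonpositive for n < N0, where nonnegativity of \<open>p\<close> is all that is known.\<close>

lemma exp_lower_bound_all_n:
  fixes p :: "nat \<Rightarrow> real"
  assumes C: "C > 0" and a: "a > 0" and p: "\<And>n. n \<ge> N0 \<Longrightarrow> p n \<ge> 1 - C * exp (- a * real n)" and p0: "\<And>n. p n \<ge> 0"
  shows "\<exists>c>0. \<exists>C>0. \<forall>n. p n \<ge> 1 - C * exp (- c * real n)"
proof (intro exI conjI allI)
  show "a > 0" by (rule a)
  show "C + exp (a * real N0) > 0" using C by (simp add: add_pos_pos)
  fix n
  show "p n \<ge> 1 - (C + exp (a * real N0)) * exp (- a * real n)"
  proof (cases "n \<ge> N0")
    case True
    have "0 \<le> exp (a * real N0) * exp (- a * real n)" by simp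
    then show ?thesis using p[OF True] by (simp only: distrib_right)
  next
    case False
    have "0 \<le> a * real N0 + - a * real n" using False a by (simp add: mult_left_mono)
    then have "1 \<le> exp (a * real N0) * exp (- a * real n)" by (simp add: exp_add[symmetric])
    moreover have "0 \<le> C * exp (- a * real n)" using C by simp
    ultimately have "1 \<le> (C + exp (a * real N0)) * exp (- a * real n)" unfolding distrib_right by linarith
    then show ?thesis using p0[of n] by linarith
  qed
qed

lemma tendsto_1_of_exp_bound:
  fixes p :: "nat \<Rightarrow> real"
  assumes "a > 0" "\<And>n. n \<ge> N0 \<Longrightarrow> p n \<ge> 1 - C * exp (- a * real n)" "\<And>n. n \<ge> N0 \<Longrightarrow> p n \<le> 1"
  shows "p \<longlonglongrightarrow> 1"
proof (rule tendsto_sandwich)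
  show "\<forall>\<^sub>F n in sequentially. 1 - C * exp (- a * real n) \<le> p n" "\<forall>\<^sub>F n in sequentially. p n \<le> 1"
    using assms(2,3) eventually_sequentially by blast+
  have "(\<lambda>n. exp (- a * real n)) \<longlonglongrightarrow> 0" using assms(1) by real_asymp
  from tendsto_diff[OF tendsto_const tendsto_mult[OF tendsto_const[of C] this]]
  show "(\<lambda>n. 1 - C * exp (- a * real n)) \<longlonglongrightarrow> 1" by simp
qed simp

lemma f_gar_forms:
  assumes \<beta>: "\<beta> > 0"
  shows "f_gar (\<kappa> / sqrt \<beta>) = \<kappa> * exp (- (\<kappa>\<^sup>2 / (2 * \<beta>))) / sqrt (2 * \<beta> * pi)
          + (\<kappa>\<^sup>2 / \<beta> + 1) * erfc (- (\<kappa> / sqrt (2 * \<beta>))) / 2"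
proof -
  have 1: "sqrt 2 * (- (\<kappa> / sqrt (2 * \<beta>))) = - (\<kappa> / sqrt \<beta>)" by (simp add: real_sqrt_mult)
  have 2: "(\<kappa> / sqrt \<beta>)\<^sup>2 = \<kappa>\<^sup>2 / \<beta>" using \<beta> by (simp add: power_divide)
  have "\<kappa> / sqrt \<beta> * std_normal_density (\<kappa> / sqrt \<beta>) = \<kappa> * exp (- (\<kappa>\<^sup>2 / (2 * \<beta>))) / sqrt (2 * \<beta> * pi)"
    unfolding std_normal_density_def 2 by (simp add: real_sqrt_mult mult_ac)
  then show ?thesis unfolding f_gar_closed erfc_eq_Q_tail 1 2 by simp
qed

theorem theorem11:
  fixes \<alpha> \<kappa> \<epsilon>1m \<epsilon>1n \<epsilon>5g :: real
    and m :: "nat \<Rightarrow> nat"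
    and M :: "nat \<Rightarrow> 'w measure"
    and H :: "nat \<Rightarrow> 'w \<Rightarrow> nat \<Rightarrow> nat \<Rightarrow> real"
  assumes "\<alpha> > 0" and "\<kappa> > 0"
    and "\<epsilon>1m > 0" and "\<epsilon>1n > 0" and "\<epsilon>5g > 0"
    and "\<And>n. \<bar>real (m n) - \<alpha> * real n\<bar> < 1"
    and "\<And>n. iid_std_normal_matrix (M n) (m n) n (H n)"
  shows
    "(\<forall>\<beta>\<in>{0<..1}.
        f_gar (\<kappa> / sqrt \<beta>) =
          1 / sqrt (2 * pi) *
            (LBINT z:{..\<kappa> / sqrt \<beta>}. (z - \<kappa> / sqrt \<beta>)\<^sup>2 * exp (- (z\<^sup>2 / 2))) \<and>
        f_gar (\<kappa> / sqrt \<beta>) =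
          \<kappa> * exp (- (\<kappa>\<^sup>2 / (2 * \<beta>))) / sqrt (2 * \<beta> * pi)
          + (\<kappa>\<^sup>2 / \<beta> + 1) * erfc (- (\<kappa> / sqrt (2 * \<beta>))) / 2)
     \<and>
     (\<forall>n. (\<forall>\<beta>\<in>{0<..1}. (\<lambda>w. xi_box_r_at \<kappa> (m n) n (H n w) \<beta>) \<in> borel_measurable (M n)) \<and>
          (\<lambda>w. xi_box_r \<kappa> (m n) n (H n w)) \<in> borel_measurable (M n) \<and>
          (\<lambda>w. xi_box \<kappa> (m n) n (H n w)) \<in> borel_measurable (M n))
     \<and>
     (\<forall>\<beta>\<in>{0<..1}. feasibility_margin \<alpha> \<kappa> \<epsilon>1m \<epsilon>1n \<epsilon>5g \<beta> > 0 \<longrightarrow>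
        (\<lambda>n. \<P>(w in M n. xi_box_r_at \<kappa> (m n) n (H n w) \<beta> > 0)) \<longlonglongrightarrow> 0 \<and>
        (\<lambda>n. \<P>(w in M n. xi_box_r_at \<kappa> (m n) n (H n w) \<beta> \<le> 0)) \<longlonglongrightarrow> 1)
     \<and>
     ((SUP \<beta>\<in>{0<..1}. feasibility_margin \<alpha> \<kappa> \<epsilon>1m \<epsilon>1n \<epsilon>5g \<beta>) > 0 \<longrightarrow>
        (\<lambda>n. \<P>(w in M n. xi_box_r \<kappa> (m n) n (H n w) > 0)) \<longlonglongrightarrow> 0 \<and>
        (\<lambda>n. \<P>(w in M n. xi_box \<kappa> (m n) n (H n w) > 0)) \<longlonglongrightarrow> 0 \<and>
        (\<exists>c>0. \<exists>C>0. \<forall>n.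
           \<P>(w in M n. box_feasible \<kappa> (m n) n (H n w)) \<ge> 1 - C * exp (- c * real n)))"
proof -
  note \<kappa> = assms(2) and H = assms(7)
  have P: "prob_space (M n)" for n using H[of n] unfolding iid_std_normal_matrix_def by simp
  note entry = measurable_matrix_entry[OF H]
  have meas: "(\<lambda>w. xi_box_r_at \<kappa> (m n) n (H n w) \<beta>) \<in> borel_measurable (M n)" if "\<beta> > 0" for n \<beta>
    by (rule borel_measurable_Lipschitz_entries[OF xi_box_r_at_Lipschitz[OF \<kappa> that] entry])
  have meas_r: "(\<lambda>w. xi_box_r \<kappa> (m n) n (H n w)) \<in> borel_measurable (M n)" for n
    by (rule borel_measurable_Lipschitz_entries[OF xi_box_r_Lipschitz[OF \<kappa>] entry])
  have meas_b: "(\<lambda>w. xi_box \<kappa> (m n) n (H n w)) \<in> borel_measurable (M n)" for n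
    by (rule borel_measurable_Lipschitz_entries[OF xi_box_Lipschitz[OF \<kappa>] entry])
  have key: "\<exists>C>0. \<exists>a>0. \<exists>N0. \<forall>n\<ge>N0. m n > 0 \<and> n > 0 \<and>
      \<P>(w in M n. xi_box_r_at \<kappa> (m n) n (H n w) \<beta> \<le> 0) \<ge> 1 - C * exp (- a * real n)"
    if \<beta>: "\<beta> \<in> {0<..1}" and margin: "feasibility_margin \<alpha> \<kappa> \<epsilon>1m \<epsilon>1n \<epsilon>5g \<beta> > 0" for \<beta>
  proof -
    have b0: "\<beta> > 0" using \<beta> by simp
    obtain \<gamma> where \<gamma>: "\<gamma> > 0" "clip_energy \<gamma> \<le> \<beta>" "sqrt (\<alpha> * f_gar (\<kappa> / sqrt \<beta>)) < clip_corr \<gamma> / sqrt \<beta>"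
      using feasibility_margin_witness[OF \<beta> assms(1-5) margin] by blast
    obtain C a N0 where *: "C > 0" "a > 0" "\<And>n. n \<ge> N0 \<Longrightarrow> m n > 0 \<and> n > 0 \<and>
      \<P>(w in gaussK (gindices (m n) n). feasible_at \<kappa> (m n) n (gmatrix w) \<beta>) \<ge> 1 - C * exp (- a * real n)"
      using feasible_prob_exponential[OF assms(1) \<kappa> b0 \<gamma>(1) assms(6) \<gamma>(2,3)] by blast
    have "m n > 0 \<and> n > 0 \<and> \<P>(w in M n. xi_box_r_at \<kappa> (m n) n (H n w) \<beta> \<le> 0) \<ge> 1 - C * exp (- a * real n)"
      if n: "n \<ge> N0" for n
    proof -
      have pos: "m n > 0" "n > 0" using *(3)[OF n] by auto
      have "\<P>(w in M n. xi_box_r_at \<kappa> (m n) n (H n w) \<beta> \<le> 0)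
        = \<P>(w in gaussK (gindices (m n) n). xi_box_r_at \<kappa> (m n) n (gmatrix w) \<beta> \<le> 0)"
        by (rule matrix_law[OF xi_box_r_at_Lipschitz[OF \<kappa> b0] H pos])
      then show ?thesis using *(3)[OF n] unfolding xi_box_r_at_le_0_iff[OF \<kappa> b0] by simp
    qed
    then show ?thesis using *(1,2) by blast
  qed
  \<comment> \<open>From \<open>N0\<close> on, the event for \<open>f\<close> lies in the complement
    of the measurable event for \<open>g\<close>. The threshold serves the sphere version, where the
    implication is available once \<open>m n > 0\<close> and \<open>n > 0\<close>.\<close>
  have to0: "(\<lambda>n. \<P>(w in M n. f n w > 0)) \<longlonglongrightarrow> 0"
    if lim: "(\<lambda>n. \<P>(w in M n. g n w \<le> 0)) \<longlonglongrightarrow> 1"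
      and g: "\<And>n. g n \<in> borel_measurable (M n)"
      and le: "\<And>n w. n \<ge> N0 \<Longrightarrow> g n w \<le> 0 \<Longrightarrow> f n w \<le> 0"
    for f g :: "nat \<Rightarrow> 'w \<Rightarrow> real" and N0
  proof (rule tendsto_sandwich[OF _ _ tendsto_const])
    show "\<forall>\<^sub>F n in sequentially. \<P>(w in M n. f n w > 0) \<le> 1 - \<P>(w in M n. g n w \<le> 0)"
    proof (rule eventually_sequentiallyI)
      fix n assume n: "n \<ge> N0"
      interpret prob_space "M n" by (rule P)
      have [measurable]: "g n \<in> borel_measurable (M n)" by (rule g)
      have "{w \<in> space (M n). f n w > 0} \<subseteq> space (M n) - {w \<in> space (M n). g n w \<le> 0}"
        using le[OF n] by (auto simp: not_le[symmetric])
      then have "prob {w \<in> space (M n). f n w > 0} \<le> prob (space (M n) - {w \<in> space (M n). g n w \<le> 0})"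
        by (rule finite_measure_mono) measurable
      also have "\<dots> = 1 - prob {w \<in> space (M n). g n w \<le> 0}" by (rule prob_compl) measurable
      finally show "\<P>(w in M n. f n w > 0) \<le> 1 - \<P>(w in M n. g n w \<le> 0)" .
    qed
    show "(\<lambda>n. 1 - \<P>(w in M n. g n w \<le> 0)) \<longlonglongrightarrow> 0"
      using tendsto_diff[OF tendsto_const[of 1] lim] by simp
  qed simp
  have le1: "\<P>(w in M n. Q w) \<le> 1" for n Q
    using prob_space.prob_le_1[OF P] .
  have lim: "(\<lambda>n. \<P>(w in M n. xi_box_r_at \<kappa> (m n) n (H n w) \<beta> \<le> 0)) \<longlonglongrightarrow> 1"
    if \<beta>: "\<beta> \<in> {0<..1}" "feasibility_margin \<alpha> \<kappa> \<epsilon>1m \<epsilon>1n \<epsilon>5g \<beta> > 0" for \<beta>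
  proof -
    obtain C a N0 where *: "a > 0" "\<And>n. n \<ge> N0 \<Longrightarrow>
        \<P>(w in M n. xi_box_r_at \<kappa> (m n) n (H n w) \<beta> \<le> 0) \<ge> 1 - C * exp (- a * real n)"
      using key[OF \<beta>] by blast
    show ?thesis by (rule tendsto_1_of_exp_bound[OF *]) (simp_all only: le1)
  qed
  have part4: "(\<lambda>n. \<P>(w in M n. xi_box_r \<kappa> (m n) n (H n w) > 0)) \<longlonglongrightarrow> 0 \<and>
        (\<lambda>n. \<P>(w in M n. xi_box \<kappa> (m n) n (H n w) > 0)) \<longlonglongrightarrow> 0 \<and>
        (\<exists>c>0. \<exists>C>0. \<forall>n.
           \<P>(w in M n. box_feasible \<kappa> (m n) n (H n w)) \<ge> 1 - C * exp (- c * real n))"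
    if sup: "(SUP \<beta>\<in>{0<..1}. feasibility_margin \<alpha> \<kappa> \<epsilon>1m \<epsilon>1n \<epsilon>5g \<beta>) > 0"
  proof -
    \<comment> \<open>A positive supremum has a positive member, whether or not it is attained, so a
      single \<beta> carries the rest.\<close>
    have "\<exists>\<beta>\<in>{0<..1}. feasibility_margin \<alpha> \<kappa> \<epsilon>1m \<epsilon>1n \<epsilon>5g \<beta> > 0"
    proof (rule ccontr)
      assume "\<not> ?thesis"
      then have "(SUP \<beta>\<in>{0<..1}. feasibility_margin \<alpha> \<kappa> \<epsilon>1m \<epsilon>1n \<epsilon>5g \<beta>) \<le> 0"
        by (intro cSUP_least) (auto simp: not_less)
      then show False using sup by simp
    qed
    then obtain \<beta> where \<beta>: "\<beta> \<in> {0<..1}" "feasibility_margin \<alpha> \<kappa> \<epsilon>1m \<epsilon>1n \<epsilon>5g \<beta> > 0" by blast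
    then have b0: "\<beta> > 0" by simp
    obtain C a N0 where *: "C > 0" "a > 0" "\<And>n. n \<ge> N0 \<Longrightarrow> m n > 0 \<and> n > 0 \<and>
        \<P>(w in M n. xi_box_r_at \<kappa> (m n) n (H n w) \<beta> \<le> 0) \<ge> 1 - C * exp (- a * real n)"
      using key[OF \<beta>] by blast
    have box: "box_feasible \<kappa> (m n) n (H n w)" if "xi_box_r_at \<kappa> (m n) n (H n w) \<beta> \<le> 0" for n w
      using that unfolding xi_box_r_at_le_0_iff[OF \<kappa> b0] by (rule feasible_at_imp_box_feasible[OF b0])
    have 1: "(\<lambda>n. \<P>(w in M n. xi_box_r \<kappa> (m n) n (H n w) > 0)) \<longlonglongrightarrow> 0"
    proof (rule to0[OF lim[OF \<beta>] meas[OF b0]])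
      fix n :: nat and w assume "xi_box_r_at \<kappa> (m n) n (H n w) \<beta> \<le> 0"
      moreover have "xi_box_r \<kappa> (m n) n (H n w) \<le> xi_box_r_at \<kappa> (m n) n (H n w) \<beta>"
        unfolding xi_box_r_def by (rule cINF_lower[OF xi_box_r_at_bdd_below[OF \<kappa>] \<beta>(1)])
      ultimately show "xi_box_r \<kappa> (m n) n (H n w) \<le> 0" by simp
    qed
    have 2: "(\<lambda>n. \<P>(w in M n. xi_box \<kappa> (m n) n (H n w) > 0)) \<longlonglongrightarrow> 0"
    proof (rule to0[OF lim[OF \<beta>] meas[OF b0]])
      fix n w assume "n \<ge> N0" "xi_box_r_at \<kappa> (m n) n (H n w) \<beta> \<le> 0"
      then show "xi_box \<kappa> (m n) n (H n w) \<le> 0"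
        using *(3)[of n] box[of n w] by (intro box_feasible_imp_xi_box_le_0 \<kappa>) auto
    qed
    have 3: "\<exists>c>0. \<exists>C>0. \<forall>n. \<P>(w in M n. box_feasible \<kappa> (m n) n (H n w)) \<ge> 1 - C * exp (- c * real n)"
    proof (rule exp_lower_bound_all_n[OF *(1,2)])
      fix n assume n: "n \<ge> N0"
      interpret prob_space "M n" by (rule P)
      have pos: "n > 0" using *(3)[OF n] by simp
      have [measurable]: "(\<lambda>w. xi_box_r_at \<kappa> (m n) n (H n w) 1) \<in> borel_measurable (M n)" by (rule meas) simp
      \<comment> \<open>The case \<beta> = 1 of the sign characterisation makes box feasibility a
        sublevel event, and so provides the measurability that monotonicity of the measure
        requires.\<close>
      have eq: "{w \<in> space (M n). box_feasible \<kappa> (m n) n (H n w)} = {w \<in> space (M n). xi_box_r_at \<kappa> (m n) n (H n w) 1 \<le> 0}"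
        using xi_box_r_at_le_0_iff[OF \<kappa> zero_less_one] feasible_at_1_iff[OF pos] by simp
      have "prob {w \<in> space (M n). xi_box_r_at \<kappa> (m n) n (H n w) \<beta> \<le> 0} \<le> prob {w \<in> space (M n). box_feasible \<kappa> (m n) n (H n w)}"
      proof (rule finite_measure_mono)
        show "{w \<in> space (M n). xi_box_r_at \<kappa> (m n) n (H n w) \<beta> \<le> 0} \<subseteq> {w \<in> space (M n). box_feasible \<kappa> (m n) n (H n w)}"
          using box by blast
        show "{w \<in> space (M n). box_feasible \<kappa> (m n) n (H n w)} \<in> events" unfolding eq by measurable
      qed
      then show "\<P>(w in M n. box_feasible \<kappa> (m n) n (H n w)) \<ge> 1 - C * exp (- a * real n)"
        using *(3)[OF n] by linarith
    qed simp
    show ?thesis using 1 2 3 by blast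
  qed
  show ?thesis
  proof (intro conjI ballI allI impI, goal_cases)
    case (1 \<beta>)
    show ?case by (rule f_gar_reflect)
  next
    case (2 \<beta>)
    then show ?case by (intro f_gar_forms) simp
  next
    case (3 n \<beta>)
    then show ?case by (intro meas) simp
  next
    case (4 n)
    show ?case by (rule meas_r)
  next
    case (5 n)
    show ?case by (rule meas_b)
  next
    case (6 \<beta>)
    then show ?case by (intro to0[OF lim meas]) simp_all
  next
    case (7 \<beta>)
    then show ?case by (rule lim)
  next
    case 8
    then show ?case using part4 by blast
  next
    case 9
    then show ?case using part4 by blast
  next
    case 10
    then show ?case using part4 by blast
  qed
qed

end
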